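(* Let $\rho>0$, $\kappa=0.1$, $\varepsilon>0$, and let $$\sigma = 1-\frac{\ln\gamma}{2\sqrt{\nu}+\ln\gamma},\qquad \gamma=\frac{2\kappa+\sqrt2}{\kappa+\sqrt2}.$$ Suppose that the initial point $v^{(0)}$ is generated by Algorithm 1 (described in the context) with smoothing parameter $\mu^{(0)}>0$. Then Algorithm 2 (described in the context), started from $v^{(0)}$ and $\mu^{(0)}$ and run with the parameters $\rho$, $\sigma = 1-\frac{\ln\gamma}{2\sqrt{\nu}+\ln\gamma}$ and $\varepsilon$, requires at most $O\big(\sqrt{\nu}\,\ln(\mu^{(0)}/\varepsilon)\big)$ iterations to attain the desired accuracy $\varepsilon$.
   Context: Setting. $(\mathbb E,\circ)$ is a Euclidean Jordan algebra of rank $\nu$ with identity $e$ and inner product $\langle x,y\rangle=\operatorname{tr}(x\circ y)$; $\mathbb K\subseteq\mathbb E$ is its symmetric cone (cone of squares), so $\operatorname{int}(\mathbb K)$ is the set of elements with all eigenvalues positive. $\mathcal A:\mathbb E\to\mathbb R^m$ is linear and surjective with adjoint $\mathcal A^*$, $b\in\mathbb R^m$, $c\in\mathbb E$. The primal-dual pair is $\min\{\langle c,x\rangle:\mathcal Ax=b,\,x\in\mathbb K\}$ and $\max\{\langle b,\lambda\rangle:\mathcal A^*\lambda+s=c,\,s\in\mathbb K\}$, and the Slater condition is assumed for both (there are $x\in\operatorname{int}(\mathbb K)$ with $\mathcal Ax=b$ and $(\lambda,s)$ with $s\in\operatorname{int}(\mathbb K)$, $\mathcal A^*\lambda+s=c$).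 Barrier and proximal point. $\phi(z)=-\ln\det z$ on $\operatorname{int}(\mathbb K)$. For $\mu,\rho>0$ and $x,s\in\mathbb E$, $z_\rho(x,s;\mu)$ is the unique minimizer over $z\in\operatorname{int}(\mathbb K)$ of $\mu\phi(z)+\langle s,z\rangle+\frac\rho2\|z-x\|^2$. Put $\mathcal W=\frac\mu\rho D^2\phi(z_\rho(x,s;\mu))$, $\mathcal H=\mathcal I+\mathcal W$ (linear operators on $\mathbb E$), and $\Phi_\rho(x,s;\mu)=2(x-z_\rho(x,s;\mu))$. Reduced BAL function. Fix $\bar x\in\mathbb E$ with $\mathcal A\bar x=b$, a Euclidean space $\hat{\mathbb E}$ with $\dim\hat{\mathbb E}=\dim\ker\mathcal A$, and an injective linear $\mathcal B:\hat{\mathbb E}\to\mathbb E$ with $\mathcal A\mathcal B=0$, $\mathcal B^*\mathcal B=\mathcal I$. Every $x$ with $\mathcal Ax=b$ is uniquely $x=\bar x+\mathcal B\hat x$. For $w=(\hat x,s)\in\hat{\mathbb E}\times\mathbb E$, $x=\bar x+\mathcal B\hat x$, $$\eta_\rho(w;\mu)=\min_{z\in\operatorname{int}(\mathbb K)}\Big\{\langle c,x\rangle+\mu\phi(z)+\langle s,z-x\rangle+\tfrac\rho2\|z-x\|^2\Big\}.$$ It is smooth, strictly convex in $\hat x$ and strictly concave in $s$. For $h=(h_{\hat x},h_s)$ let $S_{\eta_\rho}(w;\mu)[h,h]=D^2_{\hat x\hat x}\eta_\rho(w;\mu)[h_{\hat x},h_{\hat x}]-D^2_{ss}\eta_\rho(w;\mu)[h_s,h_s]$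 and $\|h\|_{\eta_\rho,w}=\sqrt{\frac1\mu S_{\eta_\rho}(w;\mu)[h,h]}$. Let $\delta_\rho(w;\mu)=\|(D^2_{ww}\eta_\rho(w;\mu))^{-1}\nabla_w\eta_\rho(w;\mu)\|_{\eta_\rho,w}$, $\xi_\rho(w;\mu)=\Big(\frac1\mu\langle\nabla_{\hat x}\eta_\rho,(D^2_{\hat x\hat x}\eta_\rho)^{-1}\nabla_{\hat x}\eta_\rho\rangle-\frac1\mu\langle\nabla_s\eta_\rho,(D^2_{ss}\eta_\rho)^{-1}\nabla_s\eta_\rho\rangle\Big)^{1/2}$ (derivatives at $(w;\mu)$), $\theta_\rho(w;\mu)=\max_{\tilde s}\eta_\rho(\hat x,\tilde s;\mu)-\min_{\tilde x}\eta_\rho(\tilde x,s;\mu)$, and $K(\theta_\rho)=\{w:\theta_\rho(w;\mu)<+\infty\}$ (with $\mu=\mu^{(0)}$ below). The neighborhood is $$\mathcal N(\kappa,\mu,\rho)=\{(x,s,\lambda):\mathcal Ax=b,\ \mathcal A^*\lambda+s=c,\ \xi_\rho(w;\mu)\le\kappa\},$$ with $w=(\mathcal B^*(x-\bar x),s)$. Newton systems. For $v=(x,s,\lambda)$ and $\Delta v=(\Delta x,\Delta s,\Delta\lambda)$, system (N) at $(v,\mu)$ is $\mathcal A\Delta x=-(\mathcal Ax-b)$, $\ \Delta s+\mathcal A^*\Delta\lambda=-(\mathcal A^*\lambda+s-c)$, $\ \mathcal H^{-1}\mathcal W\Delta x+\rho^{-1}\mathcal H^{-1}\Delta s=-(x-z_\rho)$.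 System (N$_t$) is the same with the right-hand sides replaced by $-(\mathcal Ax-b)$, $\ -(\mathcal A^*\lambda+s-c)+t(\mathcal A^*\lambda^{(0,0)}+s^{(0,0)}-c)$, $\ -(x-z_\rho)+t(x^{(0,0)}-z_\rho^{(0,0)})$, where $z_\rho^{(0,0)}=z_\rho(x^{(0,0)},s^{(0,0)};\mu^{(0)})$. Algorithm 1 (first phase; $\kappa=0.1$). Input: $w^{(0,0)}=(\hat x^{(0,0)},s^{(0,0)})\in K(\theta_\rho)$, $\lambda^{(0,0)}\in\mathbb R^m$, $\rho>0$, $\mu^{(0)}>0$, $t^{(0)}\in(0,1]$ with $(1-t^{(0)})\delta_\rho(w^{(0,0)};\mu^{(0)})\le\kappa/2$; $x^{(0,0)}=\bar x+\mathcal B\hat x^{(0,0)}$, $v^{(0,0)}=(x^{(0,0)},s^{(0,0)},\lambda^{(0,0)})$. For $j=0,1,2,\dots$ (with $w^{(0,j)}=(\mathcal B^*(x^{(0,j)}-\bar x),s^{(0,j)})$): if $\delta_\rho(w^{(0,j)};\mu^{(0)})\le\kappa$, solve (N) at $(v^{(0,j)},\mu^{(0)})$ and return $v^{(0)}=v^{(0,j)}+\Delta v^{(0,j)}$. Otherwise set $$\alpha^{(j)}=\min\Big\{\frac{\kappa}{4t^{(j)}\|(D^2_{ww}\eta_\rho(w^{(0,j)};\mu^{(0)}))^{-1}\nabla_w\eta_\rho(w^{(0,0)};\mu^{(0)})\|_{\eta_\rho,w^{(0,j)}}},1\Big\},$$ $t^{(j+1)}=(1-\alpha^{(j)})t^{(j)}$,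 solve (N$_t$) at $(v^{(0,j)},\mu^{(0)})$ with $t=t^{(j+1)}$, and set $v^{(0,j+1)}=v^{(0,j)}+\Delta v^{(0,j)}$. Algorithm 2 (second phase). Input: $v^{(0)}\in\mathcal N(\kappa,\mu^{(0)},\rho)$, $\rho>0$, $\mu^{(0)}>0$, $\varepsilon>0$, $\sigma\in(0,1)$. For $k=0,1,2,\dots$: if $\mu^{(k)}\le\varepsilon$, return $v^{(k)}$. Otherwise set $\mu^{(k+1)}=\sigma\mu^{(k)}$, solve (N) at $(v^{(k)},\mu^{(k+1)})$, and set $v^{(k+1)}=v^{(k)}+\Delta v^{(k)}$. Accuracy. Attaining accuracy $\varepsilon$ means that Algorithm 2 terminates, i.e. $\mu^{(k)}\le\varepsilon$, with an approximate KKT triple $(x^{(k)},s^{(k)},\lambda^{(k)})$ satisfying $\mathcal Ax^{(k)}=b$, $\mathcal A^*\lambda^{(k)}+s^{(k)}=c$ and $\|\Phi_\rho(x^{(k)},s^{(k)};\mu^{(k)})\|\le2\kappa\sqrt{\varepsilon/\rho}$. Convention. The $O(\cdot)$ hides a universal constant independent of the problem data, $\rho$, $\mu^{(0)}$, $\varepsilon$; for $0<\varepsilon\le\mu^{(0)}$ the bound is read as at most $C(1+\sqrt\nu\ln(\mu^{(0)}/\varepsilon))$. *)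

theory Defs
  imports "HOL-Analysis.Analysis"
begin

section \<open>Gradients and Hessians\<close>

definition grad :: "('a::real_inner \<Rightarrow> real) \<Rightarrow> 'a \<Rightarrow> 'a" where
  "grad f x = (THE D. GDERIV f x :> D)"

text \<open>The Hessian as a linear operator: the bilinear form $D^2 f(x)[h,k]$ is
  \<open>h \<bullet> hess f x k\<close>.\<close>

definition hess :: "('a::real_inner \<Rightarrow> real) \<Rightarrow> 'a \<Rightarrow> 'a \<Rightarrow> 'a" where
  "hess f x = frechet_derivative (grad f) (at x)"

section \<open>Euclidean Jordan algebras\<close>

locale jordan_product =
  fixes jmul :: "'e::euclidean_space \<Rightarrow> 'e \<Rightarrow> 'e"  (infixl \<open>\<diamondop>\<close> 70)
    and e :: 'e
begin

fun jpow :: "'e \<Rightarrow> nat \<Rightarrow> 'e" where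
  "jpow x 0 = e"
| "jpow x (Suc n) = x \<diamondop> jpow x n"

text \<open>Degree of the minimal polynomial of \<open>x\<close>. Linear dependence is that of the family
  $e, x, \dots, x^k$, not of the set of its members, which may coincide.\<close>

definition jdegree :: "'e \<Rightarrow> nat" where
  "jdegree x = (LEAST k. k > 0 \<and>
     (\<exists>a::nat \<Rightarrow> real. (\<exists>i\<le>k. a i \<noteq> 0) \<and> (\<Sum>i\<le>k. a i *\<^sub>R jpow x i) = 0))"

definition jrank :: nat where
  "jrank = Max (range jdegree)"

definition idempotent :: "'e \<Rightarrow> bool" where
  "idempotent u \<longleftrightarrow> u \<diamondop> u = u"

definition primitive_idempotent :: "'e \<Rightarrow> bool" where
  "primitive_idempotent u \<longleftrightarrow> idempotent u \<and> u \<noteq> 0 \<and>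
     \<not> (\<exists>u1 u2. idempotent u1 \<and> idempotent u2 \<and> u1 \<noteq> 0 \<and> u2 \<noteq> 0 \<and>
           u1 \<diamondop> u2 = 0 \<and> u = u1 + u2)"

definition jordan_frame :: "(nat \<Rightarrow> 'e) \<Rightarrow> bool" where
  "jordan_frame f \<longleftrightarrow>
     (\<forall>i<jrank. primitive_idempotent (f i)) \<and>
     (\<forall>i<jrank. \<forall>j<jrank. i \<noteq> j \<longrightarrow> f i \<diamondop> f j = 0) \<and>
     (\<Sum>i<jrank. f i) = e"

text \<open>\<open>ev 0, \<dots>, ev (jrank - 1)\<close> are the eigenvalues of \<open>x\<close>, with multiplicity.\<close>

definition spectral_decomposition :: "'e \<Rightarrow> (nat \<Rightarrow> real) \<Rightarrow> (nat \<Rightarrow> 'e) \<Rightarrow> bool" where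
  "spectral_decomposition x ev f \<longleftrightarrow>
     jordan_frame f \<and> x = (\<Sum>i<jrank. ev i *\<^sub>R f i)"

definition jtrace :: "'e \<Rightarrow> real" where
  "jtrace x = (THE r. \<exists>ev f. spectral_decomposition x ev f \<and> r = (\<Sum>i<jrank. ev i))"

definition jdet :: "'e \<Rightarrow> real" where
  "jdet x = (THE r. \<exists>ev f. spectral_decomposition x ev f \<and> r = (\<Prod>i<jrank. ev i))"

definition symcone :: "'e set" where
  "symcone = range (\<lambda>x. x \<diamondop> x)"

end

locale euclidean_jordan_algebra = jordan_product jmul e
  for jmul :: "'e::euclidean_space \<Rightarrow> 'e \<Rightarrow> 'e"  (infixl \<open>\<diamondop>\<close> 70) and e :: 'e +
  assumes jmul_bilinear: "bilinear jmul"
    and jmul_commute: "x \<diamondop> y = y \<diamondop> x"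
    and jordan_identity: "x \<diamondop> ((x \<diamondop> x) \<diamondop> y) = (x \<diamondop> x) \<diamondop> (x \<diamondop> y)"
    and jmul_unit: "e \<diamondop> x = x"
    and inner_associative: "(x \<diamondop> y) \<bullet> z = y \<bullet> (x \<diamondop> z)"
    and inner_eq_trace: "x \<bullet> y = jtrace (x \<diamondop> y)"
begin

definition barrier :: "'e \<Rightarrow> real" where
  "barrier z = - ln (jdet z)"

definition zprox :: "real \<Rightarrow> real \<Rightarrow> 'e \<Rightarrow> 'e \<Rightarrow> 'e" where
  "zprox rho mu x s =
     (THE z. is_arg_min (\<lambda>z. mu * barrier z + s \<bullet> z + rho / 2 * (norm (z - x))\<^sup>2)
               (\<lambda>z. z \<in> interior symcone) z)"

definition Wop :: "real \<Rightarrow> real \<Rightarrow> 'e \<Rightarrow> 'e \<Rightarrow> 'e \<Rightarrow> 'e" where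
  "Wop rho mu x s h = (mu / rho) *\<^sub>R hess barrier (zprox rho mu x s) h"

definition Hop :: "real \<Rightarrow> real \<Rightarrow> 'e \<Rightarrow> 'e \<Rightarrow> 'e \<Rightarrow> 'e" where
  "Hop rho mu x s h = h + Wop rho mu x s h"

definition Phi :: "real \<Rightarrow> real \<Rightarrow> 'e \<Rightarrow> 'e \<Rightarrow> 'e" where
  "Phi rho mu x s = 2 *\<^sub>R (x - zprox rho mu x s)"

end

section \<open>The primal-dual pair and the reduced BAL function\<close>

text \<open>The reduced space \<open>'h\<close> is only required to be a real inner product space, since class
  \<open>euclidean_space\<close> would exclude the case of a trivial kernel of \<open>A\<close>. It is
  finite-dimensional because \<open>B\<close> is injective.\<close>

locale bal_problem = euclidean_jordan_algebra jmul e
  for jmul :: "'e::euclidean_space \<Rightarrow> 'e \<Rightarrow> 'e"  (infixl \<open>\<diamondop>\<close> 70) and e :: 'e +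
  fixes A :: "'e \<Rightarrow> real ^ 'm"
    and b :: "real ^ 'm"
    and c :: 'e
    and xbar :: 'e
    and B :: "'h::real_inner \<Rightarrow> 'e"
  assumes A_linear: "linear A"
    and A_surj: "surj A"
    and primal_slater: "\<exists>x \<in> interior symcone. A x = b"
    and dual_slater: "\<exists>l. \<exists>s \<in> interior symcone. adjoint A l + s = c"
    and A_xbar: "A xbar = b"
    and B_linear: "linear B"
    and B_inj: "inj B"
    and dim_reduced: "dim (UNIV :: 'h set) = dim {x. A x = 0}"
    and A_B: "A (B y) = 0"
    and B_isometry: "adjoint B (B y) = y"
begin

definition eta :: "real \<Rightarrow> real \<Rightarrow> 'h \<times> 'e \<Rightarrow> real" where
  "eta rho mu w =
     (let x = xbar + B (fst w); s = snd w in
      INF z \<in> interior symcone.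
        c \<bullet> x + mu * barrier z + s \<bullet> (z - x) + rho / 2 * (norm (z - x))\<^sup>2)"

definition grad_x :: "real \<Rightarrow> real \<Rightarrow> 'h \<times> 'e \<Rightarrow> 'h" where
  "grad_x rho mu w = grad (\<lambda>y. eta rho mu (y, snd w)) (fst w)"

definition grad_s :: "real \<Rightarrow> real \<Rightarrow> 'h \<times> 'e \<Rightarrow> 'e" where
  "grad_s rho mu w = grad (\<lambda>s. eta rho mu (fst w, s)) (snd w)"

definition hess_xx :: "real \<Rightarrow> real \<Rightarrow> 'h \<times> 'e \<Rightarrow> 'h \<Rightarrow> 'h" where
  "hess_xx rho mu w = hess (\<lambda>y. eta rho mu (y, snd w)) (fst w)"

definition hess_ss :: "real \<Rightarrow> real \<Rightarrow> 'h \<times> 'e \<Rightarrow> 'e \<Rightarrow> 'e" where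
  "hess_ss rho mu w = hess (\<lambda>s. eta rho mu (fst w, s)) (snd w)"

definition Seta :: "real \<Rightarrow> real \<Rightarrow> 'h \<times> 'e \<Rightarrow> 'h \<times> 'e \<Rightarrow> real" where
  "Seta rho mu w h = fst h \<bullet> hess_xx rho mu w (fst h) - snd h \<bullet> hess_ss rho mu w (snd h)"

definition eta_norm :: "real \<Rightarrow> real \<Rightarrow> 'h \<times> 'e \<Rightarrow> 'h \<times> 'e \<Rightarrow> real" where
  "eta_norm rho mu w h = sqrt (1 / mu * Seta rho mu w h)"

definition delta :: "real \<Rightarrow> real \<Rightarrow> 'h \<times> 'e \<Rightarrow> real" where
  "delta rho mu w =
     eta_norm rho mu w (inv (hess (eta rho mu) w) (grad (eta rho mu) w))"

definition xi :: "real \<Rightarrow> real \<Rightarrow> 'h \<times> 'e \<Rightarrow> real" where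
  "xi rho mu w =
     sqrt (1 / mu * (grad_x rho mu w \<bullet> inv (hess_xx rho mu w) (grad_x rho mu w))
         - 1 / mu * (grad_s rho mu w \<bullet> inv (hess_ss rho mu w) (grad_s rho mu w)))"

text \<open>The difference is never of the form \<open>\<infinity> - \<infinity>\<close>: the supremum is at least, and the infimum
  at most, \<open>eta rho mu w\<close>.\<close>

definition theta :: "real \<Rightarrow> real \<Rightarrow> 'h \<times> 'e \<Rightarrow> ereal" where
  "theta rho mu w =
     (SUP s. ereal (eta rho mu (fst w, s))) - (INF y. ereal (eta rho mu (y, snd w)))"

definition Ktheta :: "real \<Rightarrow> real \<Rightarrow> ('h \<times> 'e) set" where
  "Ktheta rho mu = {w. theta rho mu w < \<infinity>}"

definition reduced :: "'e \<times> 'e \<times> (real ^ 'm) \<Rightarrow> 'h \<times> 'e" where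
  "reduced = (\<lambda>(x, s, l). (adjoint B (x - xbar), s))"

definition nbhd :: "real \<Rightarrow> real \<Rightarrow> real \<Rightarrow> ('e \<times> 'e \<times> (real ^ 'm)) set" where
  "nbhd kappa mu rho =
     {(x, s, l). A x = b \<and> adjoint A l + s = c \<and> xi rho mu (reduced (x, s, l)) \<le> kappa}"

section \<open>Newton systems\<close>

definition newtonN ::
  "real \<Rightarrow> real \<Rightarrow> 'e \<times> 'e \<times> (real ^ 'm) \<Rightarrow> 'e \<times> 'e \<times> (real ^ 'm) \<Rightarrow> bool" where
  "newtonN rho mu = (\<lambda>(x, s, l) (dx, ds, dl).
     A dx = - (A x - b) \<and>
     ds + adjoint A dl = - (adjoint A l + s - c) \<and>
     inv (Hop rho mu x s) (Wop rho mu x s dx) + (1 / rho) *\<^sub>R inv (Hop rho mu x s) ds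
       = - (x - zprox rho mu x s))"

definition newtonNt ::
  "real \<Rightarrow> real \<Rightarrow> 'e \<times> 'e \<times> (real ^ 'm) \<Rightarrow> real \<Rightarrow>
   'e \<times> 'e \<times> (real ^ 'm) \<Rightarrow> 'e \<times> 'e \<times> (real ^ 'm) \<Rightarrow> bool" where
  "newtonNt rho mu = (\<lambda>(x0, s0, l0) t (x, s, l) (dx, ds, dl).
     A dx = - (A x - b) \<and>
     ds + adjoint A dl
       = - (adjoint A l + s - c) + t *\<^sub>R (adjoint A l0 + s0 - c) \<and>
     inv (Hop rho mu x s) (Wop rho mu x s dx) + (1 / rho) *\<^sub>R inv (Hop rho mu x s) ds
       = - (x - zprox rho mu x s) + t *\<^sub>R (x0 - zprox rho mu x0 s0))"

section \<open>The two phases\<close>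

definition alg1_alpha ::
  "real \<Rightarrow> real \<Rightarrow> real \<Rightarrow> 'e \<times> 'e \<times> (real ^ 'm) \<Rightarrow>
   'e \<times> 'e \<times> (real ^ 'm) \<Rightarrow> real \<Rightarrow> real" where
  "alg1_alpha kappa rho mu v00 v t =
     min (kappa / (4 * t * eta_norm rho mu (reduced v)
            (inv (hess (eta rho mu) (reduced v)) (grad (eta rho mu) (reduced v00))))) 1"

text \<open>\<open>alg1_iterate kappa rho mu v00 t0 v t\<close>: the pair \<open>(v, t)\<close> occurs as
  $(v^{(0,j)}, t^{(j)})$ for some $j$.\<close>

inductive alg1_iterate ::
  "real \<Rightarrow> real \<Rightarrow> real \<Rightarrow> 'e \<times> 'e \<times> (real ^ 'm) \<Rightarrow> real \<Rightarrow>
   'e \<times> 'e \<times> (real ^ 'm) \<Rightarrow> real \<Rightarrow> bool"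
  for kappa rho mu v00 t0 where
  start: "alg1_iterate kappa rho mu v00 t0 v00 t0"
| step: "\<lbrakk> alg1_iterate kappa rho mu v00 t0 v t;
           \<not> delta rho mu (reduced v) \<le> kappa;
           t' = (1 - alg1_alpha kappa rho mu v00 v t) * t;
           newtonNt rho mu v00 t' v dv \<rbrakk>
         \<Longrightarrow> alg1_iterate kappa rho mu v00 t0 (v + dv) t'"

definition alg1_output ::
  "real \<Rightarrow> real \<Rightarrow> real \<Rightarrow> 'h \<times> 'e \<Rightarrow> real ^ 'm \<Rightarrow> real \<Rightarrow>
   'e \<times> 'e \<times> (real ^ 'm) \<Rightarrow> bool" where
  "alg1_output kappa rho mu w00 l00 t0 v0 \<longleftrightarrow>
     rho > 0 \<and> mu > 0 \<and> w00 \<in> Ktheta rho mu \<and>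
     0 < t0 \<and> t0 \<le> 1 \<and> (1 - t0) * delta rho mu w00 \<le> kappa / 2 \<and>
     (\<exists>v t dv.
        alg1_iterate kappa rho mu (xbar + B (fst w00), snd w00, l00) t0 v t \<and>
        delta rho mu (reduced v) \<le> kappa \<and>
        newtonN rho mu v dv \<and>
        v0 = v + dv)"

definition alg2_input ::
  "real \<Rightarrow> real \<Rightarrow> real \<Rightarrow> real \<Rightarrow> real \<Rightarrow> 'e \<times> 'e \<times> (real ^ 'm) \<Rightarrow> bool" where
  "alg2_input kappa rho sig eps mu0 v0 \<longleftrightarrow>
     v0 \<in> nbhd kappa mu0 rho \<and> rho > 0 \<and> mu0 > 0 \<and> eps > 0 \<and> 0 < sig \<and> sig < 1"

text \<open>\<open>alg2_iterate rho sig eps mu0 v0 k mu v\<close>: after \<open>k\<close> iterations the state is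
  $(\mu^{(k)}, v^{(k)}) = (mu, v)$.\<close>

inductive alg2_iterate ::
  "real \<Rightarrow> real \<Rightarrow> real \<Rightarrow> real \<Rightarrow> 'e \<times> 'e \<times> (real ^ 'm) \<Rightarrow>
   nat \<Rightarrow> real \<Rightarrow> 'e \<times> 'e \<times> (real ^ 'm) \<Rightarrow> bool"
  for rho sig eps mu0 v0 where
  start: "alg2_iterate rho sig eps mu0 v0 0 mu0 v0"
| step: "\<lbrakk> alg2_iterate rho sig eps mu0 v0 k mu v; \<not> mu \<le> eps;
           newtonN rho (sig * mu) v dv \<rbrakk>
         \<Longrightarrow> alg2_iterate rho sig eps mu0 v0 (Suc k) (sig * mu) (v + dv)"

definition accurate ::
  "real \<Rightarrow> real \<Rightarrow> real \<Rightarrow> real \<Rightarrow> 'e \<times> 'e \<times> (real ^ 'm) \<Rightarrow> bool" where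
  "accurate kappa rho eps mu = (\<lambda>(x, s, l).
     mu \<le> eps \<and> A x = b \<and> adjoint A l + s = c \<and>
     norm (Phi rho mu x s) \<le> 2 * kappa * sqrt (eps / rho))"

text \<open>Algorithm 2 attains the accuracy after exactly \<open>N\<close> iterations: no execution gets stuck
  or has to choose between several Newton steps, and it stops after \<open>N\<close> iterations at an
  accurate point.\<close>

definition alg2_attains ::
  "real \<Rightarrow> real \<Rightarrow> real \<Rightarrow> real \<Rightarrow> real \<Rightarrow> 'e \<times> 'e \<times> (real ^ 'm) \<Rightarrow> nat \<Rightarrow> bool" where
  "alg2_attains kappa rho sig eps mu0 v0 N \<longleftrightarrow>
     alg2_input kappa rho sig eps mu0 v0 \<and>
     (\<forall>k mu v. alg2_iterate rho sig eps mu0 v0 k mu v \<and> \<not> mu \<le> eps \<longrightarrow>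
        (\<exists>!dv. newtonN rho (sig * mu) v dv)) \<and>
     (\<exists>mu v. alg2_iterate rho sig eps mu0 v0 N mu v) \<and>
     (\<forall>mu v. alg2_iterate rho sig eps mu0 v0 N mu v \<longrightarrow> accurate kappa rho eps mu v)"

end

text \<open>The constant hidden in the complexity bound $O(\sqrt\nu \ln(\mu^{(0)}/\varepsilon))$.
  It has to be the same for all algebras, that is, for all types \<open>'e\<close>, \<open>'m\<close>, \<open>'h\<close>. An
  existential quantifier inside the theorem would let it depend on these types, hence on the
  dimension and the rank, so a closed expression in \<open>gamma\<close>, a fixed number, is used instead:
  \<open>N \<le> 1 + ln (mu0 / eps) / (- ln sigma)\<close>,
  $-\ln\sigma \ge \ln\gamma/(2\sqrt\nu + \ln\gamma)$ and $\nu \ge 1$ lead to it.\<close>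

definition iteration_const :: "real \<Rightarrow> real" where
  "iteration_const gamma = 1 + 2 / ln gamma"

end

theory Submission
  imports Defs
begin

text \<open>
  Write $\tau = \mu/\rho$. The proximal point $z = z_\rho(x, s; \mu)$ is characterized by
  $z - \tau z^{-1} = x - s/\rho$, so with the residual $r = x - z$ one has $x = z + r$ and
  $s = \mu z^{-1} + \rho r$: the point $(x, s)$ is the central pair $(z, \mu z^{-1})$ displaced by
  $(r, \rho r)$. Everything that the algorithms compute can be expressed by $z$, $r$ and the
  operator $\mathcal W = \tau D^2\phi(z)$; in particular
  $\nabla\eta_\rho = (\mathcal B^*(c - s + \rho r), -r)$.

  One Newton step (\<open>newton_step_recenters\<close>). With $d = r + \Delta x$, the third Newton equation
  says that the new point is $x^+ = z + d$, $s^+ = \mu (z^{-1} - D^2\phi(z) d)$. In coordinates that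
  move $z$ to the unit $e$ this is the pair $(e + k, e - k)$, and the length of the step is
  $\delta_\rho^2 = \|k\|^2 + \|r\|^2/\tau$. In the coordinates of the new proximal point $z^+$ the same
  pair is $(e + p, e + q)$, and $\xi_\rho \le \|p + q\|$. The gap
  $\langle x, s/\mu\rangle + \phi(x) + \phi(s/\mu) - \nu$ does not depend on the coordinates; it is of
  order $\|k\|^4$ when computed from $k$, and at least of order $\|p + q\|^2$ when computed from $p$
  and $q$. Hence a step of length at most $0.14$ ends in the neighbourhood with $\kappa = 0.1$
  (\<open>primal_dual_gap_contraction\<close>). The last step of the first phase has length
  $\delta_\rho \le 0.1$, which proves that its output is admissible for the second phase.

  Changing $\mu$ to $\sigma\mu$ (\<open>newton_step_after_mu_update\<close>). The old and the new proximal point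
  are functions of the same element $x - s/\rho$, so they share a Jordan frame and are compared
  eigenvalue by eigenvalue (\<open>central_path_move\<close>). The length of the following Newton step is at most
  $\xi_\rho/\sigma + \sqrt\nu\,(1 - \sigma)/\sigma$, which for the given $\sigma$ is at most
  $0.1\,(1 + \ln\gamma/2) + \ln\gamma/2 \le 0.14$. So the neighbourhood is never left, the residual obeys
  $\|r\| \le \xi_\rho \sqrt{\mu/\rho}$ there, and the iterations are counted by
  $-\ln\sigma \ge \ln\gamma/(2\sqrt\nu + \ln\gamma)$.

  What is needed about the Jordan algebra is the spectral theorem with well-defined eigenvalues,
  $\nabla\phi(z) = -z^{-1}$, and coordinates that move $z$ to $e$. Two facts replace the usual
  structure theory. First, if $c$ and $f$ are primitive idempotents that are not orthogonal, then
  computing $\|c \circ f\|^2$ in two ways gives $\|c\| = \|f\|$ (\<open>primitives_norm_eq\<close>); this makes all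
  Jordan frames equally large and the eigenvalues unique. Secondly, along $t \mapsto \exp(t L(a)) y$,
  where $L(a)$ is the multiplication by $a$, the derivative of $\phi$ is
  $-\langle y^{-1}, a \circ y\rangle = -\mathrm{tr}\, a$; so $\exp(L(\ln z))$ preserves the cone, shifts
  $\phi$ by a constant and maps $e$ to $z$ (\<open>flow_barrier\<close>, \<open>scal_barrier\<close>).
\<close>

section \<open>Symmetric operators\<close>

text \<open>A maximizer of the Rayleigh quotient on the unit sphere of the invariant subspace is an
  eigenvector: otherwise moving it in the direction of the defect \<open>w\<close> would increase the quotient.\<close>

lemma symmetric_eigenvector:
  fixes M :: "'a::euclidean_space \<Rightarrow> 'a"
  assumes lin: "linear M" and sym: "\<And>x y. M x \<bullet> y = x \<bullet> M y"
    and S: "subspace S" and inv: "\<And>x. x \<in> S \<Longrightarrow> M x \<in> S" and ne: "\<exists>x\<in>S. x \<noteq> 0"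
  obtains u where "u \<in> S" "norm u = 1" "M u = (u \<bullet> M u) *\<^sub>R u"
proof -
  let ?K = "S \<inter> sphere 0 1"
  have compact: "compact ?K"
    using closed_subspace[OF S] by (simp add: closed_Int_compact)
  obtain x where x: "x \<in> S" "x \<noteq> 0" using ne by blast
  have "x /\<^sub>R norm x \<in> ?K" using x S by (simp add: subspace_scale)
  then have "?K \<noteq> {}" by blast
  moreover have "continuous_on ?K (\<lambda>u. u \<bullet> M u)"
    using linear_continuous_on[OF linear_conv_bounded_linear[THEN iffD1, OF lin]]
    by (intro continuous_intros)
  ultimately obtain u where u: "u \<in> ?K" and max: "\<And>v. v \<in> ?K \<Longrightarrow> v \<bullet> M v \<le> u \<bullet> M u"
    using continuous_attains_sup[OF compact] by blast
  define l where "l = u \<bullet> M u"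
  have uS: "u \<in> S" and u1: "norm u = 1" using u by auto
  have max': "v \<bullet> M v \<le> l * (v \<bullet> v)" if v: "v \<in> S" for v
  proof (cases "v = 0")
    case False
    have "v /\<^sub>R norm v \<in> ?K" using v False S by (simp add: subspace_scale)
    from max[OF this] have "(v \<bullet> M v) / (norm v)\<^sup>2 \<le> l"
      by (simp add: linear_scale[OF lin] l_def power2_eq_square divide_inverse mult.assoc mult.commute mult.left_commute)
    then show ?thesis using False by (simp add: divide_le_eq power2_norm_eq_inner)
  qed (simp add: linear_0[OF lin])
  define w where "w = M u - l *\<^sub>R u"
  have wS: "w \<in> S" unfolding w_def using uS S inv by (simp add: subspace_diff subspace_scale)
  have uu: "u \<bullet> u = 1" using u1 by (simp add: norm_eq_1)
  have wu: "w \<bullet> u = 0" by (simp add: w_def inner_diff_left uu l_def inner_commute[of "M u"])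
  have wM: "w \<bullet> M u = w \<bullet> w"
  proof -
    have "M u = w + l *\<^sub>R u" by (simp add: w_def)
    then show ?thesis using wu by (simp add: inner_add_right)
  qed
  have "w = 0"
  proof (rule ccontr)
    assume "w \<noteq> 0"
    then have pos: "w \<bullet> w > 0" by simp
    define C where "C = w \<bullet> M w - l * (w \<bullet> w)"
    \<comment> \<open>small enough for the linear term to dominate the quadratic one\<close>
    define t where "t = (w \<bullet> w) / (\<bar>C\<bar> + 1)"
    have t: "t > 0" using pos by (simp add: t_def)
    have "u + t *\<^sub>R w \<in> S" using uS wS S by (simp add: subspace_add subspace_scale)
    from max'[OF this] have "2 * t * (w \<bullet> w) + t\<^sup>2 * C \<le> 0"
      using sym[of u w] wM wu uu
      by (simp add: linear_add[OF lin] linear_scale[OF lin] inner_add_left inner_add_right C_def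
          l_def[symmetric] algebra_simps power2_eq_square inner_commute)
    then have "t * (2 * (w \<bullet> w) + t * C) \<le> 0" by (simp add: algebra_simps power2_eq_square)
    moreover have "\<bar>t * C\<bar> \<le> w \<bullet> w"
    proof -
      have "\<bar>t * C\<bar> = (w \<bullet> w) * (\<bar>C\<bar> / (\<bar>C\<bar> + 1))" using t pos by (simp add: abs_mult t_def)
      also have "\<dots> \<le> (w \<bullet> w) * 1" using pos by (intro mult_left_mono) auto
      finally show ?thesis by simp
    qed
    ultimately show False using t pos
      by (smt (verit) mult_pos_pos)
  qed
  then have "M u = (u \<bullet> M u) *\<^sub>R u" by (simp add: w_def l_def)
  with uS u1 that show thesis by blast
qed

text \<open>The version on an invariant subspace serves twice: on the span of the powers of one element it
  yields the spectral theorem, on the whole space it yields exponentials of multiplication operators.\<close>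

lemma symmetric_eigenbasis:
  fixes M :: "'a::euclidean_space \<Rightarrow> 'a"
  assumes lin: "linear M" and sym: "\<And>x y. M x \<bullet> y = x \<bullet> M y"
    and S: "subspace S" and inv: "\<And>x. x \<in> S \<Longrightarrow> M x \<in> S"
  shows "\<exists>U. finite U \<and> U \<subseteq> S \<and> (\<forall>a\<in>U. \<forall>b\<in>U. a \<bullet> b = (if a = b then 1 else 0)) \<and>
    (\<forall>v\<in>S. v = (\<Sum>b\<in>U. (v \<bullet> b) *\<^sub>R b)) \<and> (\<forall>b\<in>U. M b = (b \<bullet> M b) *\<^sub>R b)"
  using S inv
proof (induction "dim S" arbitrary: S rule: less_induct)
  case less
  show ?case
  proof (cases "\<exists>x\<in>S. x \<noteq> 0")
    case False
    then show ?thesis by (intro exI[of _ "{}"]) auto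
  next
    case True
    obtain u where u: "u \<in> S" "norm u = 1" "M u = (u \<bullet> M u) *\<^sub>R u"
      using symmetric_eigenvector[OF lin sym less.prems True] by blast
    have uu: "u \<bullet> u = 1" using u by (simp add: norm_eq_1)
    define S' where "S' = {x \<in> S. u \<bullet> x = 0}"
    have S': "subspace S'" unfolding S'_def using less.prems(1)
      by (auto simp: subspace_def inner_add_right)
    have "u \<notin> S'" using uu by (simp add: S'_def)
    moreover have "S' \<subseteq> S" by (auto simp: S'_def)
    ultimately have "S' \<subset> S" using u(1) by blast
    note unS' = \<open>u \<notin> S'\<close>
    from \<open>S' \<subset> S\<close> have "dim S' < dim S"
      using dim_psubset[of S' S] span_eq_iff[THEN iffD2, OF S'] span_eq_iff[THEN iffD2, OF less.prems(1)]
      by simp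
    moreover have "M x \<in> S'" if "x \<in> S'" for x
    proof -
      have "u \<bullet> M x = M u \<bullet> x" by (rule sym[symmetric])
      also have "\<dots> = 0" using that by (subst u(3)) (simp add: S'_def)
      finally show ?thesis using that less.prems(2) by (simp add: S'_def)
    qed
    ultimately obtain U where U: "finite U" "U \<subseteq> S'"
      "\<forall>a\<in>U. \<forall>b\<in>U. a \<bullet> b = (if a = b then 1 else 0)"
      "\<forall>v\<in>S'. v = (\<Sum>b\<in>U. (v \<bullet> b) *\<^sub>R b)" "\<forall>b\<in>U. M b = (b \<bullet> M b) *\<^sub>R b"
      using less.hyps[OF _ S'] by blast
    have uU: "u \<notin> U" using U(2) \<open>u \<notin> S'\<close> by blast
    have orth: "u \<bullet> b = 0" "b \<bullet> u = 0" if "b \<in> U" for b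
      using that U(2) by (auto simp: S'_def inner_commute)
    have "v = (\<Sum>b\<in>insert u U. (v \<bullet> b) *\<^sub>R b)" if v: "v \<in> S" for v
    proof -
      let ?v = "v - (v \<bullet> u) *\<^sub>R u"
      have "?v \<in> S'" using v u less.prems(1) uu
        by (simp add: S'_def subspace_diff subspace_scale inner_diff_right inner_commute)
      then have "?v = (\<Sum>b\<in>U. (?v \<bullet> b) *\<^sub>R b)" using U(4) by blast
      also have "\<dots> = (\<Sum>b\<in>U. (v \<bullet> b) *\<^sub>R b)"
        by (intro sum.cong) (auto simp: inner_diff_left orth)
      finally show ?thesis using U(1) uU by (simp add: algebra_simps)
    qed
    moreover have "\<forall>a\<in>insert u U. \<forall>b\<in>insert u U. a \<bullet> b = (if a = b then 1 else 0)"
      using U(3) orth uu uU by auto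
    moreover have "insert u U \<subseteq> S" using u U(2) by (auto simp: S'_def)
    moreover have "\<forall>b\<in>insert u U. M b = (b \<bullet> M b) *\<^sub>R b" using u(3) U(5) by blast
    ultimately show ?thesis using U(1) by (intro exI[of _ "insert u U"]) auto
  qed
qed

section \<open>Derivatives and gradients\<close>

lemma has_derivative_quadratic_bound:
  fixes f :: "'a::real_normed_vector \<Rightarrow> 'b::real_normed_vector"
  assumes f': "bounded_linear f'" and d: "d > 0"
    and bound: "\<And>y. norm (y - x) < d \<Longrightarrow> norm (f y - f x - f' (y - x)) \<le> C * (norm (y - x))\<^sup>2"
  shows "(f has_derivative f') (at x)"
  unfolding has_derivative_at_alt
proof (intro conjI allI impI f')
  fix \<epsilon> :: real assume \<epsilon>: "0 < \<epsilon>"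
  define d' where "d' = min d (\<epsilon> / (\<bar>C\<bar> + 1))"
  have "norm (f y - f x - f' (y - x)) \<le> \<epsilon> * norm (y - x)" if y: "norm (y - x) < d'" for y
  proof -
    have "norm (f y - f x - f' (y - x)) \<le> C * (norm (y - x))\<^sup>2"
      using y by (intro bound) (simp add: d'_def)
    also have "\<dots> \<le> (\<bar>C\<bar> + 1) * norm (y - x) * norm (y - x)"
      unfolding power2_eq_square mult.assoc by (intro mult_right_mono) auto
    also have "\<dots> \<le> \<epsilon> * norm (y - x)"
      using y by (intro mult_right_mono) (auto simp: d'_def field_simps)
    finally show ?thesis .
  qed
  moreover have "d' > 0" using d \<epsilon> by (simp add: d'_def)
  ultimately show "\<exists>d>0. \<forall>y. norm (y - x) < d \<longrightarrow> norm (f y - f x - f' (y - x)) \<le> \<epsilon> * norm (y - x)"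
    by blast
qed

lemma grad_eqI:
  assumes D: "GDERIV f x :> D" shows "grad f x = D"
  unfolding grad_def
proof (rule the_equality)
  show "GDERIV f x :> D" by (rule D)
  fix D' assume "GDERIV f x :> D'"
  with D have "(\<lambda>h. h \<bullet> D') = (\<lambda>h. h \<bullet> D)"
    unfolding gderiv_def by (intro has_derivative_unique)
  then have "h \<bullet> D' = h \<bullet> D" for h by (rule fun_cong)
  then show "D' = D" using vector_eq_ldot by blast
qed

section \<open>Resolvents of positive operators\<close>

lemma psd_cauchy_schwarz:
  fixes T :: "'a::real_inner \<Rightarrow> 'a"
  assumes T: "linear T" and sym: "\<And>x y. T x \<bullet> y = x \<bullet> T y" and psd: "\<And>x. x \<bullet> T x \<ge> 0"
  shows "x \<bullet> T y \<le> sqrt (x \<bullet> T x) * sqrt (y \<bullet> T y)"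
proof -
  define a b c where "a = x \<bullet> T x" and "b = y \<bullet> T y" and "c = x \<bullet> T y"
  have yx: "y \<bullet> T x = c" using sym[of x y] by (simp add: c_def inner_commute)
  have quad: "a * s\<^sup>2 - 2 * c * s * t + b * t\<^sup>2 \<ge> 0" for s t
    using psd[of "s *\<^sub>R x - t *\<^sub>R y"] yx
    by (simp add: linear_diff[OF T] linear_scale[OF T] inner_diff_left inner_diff_right
        a_def b_def c_def power2_eq_square algebra_simps)
  have nonneg: "a \<ge> 0" "b \<ge> 0" using psd by (auto simp: a_def b_def)
  have "c\<^sup>2 \<le> a * b"
  proof (cases "b = 0")
    case True
    have "c = 0"
    proof (rule ccontr)
      assume "c \<noteq> 0"
      have "a * 1\<^sup>2 - 2 * c * 1 * ((a + 1) / (2 * c)) + b * ((a + 1) / (2 * c))\<^sup>2 \<ge> 0" by (rule quad)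
      then show False using True \<open>c \<noteq> 0\<close> by simp
    qed
    then show ?thesis using True by simp
  next
    case False
    with nonneg have b: "b > 0" by simp
    have "a * b\<^sup>2 - 2 * c * b * c + b * c\<^sup>2 \<ge> 0" by (rule quad)
    then have "b * (a * b - c\<^sup>2) \<ge> 0" by (simp add: power2_eq_square algebra_simps)
    with b show ?thesis by (simp add: zero_le_mult_iff)
  qed
  then have "\<bar>c\<bar> \<le> sqrt (a * b)" by (simp add: real_le_rsqrt real_sqrt_le_mono[of "c\<^sup>2" "a * b", simplified])
  then show ?thesis by (simp add: real_sqrt_mult a_def b_def c_def)
qed

text \<open>For symmetric positive definite \<open>W\<close> these are $(I + W)^{-1}$ and $I - (I + W)^{-1} = (I + W)^{-1} W$,
  which are the derivatives of the proximal point and of the residual.\<close>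

definition resolvent :: "('a::real_vector \<Rightarrow> 'a) \<Rightarrow> 'a \<Rightarrow> 'a" where
  "resolvent W = inv (\<lambda>h. h + W h)"

definition coresolvent :: "('a::real_vector \<Rightarrow> 'a) \<Rightarrow> 'a \<Rightarrow> 'a" where
  "coresolvent W h = h - resolvent W h"

locale positive_operator =
  fixes W :: "'a::euclidean_space \<Rightarrow> 'a"
  assumes W_linear: "linear W" and W_sym: "W x \<bullet> y = x \<bullet> W y" and W_pos: "x \<noteq> 0 \<Longrightarrow> x \<bullet> W x > 0"
begin

lemma W_nonneg: "x \<bullet> W x \<ge> 0"
  using W_pos[of x] by (cases "x = 0") (auto simp: linear_0[OF W_linear])

lemma shifted_linear: "linear (\<lambda>h. h + W h)"
  using W_linear by (simp add: linear_compose_add linear_ident)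

lemma shifted_bij: "bij (\<lambda>h. h + W h)"
proof -
  have "inj (\<lambda>h. h + W h)"
    unfolding linear_injective_0[OF shifted_linear]
  proof (intro allI impI)
    fix h assume "h + W h = 0"
    then have "h \<bullet> (h + W h) = 0" by simp
    then have "h \<bullet> h + h \<bullet> W h = 0" by (simp only: inner_add_right)
    then have "h \<bullet> h = 0" using W_nonneg[of h] inner_ge_zero[of h] by linarith
    then show "h = 0" by simp
  qed
  then show ?thesis using linear_injective_imp_surjective[OF shifted_linear] by (simp add: bij_def)
qed

lemma resolvent_right: "resolvent W y + W (resolvent W y) = y"
  unfolding resolvent_def using surj_f_inv_f[OF bij_is_surj[OF shifted_bij], of y] by simp

lemma resolvent_left: "resolvent W (h + W h) = h"
  unfolding resolvent_def using inv_f_f[OF bij_is_inj[OF shifted_bij], of h] by simp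

lemma resolvent_linear: "linear (resolvent W)"
proof (rule linearI)
  show "resolvent W (x + y) = resolvent W x + resolvent W y" for x y
  proof -
    have "x + y = (resolvent W x + resolvent W y) + W (resolvent W x + resolvent W y)"
      using resolvent_right[of x] resolvent_right[of y] by (simp add: linear_add[OF W_linear] algebra_simps)
    then show ?thesis using resolvent_left by metis
  qed
  show "resolvent W (r *\<^sub>R x) = r *\<^sub>R resolvent W x" for r x
  proof -
    have "r *\<^sub>R x = (r *\<^sub>R resolvent W x) + W (r *\<^sub>R resolvent W x)"
      using resolvent_right[of x] by (simp add: linear_scale[OF W_linear] flip: scaleR_add_right)
    then show ?thesis using resolvent_left by metis
  qed
qed

lemma resolvent_sym: "resolvent W x \<bullet> y = x \<bullet> resolvent W y"
proof -
  have "resolvent W x \<bullet> (resolvent W y + W (resolvent W y)) = (resolvent W x + W (resolvent W x)) \<bullet> resolvent W y"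
    by (simp only: inner_add_left inner_add_right W_sym)
  then show ?thesis by (simp only: resolvent_right)
qed

lemma coresolvent_eq: "coresolvent W h = W (resolvent W h)"
  using resolvent_right[of h] by (simp add: coresolvent_def algebra_simps)

lemma coresolvent_linear: "linear (coresolvent W)"
  using resolvent_linear by (auto simp: coresolvent_def[abs_def] linear_iff algebra_simps)

lemma coresolvent_sym: "coresolvent W x \<bullet> y = x \<bullet> coresolvent W y"
  by (simp add: coresolvent_def inner_diff_left inner_diff_right resolvent_sym)

lemma resolvent_of_W: "resolvent W (W h) = coresolvent W h"
proof -
  have "resolvent W (h + W h) = h" by (rule resolvent_left)
  then show ?thesis by (simp add: linear_add[OF resolvent_linear] coresolvent_def algebra_simps)
qed

lemma coresolvent_form:
  "x \<bullet> coresolvent W x = resolvent W x \<bullet> W (resolvent W x) + (norm (W (resolvent W x)))\<^sup>2"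
proof -
  let ?v = "resolvent W x"
  have "x \<bullet> coresolvent W x = (?v + W ?v) \<bullet> W ?v" by (simp only: resolvent_right coresolvent_eq)
  then show ?thesis by (simp add: inner_add_left power2_norm_eq_inner)
qed

lemma resolvent_form: "x \<bullet> resolvent W x = (norm (resolvent W x))\<^sup>2 + resolvent W x \<bullet> W (resolvent W x)"
proof -
  let ?v = "resolvent W x"
  have "x \<bullet> resolvent W x = (?v + W ?v) \<bullet> ?v" by (simp only: resolvent_right)
  then show ?thesis by (simp only: inner_add_left power2_norm_eq_inner W_sym)
qed

lemma coresolvent_nonneg: "x \<bullet> coresolvent W x \<ge> 0"
  unfolding coresolvent_form using W_nonneg by (intro add_nonneg_nonneg) auto

lemma resolvent_nonneg: "x \<bullet> resolvent W x \<ge> 0"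
  unfolding resolvent_form using W_nonneg by (intro add_nonneg_nonneg) auto

lemma coresolvent_pos: "x \<noteq> 0 \<Longrightarrow> x \<bullet> coresolvent W x > 0"
proof (rule ccontr)
  assume x: "x \<noteq> 0" and "\<not> x \<bullet> coresolvent W x > 0"
  then have "resolvent W x \<bullet> W (resolvent W x) = 0"
    unfolding coresolvent_form using W_nonneg[of "resolvent W x"] by (smt (verit) zero_le_power2)
  then have "resolvent W x = 0" using W_pos[of "resolvent W x"] by force
  then have "x = 0" using resolvent_right[of x] by (simp add: linear_0[OF W_linear])
  with x show False by simp
qed

text \<open>The quadratic form of $(I + W)^{-1} W$ is the infimal convolution of the form of \<open>W\<close> and of the
  squared norm. This form of it shows at once how it depends on \<open>W\<close>.\<close>

lemma coresolvent_le:
  "x \<bullet> coresolvent W x \<le> u \<bullet> W u + (norm (x - u))\<^sup>2"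
proof -
  define v where "v = resolvent W x"
  define k where "k = u - v"
  have x: "x = v + W v" using resolvent_right[of x] by (simp add: v_def)
  have u: "u = v + k" by (simp add: k_def)
  have "u \<bullet> W u + (norm (x - u))\<^sup>2 = v \<bullet> W v + (norm (W v))\<^sup>2 + k \<bullet> W k + (norm k)\<^sup>2"
    using W_sym[of v k]
    by (simp add: x u power2_norm_eq_inner linear_add[OF W_linear] inner_add_left inner_add_right
        inner_diff_left inner_diff_right inner_commute)
  also have "\<dots> \<ge> v \<bullet> W v + (norm (W v))\<^sup>2" using W_nonneg[of k] by simp
  finally show ?thesis by (simp add: coresolvent_form v_def)
qed

end

lemma coresolvent_mono:
  assumes "positive_operator V" "positive_operator W" and c: "c \<ge> 1"
    and le: "\<And>u. u \<bullet> V u \<le> c * (u \<bullet> W u)"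
  shows "x \<bullet> coresolvent V x \<le> c * (x \<bullet> coresolvent W x)"
proof -
  interpret V: positive_operator V by fact
  interpret W: positive_operator W by fact
  let ?v = "resolvent W x"
  have "x \<bullet> coresolvent V x \<le> ?v \<bullet> V ?v + (norm (x - ?v))\<^sup>2" by (rule V.coresolvent_le)
  also have "\<dots> \<le> c * (?v \<bullet> W ?v) + c * (norm (x - ?v))\<^sup>2"
    using le[of ?v] c by (intro add_mono) (auto intro: mult_right_mono[of 1 c, simplified])
  also have "x - ?v = W ?v" using W.coresolvent_eq[of x] by (simp add: coresolvent_def)
  finally show ?thesis by (simp add: W.coresolvent_form distrib_left)
qed

section \<open>Scalar estimates\<close>

lemma sqrt_pair_cauchy_schwarz:
  assumes "a \<ge> 0" "b \<ge> 0" "p \<ge> 0" "q \<ge> 0"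
  shows "sqrt a * sqrt p + sqrt b * sqrt q \<le> sqrt (a + b) * sqrt (p + q)"
proof -
  have "0 \<le> (sqrt a * sqrt q - sqrt b * sqrt p)\<^sup>2" by simp
  then have "(sqrt a * sqrt p + sqrt b * sqrt q)\<^sup>2 \<le> (a + b) * (p + q)"
    using assms by (simp add: power2_diff power2_sum power_mult_distrib algebra_simps)
  then have "sqrt a * sqrt p + sqrt b * sqrt q \<le> sqrt ((a + b) * (p + q))" by (rule real_le_rsqrt)
  then show ?thesis by (simp add: real_sqrt_mult)
qed

text \<open>With $q = \sqrt{1 + t}$, the bound $\ln q \le q - 1$ gives $t - \ln(1 + t) \ge (q - 1)^2$, and
  $t = (q - 1)(q + 1)$.\<close>

lemma ln_one_plus_gap:
  fixes t N :: real
  assumes t: "t > -1" "\<bar>t\<bar> \<le> N" shows "t\<^sup>2 / (2 * (2 + N)) \<le> t - ln (1 + t)"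
proof -
  define q where "q = sqrt (1 + t)"
  have q: "q > 0" "q\<^sup>2 = 1 + t" using t by (auto simp: q_def)
  have "ln (1 + t) = ln (q\<^sup>2)" by (simp add: q)
  also have "\<dots> = 2 * ln q" using q(1) by (simp add: ln_realpow)
  also have "\<dots> \<le> 2 * (q - 1)" using ln_le_minus_one[OF q(1)] by simp
  finally have "(q - 1)\<^sup>2 \<le> t - ln (1 + t)" using q(2) by (simp add: power2_diff)
  moreover have "t\<^sup>2 \<le> (q - 1)\<^sup>2 * (2 * (2 + N))"
  proof -
    have "t = (q - 1) * (q + 1)" using q(2) by (simp add: power2_eq_square algebra_simps)
    then have "t\<^sup>2 = (q - 1)\<^sup>2 * (q + 1)\<^sup>2" by (simp add: power_mult_distrib)
    also have "(q + 1)\<^sup>2 \<le> 2 * (2 + N)"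
    proof -
      have "0 \<le> (q - 1)\<^sup>2" by simp
      then have "(q + 1)\<^sup>2 \<le> 2 * q\<^sup>2 + 2" unfolding power2_diff power2_sum by simp
      then show ?thesis using q(2) t(2) by simp
    qed
    finally show ?thesis by (simp add: mult_left_mono)
  qed
  moreover have "N \<ge> 0" using t(2) abs_ge_zero[of t] by (rule order_trans[rotated])
  then have N: "2 * (2 + N) > 0" by simp
  ultimately have "t\<^sup>2 \<le> (t - ln (1 + t)) * (2 * (2 + N))"
    by (meson less_imp_le mult_right_mono order_trans)
  then show ?thesis using N by (simp only: pos_divide_le_eq)
qed

text \<open>Eigenvalues of the proximal points for the parameters \<open>\<tau>\<close> and \<open>\<sigma> * \<tau>\<close> that belong to the same
  eigenvalue of $x - s/\rho$. The last bound is the effect of the change on the residual, in the metric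
  that defines $\xi_\rho$.\<close>

lemma central_path_eigenvalues:
  fixes \<zeta> \<zeta>' \<tau> \<sigma> :: real
  assumes pos: "\<zeta> > 0" "\<zeta>' > 0" "\<tau> > 0" and \<sigma>: "0 < \<sigma>" "\<sigma> < 1"
    and eq: "\<zeta> - \<tau> * inverse \<zeta> = \<zeta>' - \<sigma> * \<tau> * inverse \<zeta>'"
  shows "\<zeta>' \<le> \<zeta>" "\<sigma> * \<zeta> \<le> \<zeta>'"
    "\<bar>(\<zeta> - \<zeta>') * inverse \<zeta>' + (1 / (\<sigma> * \<tau>)) * ((\<zeta> - \<zeta>') * \<zeta>')\<bar> \<le> (1 - \<sigma>) / \<sigma>"
proof -
  show 1: "\<zeta>' \<le> \<zeta>"
  proof (rule ccontr)
    assume "\<not> \<zeta>' \<le> \<zeta>"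
    then have "\<zeta> < \<zeta>'" by simp
    moreover have "\<sigma> * \<tau> * inverse \<zeta>' \<le> \<tau> * inverse \<zeta>"
      using pos \<sigma> calculation by (intro mult_mono) (auto intro: le_imp_inverse_le less_imp_le)
    ultimately show False using eq by linarith
  qed
  show "\<sigma> * \<zeta> \<le> \<zeta>'"
  proof (rule ccontr)
    assume "\<not> \<sigma> * \<zeta> \<le> \<zeta>'"
    then have lt: "\<zeta>' < \<sigma> * \<zeta>" by simp
    have "\<tau> * inverse \<zeta> = \<sigma> * \<tau> * inverse (\<sigma> * \<zeta>)" using \<sigma> by (simp add: field_simps)
    also have "\<dots> \<le> \<sigma> * \<tau> * inverse \<zeta>'" using pos \<sigma> lt by (intro mult_left_mono le_imp_inverse_le) auto
    finally have "\<tau> * inverse \<zeta> \<le> \<sigma> * \<tau> * inverse \<zeta>'" .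
    moreover have "\<sigma> * \<zeta> \<le> \<zeta>" using pos \<sigma> by simp
    ultimately show False using eq lt by linarith
  qed
  have "(\<zeta> - \<zeta>') * (\<zeta> * \<zeta>' + \<sigma> * \<tau>) = (1 - \<sigma>) * \<tau> * \<zeta>'"
    using eq pos by (simp add: field_simps)
  moreover have "(\<zeta> - \<zeta>') * (\<zeta>' * \<zeta>' + \<sigma> * \<tau>) \<le> (\<zeta> - \<zeta>') * (\<zeta> * \<zeta>' + \<sigma> * \<tau>)"
    using 1 pos by (intro mult_left_mono) auto
  ultimately have "(\<zeta> - \<zeta>') * (\<zeta>' * \<zeta>' + \<sigma> * \<tau>) / (\<sigma> * \<tau> * \<zeta>') \<le> (1 - \<sigma>) * \<tau> * \<zeta>' / (\<sigma> * \<tau> * \<zeta>')"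
    using pos \<sigma> by (intro divide_right_mono) auto
  also have "(1 - \<sigma>) * \<tau> * \<zeta>' / (\<sigma> * \<tau> * \<zeta>') = (1 - \<sigma>) / \<sigma>" using pos \<sigma> by simp
  also have "(\<zeta> - \<zeta>') * (\<zeta>' * \<zeta>' + \<sigma> * \<tau>) / (\<sigma> * \<tau> * \<zeta>')
      = (\<zeta> - \<zeta>') * inverse \<zeta>' + (1 / (\<sigma> * \<tau>)) * ((\<zeta> - \<zeta>') * \<zeta>')"
    using pos \<sigma> by (simp add: field_simps)
  finally show "\<bar>(\<zeta> - \<zeta>') * inverse \<zeta>' + (1 / (\<sigma> * \<tau>)) * ((\<zeta> - \<zeta>') * \<zeta>')\<bar> \<le> (1 - \<sigma>) / \<sigma>"
    using 1 pos \<sigma> by simp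
qed

context euclidean_jordan_algebra
begin

section \<open>Jordan identities and idempotents\<close>

lemmas jmul_dist = bilinear_ladd[OF jmul_bilinear] bilinear_radd[OF jmul_bilinear]
  bilinear_lmul[OF jmul_bilinear] bilinear_rmul[OF jmul_bilinear]
  bilinear_lsub[OF jmul_bilinear] bilinear_rsub[OF jmul_bilinear]
  bilinear_lzero[OF jmul_bilinear] bilinear_rzero[OF jmul_bilinear]
  bilinear_lneg[OF jmul_bilinear] bilinear_rneg[OF jmul_bilinear]

lemma jmul_linear: "linear (\<lambda>y. x \<diamondop> y)"
  using jmul_bilinear by (simp add: bilinear_def)

lemma jmul_sum_right: "x \<diamondop> (\<Sum>i\<in>I. f i) = (\<Sum>i\<in>I. x \<diamondop> f i)"
  using linear_sum[OF jmul_linear] by (simp add: o_def)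

lemma jmul_sum_left: "(\<Sum>i\<in>I. f i) \<diamondop> x = (\<Sum>i\<in>I. f i \<diamondop> x)"
  by (simp add: jmul_commute[of _ x] jmul_sum_right)

lemma jmul_unit_right: "x \<diamondop> e = x"
  using jmul_unit[of x] jmul_commute[of x e] by simp

lemma unit_nonzero: "e \<noteq> 0"
proof
  assume "e = 0"
  then have "x = 0" for x :: 'e using jmul_unit[of x] by (simp add: jmul_dist)
  then have "i = 0" if "i \<in> Basis" for i :: 'e by blast
  then show False using nonempty_Basis nonzero_Basis by blast
qed

lemma jmul_symmetric: "(x \<diamondop> y) \<bullet> z = y \<bullet> (x \<diamondop> z)"
  by (rule inner_associative)

text \<open>The part of the Jordan identity that is linear in \<open>z\<close>: the odd part in \<open>z\<close> of the identity for
  \<open>x + z\<close>, minus the identity for \<open>z\<close>.\<close>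

lemma jordan_linearized:
  "z \<diamondop> ((x \<diamondop> x) \<diamondop> y) + 2 *\<^sub>R (x \<diamondop> ((x \<diamondop> z) \<diamondop> y))
   = 2 *\<^sub>R ((x \<diamondop> z) \<diamondop> (x \<diamondop> y)) + (x \<diamondop> x) \<diamondop> (z \<diamondop> y)"
proof -
  define D where "D u = u \<diamondop> ((u \<diamondop> u) \<diamondop> y) - (u \<diamondop> u) \<diamondop> (u \<diamondop> y)" for u
  have D0: "D u = 0" for u using jordan_identity[of u y] by (simp add: D_def)
  have c: "z \<diamondop> x = x \<diamondop> z" by (rule jmul_commute)
  \<comment> \<open>\<open>D z\<close> is the cubic term in \<open>z\<close>\<close>
  have "D (x + z) - D (x - z) - 2 *\<^sub>R D z =
    2 *\<^sub>R (z \<diamondop> ((x \<diamondop> x) \<diamondop> y) + 2 *\<^sub>R (x \<diamondop> ((x \<diamondop> z) \<diamondop> y))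
      - (2 *\<^sub>R ((x \<diamondop> z) \<diamondop> (x \<diamondop> y)) + (x \<diamondop> x) \<diamondop> (z \<diamondop> y)))"
    unfolding D_def by (simp add: jmul_dist c algebra_simps scaleR_2)
  then have "2 *\<^sub>R (z \<diamondop> ((x \<diamondop> x) \<diamondop> y) + 2 *\<^sub>R (x \<diamondop> ((x \<diamondop> z) \<diamondop> y))
      - (2 *\<^sub>R ((x \<diamondop> z) \<diamondop> (x \<diamondop> y)) + (x \<diamondop> x) \<diamondop> (z \<diamondop> y))) = 0"
    by (simp add: D0)
  then show ?thesis by simp
qed

lemma operators_commute_of_annihilating_idempotent:
  assumes "c \<diamondop> c = c" "c \<diamondop> y = 0"
  shows "c \<diamondop> (y \<diamondop> w) = y \<diamondop> (c \<diamondop> w)"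
  using jordan_linearized[of y c w] assms by (simp add: jmul_dist)

lemma peirce_polynomial:
  assumes "c \<diamondop> c = c"
  shows "2 *\<^sub>R (c \<diamondop> (c \<diamondop> (c \<diamondop> z))) = 3 *\<^sub>R (c \<diamondop> (c \<diamondop> z)) - c \<diamondop> z"
proof -
  have 1: "z \<diamondop> c = c \<diamondop> z" "(c \<diamondop> z) \<diamondop> c = c \<diamondop> (c \<diamondop> z)" by (rule jmul_commute)+
  have "c \<diamondop> z + 2 *\<^sub>R (c \<diamondop> (c \<diamondop> (c \<diamondop> z))) = 2 *\<^sub>R (c \<diamondop> (c \<diamondop> z)) + c \<diamondop> (c \<diamondop> z)"
    using jordan_linearized[of z c c] unfolding assms 1 by simp
  then have "2 *\<^sub>R (c \<diamondop> (c \<diamondop> (c \<diamondop> z))) = 2 *\<^sub>R (c \<diamondop> (c \<diamondop> z)) + c \<diamondop> (c \<diamondop> z) - c \<diamondop> z"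
    by (metis add_diff_cancel_left')
  also have "2 *\<^sub>R (c \<diamondop> (c \<diamondop> z)) + c \<diamondop> (c \<diamondop> z) = 3 *\<^sub>R (c \<diamondop> (c \<diamondop> z))"
    using scaleR_add_left[of 2 1 "c \<diamondop> (c \<diamondop> z)"] by simp
  finally show ?thesis .
qed

text \<open>The multiplication $L$ by an idempotent has eigenvalues in $\{0, 1/2, 1\}$, where
  $L = L^2 + 4 (L - L^2)^2$. The right-hand side is a sum of squares, so $L$ is positive semidefinite.\<close>

lemma idempotent_quadratic_form:
  assumes "c \<diamondop> c = c"
  shows "v \<bullet> (c \<diamondop> v) = (norm (c \<diamondop> v))\<^sup>2 + 4 * (norm (c \<diamondop> v - c \<diamondop> (c \<diamondop> v)))\<^sup>2"
proof -
  let ?L = "\<lambda>v. c \<diamondop> v"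
  define a1 where "a1 = v \<bullet> ?L v"
  define a2 where "a2 = v \<bullet> ?L (?L v)"
  define a3 where "a3 = v \<bullet> ?L (?L (?L v))"
  define a4 where "a4 = v \<bullet> ?L (?L (?L (?L v)))"
  have e3: "2 * a3 = 3 * a2 - a1"
    using arg_cong[OF peirce_polynomial[OF assms, of v], of "\<lambda>w. v \<bullet> w"]
    by (simp add: a1_def a2_def a3_def inner_diff_right)
  have e4: "2 * a4 = 3 * a3 - a2"
    using arg_cong[OF peirce_polynomial[OF assms, of "?L v"], of "\<lambda>w. v \<bullet> w"]
    by (simp add: a4_def a2_def a3_def inner_diff_right)
  have "(norm (?L v))\<^sup>2 = a2"
    by (simp add: power2_norm_eq_inner jmul_symmetric a2_def)
  moreover have "(norm (?L v - ?L (?L v)))\<^sup>2 = a2 - 2 * a3 + a4"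
    by (simp add: power2_norm_eq_inner jmul_symmetric inner_diff_left inner_diff_right
        jmul_dist a2_def a3_def a4_def)
  ultimately show ?thesis using e3 e4 by (simp add: a1_def[symmetric])
qed

lemma idempotent_psd:
  assumes "c \<diamondop> c = c" shows "v \<bullet> (c \<diamondop> v) \<ge> 0"
  by (simp add: idempotent_quadratic_form[OF assms])

lemma idempotents_inner:
  assumes "d \<diamondop> d = d" shows "c \<bullet> d = d \<bullet> (c \<diamondop> d)"
  using jmul_symmetric[of d d c] assms by (simp add: inner_commute jmul_commute)

lemma idempotents_inner_nonneg:
  assumes "c \<diamondop> c = c" "d \<diamondop> d = d" shows "c \<bullet> d \<ge> 0"
  using idempotents_inner[OF assms(2)] idempotent_psd[OF assms(1)] by simp

lemma idempotents_orthogonal: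
  assumes "c \<diamondop> c = c" "d \<diamondop> d = d" "c \<bullet> d = 0" shows "c \<diamondop> d = 0"
proof -
  have "(norm (c \<diamondop> d))\<^sup>2 + 4 * (norm (c \<diamondop> d - c \<diamondop> (c \<diamondop> d)))\<^sup>2 = 0"
    using idempotent_quadratic_form[OF assms(1), of d] idempotents_inner[OF assms(2), of c] assms(3)
    by simp
  then have "(norm (c \<diamondop> d))\<^sup>2 = 0"
    by (smt (verit) zero_le_power2)
  then show ?thesis by simp
qed

lemma square_power: "(x \<diamondop> x) \<diamondop> jpow x n = jpow x (Suc (Suc n))"
proof (induction n)
  case 0 then show ?case by (simp add: jmul_unit_right)
next
  case (Suc n)
  have "(x \<diamondop> x) \<diamondop> jpow x (Suc n) = x \<diamondop> ((x \<diamondop> x) \<diamondop> jpow x n)"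
    using jordan_identity[of x "jpow x n"] by simp
  then show ?case using Suc by simp
qed

text \<open>The linearized identity with \<open>y = jpow x m\<close>, read as an identity of operators applied to \<open>z\<close>,
  expresses the multiplication by $x^{m+2}$ by those with $x^{m+1}$, $x^m$, $x^2$ and $x$.\<close>

lemma power_operator_commutes: "x \<diamondop> (jpow x n \<diamondop> w) = jpow x n \<diamondop> (x \<diamondop> w)"
proof (induction n arbitrary: w rule: less_induct)
  case (less n)
  consider "n = 0" | "n = 1" | m where "n = Suc (Suc m)"
    by (metis One_nat_def not0_implies_Suc)
  then show ?case
  proof cases
    case 3
    have rec: "jpow x n \<diamondop> z = 2 *\<^sub>R (jpow x (Suc m) \<diamondop> (x \<diamondop> z)) + (x \<diamondop> x) \<diamondop> (jpow x m \<diamondop> z)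
        - 2 *\<^sub>R (x \<diamondop> (jpow x m \<diamondop> (x \<diamondop> z)))" for z
      using jordan_linearized[of z x "jpow x m"] unfolding square_power 3
      by (simp add: jmul_commute[of z] jmul_commute[of "x \<diamondop> z"] algebra_simps)
    have IH1: "x \<diamondop> (jpow x (Suc m) \<diamondop> w) = jpow x (Suc m) \<diamondop> (x \<diamondop> w)" for w
      by (rule less.IH) (simp add: 3)
    have IH2: "x \<diamondop> (jpow x m \<diamondop> w) = jpow x m \<diamondop> (x \<diamondop> w)" for w
      by (rule less.IH) (simp add: 3)
    show ?thesis
      by (simp only: rec jmul_dist IH1 IH2 jordan_identity)
  qed (auto simp: jmul_unit jmul_unit_right)
qed

section \<open>The spectral theorem\<close>

definition orth_system :: "nat \<Rightarrow> (nat \<Rightarrow> 'e) \<Rightarrow> bool" where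
  "orth_system n f \<longleftrightarrow> (\<forall>i<n. f i \<diamondop> f i = f i \<and> f i \<noteq> 0) \<and>
     (\<forall>i<n. \<forall>j<n. i \<noteq> j \<longrightarrow> f i \<diamondop> f j = 0) \<and> (\<Sum>i<n. f i) = e"

lemma system_mult:
  "orth_system n f \<Longrightarrow> i < n \<Longrightarrow> j < n \<Longrightarrow> f i \<diamondop> f j = (if i = j then f i else 0)"
  by (auto simp: orth_system_def)

lemma system_inner:
  assumes f: "orth_system n f" and ij: "i < n" "j < n" "i \<noteq> j"
  shows "f i \<bullet> f j = 0"
proof -
  have "f i \<bullet> f j = (f i \<diamondop> f i) \<bullet> f j" using system_mult[OF f ij(1) ij(1)] by simp
  also have "\<dots> = 0" using system_mult[OF f ij(1,2)] ij(3) by (simp add: jmul_symmetric)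
  finally show ?thesis .
qed

lemma system_comb_mult:
  assumes f: "orth_system n f"
  shows "(\<Sum>i<n. \<alpha> i *\<^sub>R f i) \<diamondop> (\<Sum>i<n. \<beta> i *\<^sub>R f i) = (\<Sum>i<n. (\<alpha> i * \<beta> i) *\<^sub>R f i)"
proof -
  have "(\<Sum>i<n. \<alpha> i *\<^sub>R f i) \<diamondop> (\<Sum>i<n. \<beta> i *\<^sub>R f i)
      = (\<Sum>i<n. \<Sum>j<n. (\<alpha> i * \<beta> j) *\<^sub>R (f i \<diamondop> f j))"
    unfolding jmul_sum_left unfolding jmul_sum_right by (simp add: jmul_dist mult.commute)
  also have "\<dots> = (\<Sum>i<n. \<Sum>j<n. if i = j then (\<alpha> i * \<beta> i) *\<^sub>R f i else 0)"
    by (intro sum.cong) (auto simp: system_mult[OF f])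
  finally show ?thesis by (simp add: sum.delta)
qed

lemma system_comb_mult_member:
  assumes f: "orth_system n f" and j: "j < n"
  shows "(\<Sum>i<n. \<alpha> i *\<^sub>R f i) \<diamondop> f j = \<alpha> j *\<^sub>R f j"
proof -
  have "(\<Sum>i<n. \<alpha> i *\<^sub>R f i) \<diamondop> f j = (\<Sum>i<n. if i = j then \<alpha> j *\<^sub>R f j else 0)"
    unfolding jmul_sum_left by (intro sum.cong) (auto simp: jmul_dist system_mult[OF f] j)
  then show ?thesis using j by simp
qed

lemma system_comb_power:
  assumes f: "orth_system n f"
  shows "jpow (\<Sum>i<n. \<alpha> i *\<^sub>R f i) k = (\<Sum>i<n. \<alpha> i ^ k *\<^sub>R f i)"
proof (induction k)
  case 0 then show ?case using f by (simp add: orth_system_def)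
qed (simp add: system_comb_mult[OF f])

lemma system_independent:
  assumes f: "orth_system n f" and z: "(\<Sum>i<n. \<alpha> i *\<^sub>R f i) = 0" and j: "j < n"
  shows "\<alpha> j = 0"
proof -
  have "\<alpha> j *\<^sub>R f j = 0" using system_comb_mult_member[OF f j, of \<alpha>] by (simp add: z jmul_dist)
  moreover have "f j \<noteq> 0" using f j by (auto simp: orth_system_def)
  ultimately show ?thesis by simp
qed

lemma system_size_le_dim:
  assumes f: "orth_system n f" shows "n \<le> DIM('e)"
proof -
  have nz: "f i \<noteq> 0" if "i < n" for i using f that by (auto simp: orth_system_def)
  have "inj_on f {..<n}"
  proof (rule inj_onI)
    fix i j assume "i \<in> {..<n}" "j \<in> {..<n}" "f i = f j"
    then show "i = j" using system_mult[OF f, of i j] system_mult[OF f, of i i] nz[of i] by (auto split: if_splits)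
  qed
  moreover have "independent (f ` {..<n})"
  proof (rule pairwise_orthogonal_independent)
    show "pairwise orthogonal (f ` {..<n})"
      by (auto simp: pairwise_def orthogonal_def) (metis system_inner[OF f])
    show "0 \<notin> f ` {..<n}" using nz by auto
  qed
  ultimately show ?thesis using independent_bound[of "f ` {..<n}"] by (simp add: card_image)
qed

text \<open>Decompose the unit into eigenvectors of the multiplication by \<open>x\<close> on the span of the powers of
  \<open>x\<close>. The components for distinct eigenvalues multiply to zero, because the multiplications by them
  commute with that by \<open>x\<close>; since they add up to the unit, they are idempotent.\<close>

lemma first_spectral_theorem:
  obtains n \<alpha> f where "orth_system n f" "x = (\<Sum>i<n. \<alpha> i *\<^sub>R f i)"
    "\<forall>i<n. f i \<in> span (range (jpow x))"
proof -
  let ?S = "span (range (jpow x))"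
  have invS: "x \<diamondop> v \<in> ?S" if "v \<in> ?S" for v
    using that
  proof (induction rule: span_induct_alt)
    case base then show ?case by (simp add: jmul_dist span_zero)
  next
    case (step c v y)
    then obtain k where "v = jpow x k" by blast
    then have "x \<diamondop> v = jpow x (Suc k)" by simp
    then have "x \<diamondop> v \<in> ?S" by (metis span_base rangeI)
    with step show ?case by (simp add: jmul_dist span_add span_scale)
  qed
  have comm: "x \<diamondop> (v \<diamondop> w) = v \<diamondop> (x \<diamondop> w)" if "v \<in> ?S" for v w
    using that
  proof (induction rule: span_induct_alt)
    case (step c v y)
    then obtain k where "v = jpow x k" by blast
    with step show ?case by (simp add: jmul_dist power_operator_commutes)
  qed (simp add: jmul_dist)
  obtain U where U: "finite U" "U \<subseteq> ?S" "\<forall>v\<in>?S. v = (\<Sum>b\<in>U. (v \<bullet> b) *\<^sub>R b)"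
      "\<forall>b\<in>U. x \<diamondop> b = (b \<bullet> (x \<diamondop> b)) *\<^sub>R b"
    using symmetric_eigenbasis[of "\<lambda>v. x \<diamondop> v" ?S] jmul_linear jmul_symmetric invS by auto
  define l where "l b = b \<bullet> (x \<diamondop> b)" for b
  define C where "C v = (\<Sum>b\<in>{b\<in>U. l b = v}. (e \<bullet> b) *\<^sub>R b)" for v
  define V where "V = {v \<in> l ` U. C v \<noteq> 0}"
  have finV: "finite V" using U(1) by (simp add: V_def)
  have eS: "e \<in> ?S" by (metis span_base rangeI jpow.simps(1))
  have CS: "C v \<in> ?S" for v
    unfolding C_def by (intro span_sum span_scale) (use U(2) in auto)
  have xC: "x \<diamondop> C v = v *\<^sub>R C v" for v
    unfolding C_def jmul_sum_right scaleR_sum_right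
  proof (intro sum.cong refl)
    fix b assume "b \<in> {b \<in> U. l b = v}"
    then have "x \<diamondop> b = v *\<^sub>R b" using U(4) by (auto simp: l_def)
    then show "x \<diamondop> ((e \<bullet> b) *\<^sub>R b) = v *\<^sub>R (e \<bullet> b) *\<^sub>R b" by (simp add: jmul_dist)
  qed
  have sumC: "(\<Sum>v\<in>V. C v) = e"
  proof -
    have "(\<Sum>v\<in>V. C v) = (\<Sum>v\<in>l ` U. C v)"
      using U(1) by (intro sum.mono_neutral_left) (auto simp: V_def)
    also have "\<dots> = (\<Sum>b\<in>U. (e \<bullet> b) *\<^sub>R b)"
      unfolding C_def by (rule sum.group) (use U(1) in auto)
    also have "\<dots> = e" using U(3) eS by simp
    finally show ?thesis .
  qed
  have orth: "C v \<diamondop> C w = 0" if "v \<noteq> w" for v w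
  proof -
    have "x \<diamondop> (C v \<diamondop> C w) = w *\<^sub>R (C v \<diamondop> C w)"
      using comm[OF CS, of v "C w"] by (simp add: xC jmul_dist)
    moreover have "x \<diamondop> (C v \<diamondop> C w) = v *\<^sub>R (C v \<diamondop> C w)"
      using comm[OF CS, of w "C v"] by (simp add: xC jmul_dist jmul_commute[of "C w"])
    ultimately have "(v - w) *\<^sub>R (C v \<diamondop> C w) = 0" by (simp add: scaleR_diff_left)
    with that show ?thesis by simp
  qed
  have idem: "C v \<diamondop> C v = C v" if "v \<in> V" for v
  proof -
    have "C v = (\<Sum>w\<in>V. C v \<diamondop> C w)"
      using jmul_sum_right[of "C v" C V] by (simp add: sumC jmul_unit_right)
    also have "\<dots> = (\<Sum>w\<in>V. if w = v then C v \<diamondop> C v else 0)"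
      by (intro sum.cong) (auto simp: orth)
    also have "\<dots> = C v \<diamondop> C v" using that finV by simp
    finally show ?thesis by simp
  qed
  obtain h where h: "bij_betw h {..<card V} V"
    using ex_bij_betw_nat_finite[OF finV] by (auto simp: atLeast0LessThan)
  have hV: "h i \<in> V" if "i < card V" for i using h that by (auto simp: bij_betw_def)
  have hinj: "h i \<noteq> h j" if "i < card V" "j < card V" "i \<noteq> j" for i j
    using h that by (auto simp: bij_betw_def inj_on_def)
  have sumh: "(\<Sum>i<card V. g (h i)) = (\<Sum>v\<in>V. g v)" for g :: "real \<Rightarrow> 'e"
    by (rule sum.reindex_bij_betw[OF h])
  show thesis
  proof (rule that)
    show "orth_system (card V) (\<lambda>i. C (h i))"
      unfolding orth_system_def using idem hV orth hinj sumh[of C] sumC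
      by (auto simp: V_def)
    have "x = x \<diamondop> (\<Sum>v\<in>V. C v)" by (simp add: sumC jmul_unit_right)
    also have "\<dots> = (\<Sum>v\<in>V. v *\<^sub>R C v)" by (simp add: jmul_sum_right xC)
    finally show "x = (\<Sum>i<card V. h i *\<^sub>R C (h i))" using sumh[of "\<lambda>v. v *\<^sub>R C v"] by simp
    show "\<forall>i<card V. C (h i) \<in> ?S" using CS by blast
  qed
qed

section \<open>Primitive idempotents and the rank\<close>

lemma primitive_idempotentD:
  assumes "primitive_idempotent c" shows "c \<diamondop> c = c" "c \<noteq> 0"
  using assms by (auto simp: primitive_idempotent_def idempotent_def)

text \<open>The eigenspace of a primitive idempotent \<open>c\<close> for the eigenvalue 1 is a line: every spectral
  idempotent of \<open>y\<close> for a nonzero eigenvalue lies below \<open>c\<close>, hence is \<open>c\<close>.\<close>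

lemma primitive_peirce_one:
  assumes c: "primitive_idempotent c" and y: "c \<diamondop> y = y"
  obtains s where "y = s *\<^sub>R c"
proof -
  have cc: "c \<diamondop> c = c" using primitive_idempotentD[OF c] by simp
  define c' where "c' = e - c"
  have c': "c' \<diamondop> c' = c'" "c' \<diamondop> y = 0" by (simp_all add: c'_def jmul_dist jmul_unit jmul_unit_right cc y)
  have comm: "c' \<diamondop> (y \<diamondop> w) = y \<diamondop> (c' \<diamondop> w)" for w
    by (rule operators_commute_of_annihilating_idempotent) (fact c')+
  \<comment> \<open>only powers with positive exponent are annihilated, whence the extra factor \<open>y\<close>\<close>
  have pow: "c' \<diamondop> (y \<diamondop> jpow y k) = 0" for k
    by (induction k) (simp_all add: jmul_unit_right c' comm jmul_dist)
  have span: "c' \<diamondop> (y \<diamondop> d) = 0" if "d \<in> span (range (jpow y))" for d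
    using that
  proof (induction rule: span_induct_alt)
    case (step a v w)
    then obtain k where "v = jpow y k" by blast
    with step pow show ?case by (simp add: jmul_dist)
  qed (simp add: jmul_dist)
  obtain n \<alpha> f where f: "orth_system n f" and yf: "y = (\<Sum>i<n. \<alpha> i *\<^sub>R f i)"
    and fS: "\<forall>i<n. f i \<in> span (range (jpow y))"
    using first_spectral_theorem by blast
  have eq: "f i = c" if i: "i < n" and nz: "\<alpha> i \<noteq> 0" for i
  proof (rule ccontr)
    assume ne: "f i \<noteq> c"
    have "y \<diamondop> f i = \<alpha> i *\<^sub>R f i" using system_comb_mult_member[OF f i] by (simp add: yf)
    with span[of "f i"] fS i nz have "c' \<diamondop> f i = 0" by (simp add: jmul_dist)
    then have cf: "c \<diamondop> f i = f i" by (simp add: c'_def jmul_dist jmul_unit)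
    have fc: "f i \<diamondop> c = f i" using cf jmul_commute by simp
    have ff: "f i \<diamondop> f i = f i" "f i \<noteq> 0" using f i by (auto simp: orth_system_def)
    have "idempotent (f i)" "idempotent (c - f i)" "f i \<diamondop> (c - f i) = 0" "c = f i + (c - f i)"
      by (simp_all add: idempotent_def jmul_dist ff cf fc cc)
    with c ne ff show False unfolding primitive_idempotent_def
      by (metis right_minus_eq)
  qed
  have "\<alpha> i *\<^sub>R f i = \<alpha> i *\<^sub>R c" if "i < n" for i using eq[OF that] by (cases "\<alpha> i = 0") auto
  then have "(\<Sum>i<n. \<alpha> i *\<^sub>R f i) = (\<Sum>i<n. \<alpha> i *\<^sub>R c)" by (intro sum.cong) auto
  then have "y = (\<Sum>i<n. \<alpha> i) *\<^sub>R c" by (simp only: yf scaleR_sum_left)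
  then show thesis by (rule that)
qed

text \<open>Both $\|c \circ f\|^2 = (1 + s)/2\,\langle c, f\rangle$ with $\langle c, f\rangle = s\|c\|^2$ and the
  same equation with \<open>c\<close> and \<open>f\<close> exchanged hold, so the two factors $s$ agree.\<close>

lemma primitives_norm_eq:
  assumes c: "primitive_idempotent c" and f: "primitive_idempotent f" and cf: "c \<bullet> f \<noteq> 0"
  shows "norm c = norm f"
proof -
  have key: "norm (c \<diamondop> f) ^ 2 * (2 * norm c ^ 2) = (c \<bullet> f + norm c ^ 2) * (c \<bullet> f)"
    if c: "primitive_idempotent c" and f: "primitive_idempotent f" for c f
  proof -
    have cc: "c \<diamondop> c = c" and ff: "f \<diamondop> f = f" using primitive_idempotentD c f by auto
    define y where "y = 2 *\<^sub>R (c \<diamondop> (c \<diamondop> f)) - c \<diamondop> f"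
    have "c \<diamondop> y = y"
    proof -
      have "c \<diamondop> y = 3 *\<^sub>R (c \<diamondop> (c \<diamondop> f)) - c \<diamondop> f - c \<diamondop> (c \<diamondop> f)"
        using peirce_polynomial[OF cc, of f] by (simp add: y_def jmul_dist)
      also have "\<dots> = y" using scaleR_add_left[of 2 1 "c \<diamondop> (c \<diamondop> f)"] by (simp add: y_def)
      finally show ?thesis .
    qed
    then obtain s where s: "y = s *\<^sub>R c" using primitive_peirce_one[OF c] by blast
    have cfc: "(c \<diamondop> f) \<bullet> c = c \<bullet> f" by (simp only: jmul_symmetric cc inner_commute[of f c])
    have "y \<bullet> c = c \<bullet> f"
      using cfc by (simp add: y_def inner_diff_left jmul_symmetric cc)
    then have scn: "c \<bullet> f = s * norm c ^ 2" by (simp add: s power2_norm_eq_inner)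
    have fcf: "f \<bullet> (c \<diamondop> f) = c \<bullet> f" using idempotents_inner[OF ff] by simp
    have "2 * norm (c \<diamondop> f) ^ 2 = f \<bullet> (2 *\<^sub>R (c \<diamondop> (c \<diamondop> f)))"
      by (simp add: power2_norm_eq_inner jmul_symmetric)
    also have "2 *\<^sub>R (c \<diamondop> (c \<diamondop> f)) = y + c \<diamondop> f" by (simp add: y_def)
    also have "f \<bullet> (y + c \<diamondop> f) = (s + 1) * (c \<bullet> f)"
      by (simp add: inner_add_right fcf s inner_commute algebra_simps)
    finally have "2 * norm (c \<diamondop> f) ^ 2 * norm c ^ 2 = (s * norm c ^ 2 + norm c ^ 2) * (c \<bullet> f)"
      by (simp add: algebra_simps)
    then show ?thesis using scn by (simp add: algebra_simps)
  qed
  define p q X Y where "p = c \<bullet> f" and "q = norm (c \<diamondop> f) ^ 2" and "X = norm c ^ 2" and "Y = norm f ^ 2"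
  have 1: "q * (2 * X) = (p + X) * p" using key[OF c f] by (simp add: p_def q_def X_def)
  have 2: "q * (2 * Y) = (p + Y) * p"
    using key[OF f c] by (simp add: p_def q_def Y_def jmul_commute[of f] inner_commute[of f])
  have "(p + X) * p * Y = (p + Y) * p * X" unfolding 1[symmetric] 2[symmetric] by simp
  moreover have "p \<noteq> 0" using cf by (simp add: p_def)
  ultimately have "(p + X) * Y = (p + Y) * X" by simp
  then have "p * (Y - X) = 0" by (simp add: algebra_simps)
  with \<open>p \<noteq> 0\<close> have "norm f ^ 2 = norm c ^ 2" by (simp add: X_def Y_def)
  then show ?thesis by simp
qed

definition primitive_system :: "nat \<Rightarrow> (nat \<Rightarrow> 'e) \<Rightarrow> bool" where
  "primitive_system n f \<longleftrightarrow> orth_system n f \<and> (\<forall>i<n. primitive_idempotent (f i))"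

lemma system_split:
  assumes f: "orth_system n f" and i: "i < n" and np: "\<not> primitive_idempotent (f i)"
  obtains u1 u2 where "orth_system (Suc n) (f(i := u1, n := u2))" "f i = u1 + u2"
proof -
  have "idempotent (f i)" "f i \<noteq> 0" using f i by (auto simp: orth_system_def idempotent_def)
  then obtain u1 u2 where u: "u1 \<diamondop> u1 = u1" "u2 \<diamondop> u2 = u2" "u1 \<noteq> 0" "u2 \<noteq> 0" "u1 \<diamondop> u2 = 0" "f i = u1 + u2"
    using np by (auto simp: primitive_idempotent_def idempotent_def)
  have orth: "u1 \<diamondop> f j = 0" "u2 \<diamondop> f j = 0" "f j \<diamondop> u1 = 0" "f j \<diamondop> u2 = 0" if j: "j < n" "j \<noteq> i" for j
  proof -
    have fj: "f j \<diamondop> f j = f j" using f j by (auto simp: orth_system_def)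
    have "u1 \<bullet> f j + u2 \<bullet> f j = 0"
      using system_inner[OF f i j(1)] j u(6) by (simp add: inner_add_left)
    moreover have "u1 \<bullet> f j \<ge> 0" "u2 \<bullet> f j \<ge> 0" using idempotents_inner_nonneg fj u by auto
    ultimately have "u1 \<bullet> f j = 0" "u2 \<bullet> f j = 0" by auto
    then show "u1 \<diamondop> f j = 0" "u2 \<diamondop> f j = 0" using idempotents_orthogonal fj u by auto
    then show "f j \<diamondop> u1 = 0" "f j \<diamondop> u2 = 0" by (simp_all add: jmul_commute[of "f j"])
  qed
  let ?g = "f(i := u1, n := u2)"
  have "(\<Sum>k<Suc n. ?g k) = (\<Sum>k<n. (f(i := u1)) k) + u2"
    using i by (auto intro!: sum.cong)
  also have "(\<Sum>k<n. (f(i := u1)) k) = u1 + (\<Sum>k\<in>{..<n} - {i}. f k)"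
    using i by (subst sum.remove[of _ i]) (auto intro!: sum.cong)
  also have "(\<Sum>k\<in>{..<n} - {i}. f k) = e - f i"
    using f i by (simp add: orth_system_def sum_diff1)
  finally have sum: "(\<Sum>k<Suc n. ?g k) = e" by (simp add: u(6))
  have u21: "u2 \<diamondop> u1 = 0" using u(5) jmul_commute by simp
  have "?g a \<diamondop> ?g a = ?g a \<and> ?g a \<noteq> 0" if "a < Suc n" for a
    using that u f by (auto simp: orth_system_def less_Suc_eq)
  moreover have "?g a \<diamondop> ?g b = 0" if "a < Suc n" "b < Suc n" "a \<noteq> b" for a b
    using that u u21 orth system_mult[OF f, of a b] i by (auto simp: less_Suc_eq)
  ultimately have "orth_system (Suc n) ?g"
    unfolding orth_system_def using sum by blast
  with u(6) that show thesis by blast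
qed

text \<open>A decomposition with the largest possible number of idempotents consists of primitive ones, as
  otherwise one of them could be split.\<close>

lemma primitive_system_exists:
  obtains n \<alpha> f where "primitive_system n f" "x = (\<Sum>i<n. \<alpha> i *\<^sub>R f i)"
proof -
  let ?P = "\<lambda>n. \<exists>\<alpha> f. orth_system n f \<and> x = (\<Sum>i<n. \<alpha> i *\<^sub>R f i)"
  define n where "n = (GREATEST n. ?P n)"
  have ex: "\<exists>n. ?P n" using first_spectral_theorem[of x] by metis
  have bound: "\<And>y. ?P y \<Longrightarrow> y \<le> DIM('e)" using system_size_le_dim by blast
  have "?P n" unfolding n_def by (rule GreatestI_ex_nat[OF ex bound])
  then obtain \<alpha> f where f: "orth_system n f" and x: "x = (\<Sum>i<n. \<alpha> i *\<^sub>R f i)" by blast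
  have "primitive_idempotent (f i)" if i: "i < n" for i
  proof (rule ccontr)
    assume "\<not> primitive_idempotent (f i)"
    then obtain u1 u2 where g: "orth_system (Suc n) (f(i := u1, n := u2))" and u: "f i = u1 + u2"
      using system_split[OF f i] by blast
    let ?g = "f(i := u1, n := u2)" and ?\<beta> = "\<alpha>(n := \<alpha> i)"
    have "(\<Sum>k<Suc n. ?\<beta> k *\<^sub>R ?g k) = (\<Sum>k<n. \<alpha> k *\<^sub>R (f(i := u1)) k) + \<alpha> i *\<^sub>R u2"
      using i by (auto intro!: sum.cong)
    also have "(\<Sum>k<n. \<alpha> k *\<^sub>R (f(i := u1)) k) = \<alpha> i *\<^sub>R u1 + (\<Sum>k\<in>{..<n} - {i}. \<alpha> k *\<^sub>R f k)"
      using i by (subst sum.remove[of _ i]) (auto intro!: sum.cong)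
    also have "(\<Sum>k\<in>{..<n} - {i}. \<alpha> k *\<^sub>R f k) = x - \<alpha> i *\<^sub>R f i"
      using i by (simp add: x sum_diff1)
    finally have "(\<Sum>k<Suc n. ?\<beta> k *\<^sub>R ?g k) = x" by (simp add: u scaleR_add_right)
    with g have "?P (Suc n)" by metis
    then have "Suc n \<le> n" unfolding n_def by (rule Greatest_le_nat[OF _ bound])
    then show False by simp
  qed
  with f have "primitive_system n f" by (simp add: primitive_system_def)
  with x that show thesis by blast
qed

lemma system_inner_unit:
  assumes "orth_system n f" "i < n" shows "f i \<bullet> e = norm (f i) ^ 2"
  using system_mult[OF assms(1) assms(2) assms(2)] jmul_symmetric[of "f i" "f i" e]
  by (simp add: jmul_unit_right power2_norm_eq_inner)

text \<open>Expand both sums over the pairs of idempotents with weight $\langle f_i, g_j\rangle / \|f_i\|^2$. A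
  pair with nonzero weight has equal norms and belongs to the same eigenvalue.\<close>

lemma primitive_eigenvalue_sum:
  assumes f: "primitive_system n f" and g: "primitive_system m g"
    and eq: "(\<Sum>i<n. \<alpha> i *\<^sub>R f i) = (\<Sum>i<m. \<beta> i *\<^sub>R g i)"
  shows "(\<Sum>i<n. G (\<alpha> i)) = (\<Sum>j<m. G (\<beta> j) :: real)"
proof -
  have F: "orth_system n f" and G: "orth_system m g" using f g by (auto simp: primitive_system_def)
  have sumF: "(\<Sum>i<n. f i) = e" and sumG: "(\<Sum>i<m. g i) = e" using F G by (auto simp: orth_system_def)
  have nzF: "norm (f i) > 0" if "i < n" for i using F that by (auto simp: orth_system_def)
  have nzG: "norm (g i) > 0" if "i < m" for i using G that by (auto simp: orth_system_def)
  have cross: "G (\<alpha> i) * (f i \<bullet> g j) / norm (f i) ^ 2 = G (\<beta> j) * (g j \<bullet> f i) / norm (g j) ^ 2"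
    if i: "i < n" and j: "j < m" for i j
  proof (cases "f i \<bullet> g j = 0")
    case False
    have "norm (f i) = norm (g j)"
      using primitives_norm_eq[OF _ _ False] f g i j by (auto simp: primitive_system_def)
    moreover have "\<alpha> i = \<beta> j"
    proof -
      let ?x = "\<Sum>i<n. \<alpha> i *\<^sub>R f i"
      have "\<alpha> i * (f i \<bullet> g j) = (?x \<diamondop> f i) \<bullet> g j"
        by (simp add: system_comb_mult_member[OF F i])
      also have "\<dots> = f i \<bullet> (?x \<diamondop> g j)" by (rule jmul_symmetric)
      also have "\<dots> = \<beta> j * (f i \<bullet> g j)"
        by (simp add: eq system_comb_mult_member[OF G j])
      finally show ?thesis using False by simp
    qed
    ultimately show ?thesis by (simp add: inner_commute)
  qed (simp add: inner_commute[of "g j"])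
  have "(\<Sum>i<n. G (\<alpha> i)) = (\<Sum>i<n. \<Sum>j<m. G (\<alpha> i) * (f i \<bullet> g j) / norm (f i) ^ 2)"
  proof (intro sum.cong refl)
    fix i assume i: "i \<in> {..<n}"
    have "(\<Sum>j<m. G (\<alpha> i) * (f i \<bullet> g j) / norm (f i) ^ 2) = G (\<alpha> i) * (f i \<bullet> e) / norm (f i) ^ 2"
      by (simp add: sumG[symmetric] inner_sum_right sum_distrib_left sum_divide_distrib)
    then show "G (\<alpha> i) = (\<Sum>j<m. G (\<alpha> i) * (f i \<bullet> g j) / norm (f i) ^ 2)"
      using i nzF[of i] system_inner_unit[OF F] by simp
  qed
  also have "\<dots> = (\<Sum>i<n. \<Sum>j<m. G (\<beta> j) * (g j \<bullet> f i) / norm (g j) ^ 2)"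
    by (intro sum.cong refl) (auto simp: cross)
  also have "\<dots> = (\<Sum>j<m. \<Sum>i<n. G (\<beta> j) * (g j \<bullet> f i) / norm (g j) ^ 2)"
    by (rule sum.swap)
  also have "\<dots> = (\<Sum>j<m. G (\<beta> j))"
  proof (intro sum.cong refl)
    fix j assume j: "j \<in> {..<m}"
    have "(\<Sum>i<n. G (\<beta> j) * (g j \<bullet> f i) / norm (g j) ^ 2) = G (\<beta> j) * (g j \<bullet> e) / norm (g j) ^ 2"
      by (simp add: sumF[symmetric] inner_sum_right sum_distrib_left sum_divide_distrib)
    then show "(\<Sum>i<n. G (\<beta> j) * (g j \<bullet> f i) / norm (g j) ^ 2) = G (\<beta> j)"
      using j nzG[of j] system_inner_unit[OF G] by simp
  qed
  finally show ?thesis .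
qed

lemma primitive_systems_same_size:
  assumes f: "primitive_system n f" and g: "primitive_system m g"
  shows "n = m"
proof -
  have "(\<Sum>i<n. 1 *\<^sub>R f i) = (\<Sum>i<m. 1 *\<^sub>R g i)"
    using f g by (simp add: primitive_system_def orth_system_def)
  from primitive_eigenvalue_sum[OF f g this, of "\<lambda>_. 1"] show ?thesis by simp
qed

lemma system_nonempty: "orth_system n f \<Longrightarrow> n > 0"
  using unit_nonzero by (cases n) (auto simp: orth_system_def)

lemma system_annihilating_polynomial:
  assumes f: "orth_system n f"
  obtains a :: "nat \<Rightarrow> real" where "a n \<noteq> 0"
    "(\<Sum>k\<le>n. a k *\<^sub>R jpow (\<Sum>i<n. \<alpha> i *\<^sub>R f i) k) = 0"
proof -
  let ?x = "\<Sum>i<n. \<alpha> i *\<^sub>R f i"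
  \<comment> \<open>the polynomial with the eigenvalues as roots annihilates the element\<close>
  define p where "p = (\<Prod>i<n. [:- \<alpha> i, 1:])"
  have deg: "degree p = n" unfolding p_def by (subst degree_prod_eq_sum_degree) auto
  have root: "poly p (\<alpha> i) = 0" if "i < n" for i
    using that by (auto simp: p_def poly_prod)
  have lc: "coeff p n \<noteq> 0" using deg leading_coeff_0_iff[of p] by (auto simp: p_def)
  have "(\<Sum>k\<le>n. coeff p k *\<^sub>R jpow ?x k) = (\<Sum>k\<le>n. \<Sum>i<n. (coeff p k * \<alpha> i ^ k) *\<^sub>R f i)"
    by (simp add: system_comb_power[OF f] scaleR_sum_right)
  also have "\<dots> = (\<Sum>i<n. \<Sum>k\<le>n. (coeff p k * \<alpha> i ^ k) *\<^sub>R f i)" by (rule sum.swap)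
  also have "\<dots> = (\<Sum>i<n. poly p (\<alpha> i) *\<^sub>R f i)" by (simp add: poly_altdef deg scaleR_sum_left)
  also have "\<dots> = 0" by (simp add: root)
  finally show thesis using lc that by blast
qed

definition power_relation :: "'e \<Rightarrow> nat \<Rightarrow> (nat \<Rightarrow> real) \<Rightarrow> bool" where
  "power_relation x k a \<longleftrightarrow> (\<exists>i\<le>k. a i \<noteq> 0) \<and> (\<Sum>i\<le>k. a i *\<^sub>R jpow x i) = 0"

lemma jdegree_power_relation: "jdegree x = (LEAST k. k > 0 \<and> (\<exists>a. power_relation x k a))"
  by (simp add: jdegree_def power_relation_def)

lemma system_power_relation:
  assumes f: "orth_system n f"
  obtains a where "power_relation (\<Sum>i<n. \<alpha> i *\<^sub>R f i) n a"
proof -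
  obtain a :: "nat \<Rightarrow> real" where a: "a n \<noteq> 0"
      "(\<Sum>k\<le>n. a k *\<^sub>R jpow (\<Sum>i<n. \<alpha> i *\<^sub>R f i) k) = 0"
    by (rule system_annihilating_polynomial[OF f])
  then have "power_relation (\<Sum>i<n. \<alpha> i *\<^sub>R f i) n a"
    unfolding power_relation_def by (intro conjI exI[of _ n]) auto
  then show thesis by (rule that)
qed

lemma jdegree_le_system:
  assumes f: "orth_system n f"
  shows "jdegree (\<Sum>i<n. \<alpha> i *\<^sub>R f i) \<le> n"
proof -
  obtain a where "power_relation (\<Sum>i<n. \<alpha> i *\<^sub>R f i) n a" by (rule system_power_relation[OF f])
  then show ?thesis unfolding jdegree_power_relation
    by (intro Least_le conjI exI[of _ a] system_nonempty[OF f])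
qed

lemma power_relation_ge_system:
  assumes f: "orth_system n f" and inj: "inj_on \<alpha> {..<n}"
    and rel: "power_relation (\<Sum>i<n. \<alpha> i *\<^sub>R f i) k a"
  shows "n \<le> k"
proof -
  let ?x = "\<Sum>i<n. \<alpha> i *\<^sub>R f i"
  have "(\<Sum>i\<le>k. a i *\<^sub>R jpow ?x i) = (\<Sum>i\<le>k. \<Sum>j<n. (a i * \<alpha> j ^ i) *\<^sub>R f j)"
    by (simp add: system_comb_power[OF f] scaleR_sum_right)
  also have "\<dots> = (\<Sum>j<n. \<Sum>i\<le>k. (a i * \<alpha> j ^ i) *\<^sub>R f j)" by (rule sum.swap)
  also have "\<dots> = (\<Sum>j<n. (\<Sum>i\<le>k. a i * \<alpha> j ^ i) *\<^sub>R f j)" by (simp add: scaleR_sum_left)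
  finally have zero: "(\<Sum>j<n. (\<Sum>i\<le>k. a i * \<alpha> j ^ i) *\<^sub>R f j) = 0"
    using rel by (simp add: power_relation_def)
  have "(\<Sum>i\<le>k. a i * \<alpha> j ^ i) = 0" if "j < n" for j
    by (rule system_independent[OF f zero that])
  then have sub: "\<alpha> ` {..<n} \<subseteq> {z. (\<Sum>i\<le>k. a i * z ^ i) = 0}" by auto
  have "\<exists>i\<le>k. a i \<noteq> 0" using rel by (simp add: power_relation_def)
  then have "finite {z. (\<Sum>i\<le>k. a i * z ^ i) = 0}" "card {z. (\<Sum>i\<le>k. a i * z ^ i) = 0} \<le> k"
    using polyfun_rootbound[of k a] by auto
  with sub have "card (\<alpha> ` {..<n}) \<le> k" by (meson card_mono le_trans)
  then show ?thesis using card_image[OF inj] by simp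
qed

lemma jdegree_ge_system:
  assumes f: "orth_system n f" and inj: "inj_on \<alpha> {..<n}"
  shows "n \<le> jdegree (\<Sum>i<n. \<alpha> i *\<^sub>R f i)"
proof -
  let ?P = "\<lambda>k. k > 0 \<and> (\<exists>a. power_relation (\<Sum>i<n. \<alpha> i *\<^sub>R f i) k a)"
  obtain a where "power_relation (\<Sum>i<n. \<alpha> i *\<^sub>R f i) n a" by (rule system_power_relation[OF f])
  then have "?P n" using system_nonempty[OF f] by blast
  then have "?P (jdegree (\<Sum>i<n. \<alpha> i *\<^sub>R f i))" unfolding jdegree_power_relation by (rule LeastI)
  then show ?thesis using power_relation_ge_system[OF f inj] by blast
qed

lemma jrank_eq_primitive_system:
  assumes f: "primitive_system n f" shows "jrank = n"
  unfolding jrank_def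
proof (rule Max_eqI)
  have F: "orth_system n f" using f by (simp add: primitive_system_def)
  have le: "jdegree x \<le> n" for x
  proof -
    obtain m \<beta> g where g: "primitive_system m g" and x: "x = (\<Sum>i<m. \<beta> i *\<^sub>R g i)"
      by (rule primitive_system_exists)
    then show ?thesis using jdegree_le_system[of m g \<beta>] primitive_systems_same_size[OF f g]
      by (simp add: primitive_system_def)
  qed
  then show "finite (range jdegree)" by (auto intro: finite_subset[of _ "{..n}"])
  show "y \<le> n" if "y \<in> range jdegree" for y using that le by auto
  \<comment> \<open>an element with pairwise distinct eigenvalues attains the maximum\<close>
  have "jdegree (\<Sum>i<n. real i *\<^sub>R f i) = n"
    using le jdegree_ge_system[OF F, of real] by (simp add: eq_iff inj_on_def)
  then show "n \<in> range jdegree" by (metis rangeI)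
qed

lemma jordan_frame_iff: "jordan_frame f \<longleftrightarrow> primitive_system jrank f"
  by (auto simp: jordan_frame_def primitive_system_def orth_system_def dest: primitive_idempotentD)

lemma jordan_frame_system: "jordan_frame f \<Longrightarrow> orth_system jrank f"
  by (simp add: jordan_frame_iff primitive_system_def)

lemma spectral_theorem:
  obtains ev f where "spectral_decomposition x ev f"
proof -
  obtain n ev f where f: "primitive_system n f" and x: "x = (\<Sum>i<n. ev i *\<^sub>R f i)"
    by (rule primitive_system_exists)
  with jrank_eq_primitive_system[OF f] that show thesis
    by (simp add: spectral_decomposition_def jordan_frame_iff)
qed

lemma jrank_pos: "jrank > 0"
proof -
  obtain ev f where "spectral_decomposition e ev f" by (rule spectral_theorem)
  then show ?thesis by (auto simp: spectral_decomposition_def dest: jordan_frame_system system_nonempty)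
qed

lemma spectral_sum_unique:
  assumes "spectral_decomposition x \<alpha> f" "spectral_decomposition x \<beta> g"
  shows "(\<Sum>i<jrank. G (\<alpha> i)) = (\<Sum>j<jrank. G (\<beta> j) :: real)"
proof (rule primitive_eigenvalue_sum[where f = f and g = g and \<alpha> = \<alpha> and \<beta> = \<beta>])
  show "primitive_system jrank f" "primitive_system jrank g"
    using assms by (simp_all add: spectral_decomposition_def jordan_frame_iff)
  show "(\<Sum>i<jrank. \<alpha> i *\<^sub>R f i) = (\<Sum>i<jrank. \<beta> i *\<^sub>R g i)"
    using assms by (simp add: spectral_decomposition_def)
qed

lemma jtrace_eq:
  assumes "spectral_decomposition x \<alpha> f" shows "jtrace x = (\<Sum>i<jrank. \<alpha> i)"
  unfolding jtrace_def
proof (rule the_equality)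
  show "\<exists>ev f. spectral_decomposition x ev f \<and> (\<Sum>i<jrank. \<alpha> i) = (\<Sum>i<jrank. ev i)"
    using assms by blast
  show "r = (\<Sum>i<jrank. \<alpha> i)"
    if "\<exists>ev f. spectral_decomposition x ev f \<and> r = (\<Sum>i<jrank. ev i)" for r
    using that spectral_sum_unique[OF assms, of _ _ "\<lambda>t. t"] by fastforce
qed

lemma jtrace_inner: "jtrace x = x \<bullet> e"
  using inner_eq_trace[of x e] by (simp add: jmul_unit_right)

text \<open>The norm is where the trace enters: $\|f_i\|^2 = \langle f_i, e\rangle$ is the trace of $f_i$, and the
  eigenvalues of $f_i$ in its own frame are 0 and a single 1.\<close>

lemma frame_inner:
  assumes f: "jordan_frame f" and i: "i < jrank" and j: "j < jrank"
  shows "f i \<bullet> f j = (if i = j then 1 else 0)"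
proof (cases "i = j")
  case True
  have "f i = (\<Sum>k<jrank. (if k = i then 1 else 0) *\<^sub>R f k)"
    using i by (simp add: if_distrib[of "\<lambda>t. t *\<^sub>R _"] cong: if_cong)
  then have "spectral_decomposition (f i) (\<lambda>k. if k = i then 1 else 0) f"
    using f by (simp add: spectral_decomposition_def)
  then have "f i \<bullet> e = 1" using jtrace_eq i by (simp add: jtrace_inner[symmetric])
  then show ?thesis using True system_inner_unit[OF jordan_frame_system[OF f] i]
    by (simp add: power2_norm_eq_inner)
next
  case False
  then show ?thesis using system_inner[OF jordan_frame_system[OF f] i j] by simp
qed

section \<open>Spectral calculus\<close>

definition spectrum :: "'e \<Rightarrow> real set" where
  "spectrum x = {ev i | ev f i. spectral_decomposition x ev f \<and> i < jrank}"

lemma frame_inner_nonneg: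
  assumes "jordan_frame f" "jordan_frame g" "i < jrank" "j < jrank"
  shows "f i \<bullet> g j \<ge> 0"
  using jordan_frame_system[OF assms(1)] jordan_frame_system[OF assms(2)] assms(3,4)
  by (intro idempotents_inner_nonneg) (auto simp: orth_system_def)

lemma frame_inner_unit:
  assumes f: "jordan_frame f" and i: "i < jrank" shows "f i \<bullet> e = 1"
  using system_inner_unit[OF jordan_frame_system[OF f] i] frame_inner[OF f i i]
  by (simp add: power2_norm_eq_inner)

lemma frame_sum: "jordan_frame f \<Longrightarrow> (\<Sum>i<jrank. f i) = e"
  by (simp add: jordan_frame_def)

lemma frame_row_sum:
  assumes "jordan_frame f" "jordan_frame g" "i < jrank"
  shows "(\<Sum>j<jrank. f i \<bullet> g j) = 1"
  using frame_inner_unit[OF assms(1,3)] by (simp add: inner_sum_right[symmetric] frame_sum[OF assms(2)])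

lemma frame_comb_inner:
  assumes f: "jordan_frame f" and i: "i < jrank"
  shows "(\<Sum>k<jrank. p k *\<^sub>R f k) \<bullet> f i = p i"
proof -
  have "(\<Sum>k<jrank. p k *\<^sub>R f k) \<bullet> f i = (\<Sum>k<jrank. if k = i then p i else 0)"
    unfolding inner_sum_left by (intro sum.cong refl) (auto simp: frame_inner[OF f _ i])
  then show ?thesis using i by simp
qed

lemma frame_comb_inner_comb:
  assumes f: "jordan_frame f"
  shows "(\<Sum>k<jrank. p k *\<^sub>R f k) \<bullet> (\<Sum>k<jrank. q k *\<^sub>R f k) = (\<Sum>k<jrank. p k * q k)"
proof -
  have "(\<Sum>k<jrank. p k *\<^sub>R f k) \<bullet> (\<Sum>k<jrank. q k *\<^sub>R f k)
      = (\<Sum>j<jrank. q j * ((\<Sum>k<jrank. p k *\<^sub>R f k) \<bullet> f j))"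
    by (simp add: inner_sum_right)
  also have "\<dots> = (\<Sum>k<jrank. p k * q k)"
    by (intro sum.cong refl) (simp add: frame_comb_inner[OF f])
  finally show ?thesis .
qed

lemma frame_comb_norm:
  assumes f: "jordan_frame f"
  shows "(norm (\<Sum>k<jrank. p k *\<^sub>R f k))\<^sup>2 = (\<Sum>k<jrank. (p k)\<^sup>2)"
  using frame_comb_inner_comb[OF f, of p p] by (simp add: power2_norm_eq_inner power2_eq_square[of "p _"])

lemma frame_sum_expand:
  assumes f: "jordan_frame f" and g: "jordan_frame g"
  shows "(\<Sum>i<jrank. p i) = (\<Sum>i<jrank. \<Sum>j<jrank. (f i \<bullet> g j) * (p i :: real))"
    and "(\<Sum>j<jrank. q j) = (\<Sum>i<jrank. \<Sum>j<jrank. (f i \<bullet> g j) * (q j :: real))"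
proof -
  show "(\<Sum>i<jrank. p i) = (\<Sum>i<jrank. \<Sum>j<jrank. (f i \<bullet> g j) * (p i :: real))"
    by (intro sum.cong refl) (simp add: sum_distrib_right[symmetric] frame_row_sum[OF f g])
  have "(\<Sum>j<jrank. q j) = (\<Sum>j<jrank. \<Sum>i<jrank. (g j \<bullet> f i) * q j)"
    by (intro sum.cong refl) (simp add: sum_distrib_right[symmetric] frame_row_sum[OF g f])
  also have "\<dots> = (\<Sum>i<jrank. \<Sum>j<jrank. (f i \<bullet> g j) * q j)"
    by (subst sum.swap) (simp add: inner_commute)
  finally show "(\<Sum>j<jrank. q j) = (\<Sum>i<jrank. \<Sum>j<jrank. (f i \<bullet> g j) * (q j :: real))" .
qed

lemma frame_cross_inner:
  "(\<Sum>i<jrank. p i *\<^sub>R f i) \<bullet> (\<Sum>j<jrank. q j *\<^sub>R g j)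
    = (\<Sum>i<jrank. \<Sum>j<jrank. (f i \<bullet> g j) * (p i * q j))"
proof -
  have "(\<Sum>i<jrank. p i *\<^sub>R f i) \<bullet> (\<Sum>j<jrank. q j *\<^sub>R g j)
      = (\<Sum>i<jrank. \<Sum>j<jrank. (p i *\<^sub>R f i) \<bullet> (q j *\<^sub>R g j))"
    by (simp only: inner_sum_left inner_sum_right) (rule sum.swap)
  then show ?thesis by (simp add: mult.assoc mult.commute mult.left_commute)
qed

text \<open>The numbers $\langle f_i, g_j\rangle$ form a doubly stochastic matrix. Hence norms of differences of
  spectral functions of two elements reduce to differences of scalars, although the elements need not
  have a common frame.\<close>

lemma frame_cross_distance:
  assumes f: "jordan_frame f" and g: "jordan_frame g"
  shows "(norm ((\<Sum>i<jrank. p i *\<^sub>R f i) - (\<Sum>j<jrank. q j *\<^sub>R g j)))\<^sup>2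
    = (\<Sum>i<jrank. \<Sum>j<jrank. (f i \<bullet> g j) * (p i - q j)\<^sup>2)"
proof -
  let ?x = "\<Sum>i<jrank. p i *\<^sub>R f i" and ?y = "\<Sum>j<jrank. q j *\<^sub>R g j"
  have "(norm (?x - ?y))\<^sup>2 = (norm ?x)\<^sup>2 - 2 * (?x \<bullet> ?y) + (norm ?y)\<^sup>2"
    by (simp add: power2_norm_eq_inner inner_diff_left inner_diff_right inner_commute)
  also have "\<dots> = (\<Sum>i<jrank. \<Sum>j<jrank. (f i \<bullet> g j) * (p i)\<^sup>2 - 2 * ((f i \<bullet> g j) * (p i * q j)) + (f i \<bullet> g j) * (q j)\<^sup>2)"
    unfolding frame_comb_norm[OF f] frame_comb_norm[OF g] frame_cross_inner
      frame_sum_expand(1)[OF f g, of "\<lambda>i. (p i)\<^sup>2"] frame_sum_expand(2)[OF f g, of "\<lambda>i. (q i)\<^sup>2"]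
    by (simp add: sum.distrib sum_subtractf sum_distrib_left)
  also have "\<dots> = (\<Sum>i<jrank. \<Sum>j<jrank. (f i \<bullet> g j) * (p i - q j)\<^sup>2)"
    by (intro sum.cong refl) (simp add: power2_diff algebra_simps)
  finally show ?thesis .
qed

lemma spectral_match:
  assumes f: "spectral_decomposition x \<alpha> f" and g: "spectral_decomposition x \<beta> g"
    and ij: "i < jrank" "j < jrank" and nz: "f i \<bullet> g j \<noteq> 0"
  shows "\<alpha> i = \<beta> j"
proof -
  have F: "jordan_frame f" and G: "jordan_frame g" and x: "x = (\<Sum>i<jrank. \<alpha> i *\<^sub>R f i)" "x = (\<Sum>i<jrank. \<beta> i *\<^sub>R g i)"
    using f g by (auto simp: spectral_decomposition_def)
  let ?t = "\<lambda>i j. (f i \<bullet> g j) * (\<alpha> i - \<beta> j)\<^sup>2"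
  have nonneg: "?t i j \<ge> 0" if "i < jrank" "j < jrank" for i j
    using frame_inner_nonneg[OF F G that] by simp
  have "(\<Sum>i<jrank. \<Sum>j<jrank. ?t i j) = 0"
    using frame_cross_distance[OF F G, of \<alpha> \<beta>] by (simp add: x[symmetric])
  moreover have "?t i j \<le> (\<Sum>j<jrank. ?t i j)"
    using ij nonneg by (intro member_le_sum) auto
  moreover have "(\<Sum>j<jrank. ?t i j) \<le> (\<Sum>i<jrank. \<Sum>j<jrank. ?t i j)"
    using ij nonneg by (intro member_le_sum[where f = "\<lambda>i. \<Sum>j<jrank. ?t i j"] sum_nonneg) auto
  ultimately have "?t i j = 0" using nonneg[OF ij] by linarith
  then show ?thesis using nz by simp
qed

lemma frame_partner:
  assumes "jordan_frame f" "jordan_frame g" "j < jrank"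
  obtains i where "i < jrank" "f i \<bullet> g j \<noteq> 0"
proof -
  have "(\<Sum>i<jrank. g j \<bullet> f i) \<noteq> 0" using frame_row_sum[OF assms(2,1,3)] by simp
  then obtain i where "i < jrank" "g j \<bullet> f i \<noteq> 0"
    by (metis (no_types, lifting) sum.neutral lessThan_iff)
  then show thesis using that by (simp add: inner_commute)
qed

lemma spectrum_eq:
  assumes f: "spectral_decomposition x \<alpha> f" shows "spectrum x = \<alpha> ` {..<jrank}"
proof
  show "\<alpha> ` {..<jrank} \<subseteq> spectrum x" using f by (auto simp: spectrum_def)
  show "spectrum x \<subseteq> \<alpha> ` {..<jrank}"
  proof
    fix t assume "t \<in> spectrum x"
    then obtain \<beta> g j where g: "spectral_decomposition x \<beta> g" and j: "j < jrank" and t: "t = \<beta> j"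
      by (auto simp: spectrum_def)
    have "jordan_frame f" "jordan_frame g" using f g by (auto simp: spectral_decomposition_def)
    then obtain i where i: "i < jrank" "f i \<bullet> g j \<noteq> 0" using frame_partner j by blast
    then have "t = \<alpha> i" using spectral_match[OF f g i(1) j i(2)] t by simp
    then show "t \<in> \<alpha> ` {..<jrank}" using i(1) by blast
  qed
qed

lemma spectrum_finite: "finite (spectrum x)"
proof -
  obtain \<alpha> f where "spectral_decomposition x \<alpha> f" by (rule spectral_theorem)
  then show ?thesis by (simp add: spectrum_eq)
qed

lemma spectrum_nonempty: "spectrum x \<noteq> {}"
proof -
  obtain \<alpha> f where "spectral_decomposition x \<alpha> f" by (rule spectral_theorem)
  then show ?thesis using jrank_pos by (auto simp: spectrum_eq)
qed

definition jfun :: "(real \<Rightarrow> real) \<Rightarrow> 'e \<Rightarrow> 'e" where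
  "jfun h x = (SOME y. \<exists>ev f. spectral_decomposition x ev f \<and> y = (\<Sum>i<jrank. h (ev i) *\<^sub>R f i))"

lemma jfun_eq:
  assumes f: "spectral_decomposition x \<alpha> f"
  shows "jfun h x = (\<Sum>i<jrank. h (\<alpha> i) *\<^sub>R f i)"
proof -
  let ?P = "\<lambda>y. \<exists>ev f. spectral_decomposition x ev f \<and> y = (\<Sum>i<jrank. h (ev i) *\<^sub>R f i)"
  have "?P (jfun h x)" unfolding jfun_def by (rule someI_ex) (use f in blast)
  then obtain \<beta> g where g: "spectral_decomposition x \<beta> g" and y: "jfun h x = (\<Sum>j<jrank. h (\<beta> j) *\<^sub>R g j)"
    by blast
  have F: "jordan_frame f" and G: "jordan_frame g" using f g by (auto simp: spectral_decomposition_def)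
  have "(norm ((\<Sum>i<jrank. h (\<alpha> i) *\<^sub>R f i) - jfun h x))\<^sup>2
      = (\<Sum>i<jrank. \<Sum>j<jrank. (f i \<bullet> g j) * (h (\<alpha> i) - h (\<beta> j))\<^sup>2)"
    unfolding y by (rule frame_cross_distance[OF F G])
  also have "\<dots> = 0"
  proof (intro sum.neutral ballI)
    fix i j assume "i \<in> {..<jrank}" "j \<in> {..<jrank}"
    then show "(f i \<bullet> g j) * (h (\<alpha> i) - h (\<beta> j))\<^sup>2 = 0"
      using spectral_match[OF f g, of i j] by (cases "f i \<bullet> g j = 0") auto
  qed
  finally show ?thesis by simp
qed

lemma jfun_spectral_decomposition:
  assumes "spectral_decomposition x \<alpha> f"
  shows "spectral_decomposition (jfun h x) (\<lambda>i. h (\<alpha> i)) f"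
  using assms jfun_eq[OF assms, of h] by (simp add: spectral_decomposition_def)

lemma spectrum_jfun: "spectrum (jfun h x) = h ` spectrum x"
proof -
  obtain \<alpha> f where f: "spectral_decomposition x \<alpha> f" by (rule spectral_theorem)
  then show ?thesis
    by (simp add: spectrum_eq[OF f] spectrum_eq[OF jfun_spectral_decomposition[OF f]] image_image)
qed

lemma spectral_mult:
  assumes "spectral_decomposition x \<alpha> f" "i < jrank" shows "x \<diamondop> f i = \<alpha> i *\<^sub>R f i"
  using assms system_comb_mult_member[OF jordan_frame_system] by (auto simp: spectral_decomposition_def)

lemma eigenvalue_inner:
  assumes f: "spectral_decomposition x \<alpha> f" and i: "i < jrank" shows "\<alpha> i = x \<bullet> f i"
  using assms frame_comb_inner[of f i \<alpha>] by (auto simp: spectral_decomposition_def)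

lemma jmul_quadratic_lower:
  assumes m: "\<forall>t\<in>spectrum x. m \<le> t" shows "m * (norm v)\<^sup>2 \<le> v \<bullet> (x \<diamondop> v)"
proof -
  obtain \<alpha> f where f: "spectral_decomposition x \<alpha> f" by (rule spectral_theorem)
  then have F: "jordan_frame f" and x: "x = (\<Sum>i<jrank. \<alpha> i *\<^sub>R f i)"
    by (auto simp: spectral_decomposition_def)
  have "(norm v)\<^sup>2 = v \<bullet> (e \<diamondop> v)" by (simp add: jmul_unit power2_norm_eq_inner)
  also have "\<dots> = v \<bullet> ((\<Sum>i<jrank. f i) \<diamondop> v)" by (simp only: frame_sum[OF F])
  also have "\<dots> = (\<Sum>i<jrank. v \<bullet> (f i \<diamondop> v))" by (simp add: jmul_sum_left inner_sum_right)
  finally have "m * (norm v)\<^sup>2 = (\<Sum>i<jrank. m * (v \<bullet> (f i \<diamondop> v)))" by (simp add: sum_distrib_left)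
  also have "\<dots> \<le> (\<Sum>i<jrank. \<alpha> i * (v \<bullet> (f i \<diamondop> v)))"
  proof (intro sum_mono mult_right_mono)
    fix i assume "i \<in> {..<jrank}"
    then show "m \<le> \<alpha> i" "0 \<le> v \<bullet> (f i \<diamondop> v)"
      using m spectrum_eq[OF f] jordan_frame_system[OF F] idempotent_psd by (auto simp: orth_system_def)
  qed
  also have "\<dots> = v \<bullet> (x \<diamondop> v)"
    unfolding x jmul_sum_left inner_sum_right by (simp add: jmul_dist)
  finally show ?thesis .
qed

lemma spectrum_perturb:
  assumes m: "\<forall>t\<in>spectrum x. m \<le> t" and t: "t \<in> spectrum y"
  shows "m - norm (y - x) \<le> t"
proof -
  obtain \<beta> g where g: "spectral_decomposition y \<beta> g" by (rule spectral_theorem)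
  then have G: "jordan_frame g" by (simp add: spectral_decomposition_def)
  obtain j where j: "j < jrank" "t = \<beta> j" using t spectrum_eq[OF g] by auto
  have gj: "g j \<diamondop> g j = g j" "norm (g j) = 1"
    using jordan_frame_system[OF G] frame_inner[OF G j(1) j(1)] j(1)
    by (auto simp: orth_system_def norm_eq_1)
  have "m \<le> g j \<bullet> (x \<diamondop> g j)" using jmul_quadratic_lower[OF m, of "g j"] gj by simp
  also have "g j \<bullet> (x \<diamondop> g j) = x \<bullet> g j"
    using idempotents_inner[OF gj(1), of x] by simp
  finally have "m \<le> x \<bullet> g j" .
  moreover have "t = x \<bullet> g j + (y - x) \<bullet> g j"
    using eigenvalue_inner[OF g j(1)] j(2) by (simp add: inner_diff_left)
  moreover have "\<bar>(y - x) \<bullet> g j\<bar> \<le> norm (y - x)"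
    using Cauchy_Schwarz_ineq2[of "y - x" "g j"] gj by simp
  ultimately show ?thesis by linarith
qed

lemma spectrum_abs_le_norm:
  assumes t: "t \<in> spectrum x" shows "\<bar>t\<bar> \<le> norm x"
proof -
  obtain \<beta> g where g: "spectral_decomposition x \<beta> g" by (rule spectral_theorem)
  then have G: "jordan_frame g" by (simp add: spectral_decomposition_def)
  obtain j where j: "j < jrank" "t = \<beta> j" using t spectrum_eq[OF g] by auto
  have "norm (g j) = 1" using frame_inner[OF G j(1) j(1)] by (simp add: norm_eq_1)
  then show ?thesis using eigenvalue_inner[OF g j(1)] Cauchy_Schwarz_ineq2[of x "g j"] j(2) by simp
qed

section \<open>The cone and its interior\<close>

definition positive :: "'e \<Rightarrow> bool" where
  "positive x \<longleftrightarrow> (\<forall>t\<in>spectrum x. t > 0)"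

lemma positive_eigenvalue:
  "positive x \<Longrightarrow> spectral_decomposition x \<alpha> f \<Longrightarrow> i < jrank \<Longrightarrow> \<alpha> i > 0"
  by (auto simp: positive_def spectrum_eq)

lemma positiveI:
  "spectral_decomposition x \<alpha> f \<Longrightarrow> (\<And>i. i < jrank \<Longrightarrow> \<alpha> i > 0) \<Longrightarrow> positive x"
  by (auto simp: positive_def spectrum_eq)

lemma positive_lower_bound:
  assumes "positive x" obtains m where "m > 0" "\<forall>t\<in>spectrum x. m \<le> t"
proof (rule that)
  show "Min (spectrum x) > 0" using assms spectrum_finite spectrum_nonempty by (simp add: positive_def)
  show "\<forall>t\<in>spectrum x. Min (spectrum x) \<le> t" using spectrum_finite by simp
qed

lemma symcone_iff: "x \<in> symcone \<longleftrightarrow> (\<forall>t\<in>spectrum x. t \<ge> 0)"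
proof
  assume "x \<in> symcone"
  then obtain y where y: "x = y \<diamondop> y" by (auto simp: symcone_def)
  obtain \<alpha> f where f: "spectral_decomposition y \<alpha> f" by (rule spectral_theorem)
  then have "x = (\<Sum>i<jrank. (\<alpha> i * \<alpha> i) *\<^sub>R f i)"
    unfolding y by (simp add: spectral_decomposition_def system_comb_mult jordan_frame_system)
  with f have "spectral_decomposition x (\<lambda>i. \<alpha> i * \<alpha> i) f" by (simp add: spectral_decomposition_def)
  then show "\<forall>t\<in>spectrum x. t \<ge> 0" by (auto simp: spectrum_eq)
next
  assume pos: "\<forall>t\<in>spectrum x. t \<ge> 0"
  obtain \<alpha> f where f: "spectral_decomposition x \<alpha> f" by (rule spectral_theorem)
  then have F: "jordan_frame f" and x: "x = (\<Sum>i<jrank. \<alpha> i *\<^sub>R f i)"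
    by (auto simp: spectral_decomposition_def)
  have "jfun sqrt x \<diamondop> jfun sqrt x = (\<Sum>i<jrank. (sqrt (\<alpha> i) * sqrt (\<alpha> i)) *\<^sub>R f i)"
    unfolding jfun_eq[OF f] by (rule system_comb_mult[OF jordan_frame_system[OF F]])
  also have "\<dots> = x"
    unfolding x using pos spectrum_eq[OF f] by (intro sum.cong refl) auto
  finally have "x = jfun sqrt x \<diamondop> jfun sqrt x" by simp
  then show "x \<in> symcone" unfolding symcone_def by (rule range_eqI)
qed

lemma positive_ball:
  assumes m: "\<forall>t\<in>spectrum x. m \<le> t" and y: "norm (y - x) < m"
  shows "positive y"
  unfolding positive_def
proof
  fix t assume "t \<in> spectrum y"
  from spectrum_perturb[OF m this] y show "t > 0" by simp
qed

lemma open_positive: "open {x. positive x}"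
  unfolding open_dist
proof (intro ballI)
  fix x assume "x \<in> {x. positive x}"
  then obtain m where m: "m > 0" "\<forall>t\<in>spectrum x. m \<le> t" using positive_lower_bound by blast
  then have "\<forall>y. dist y x < m \<longrightarrow> y \<in> {x. positive x}" using positive_ball by (auto simp: dist_norm)
  with m(1) show "\<exists>d>0. \<forall>y. dist y x < d \<longrightarrow> y \<in> {x. positive x}" by blast
qed

lemma interior_symcone: "interior symcone = {x. positive x}"
proof
  have "{x. positive x} \<subseteq> symcone" by (force simp: positive_def symcone_iff)
  then show "{x. positive x} \<subseteq> interior symcone" using open_positive by (rule interior_maximal)
  show "interior symcone \<subseteq> {x. positive x}"
  proof
    fix x assume "x \<in> interior symcone"
    then obtain r where r: "r > 0" "ball x r \<subseteq> symcone" by (auto simp: mem_interior)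
    define s where "s = r / (2 * norm e)"
    have s: "s > 0" "norm (s *\<^sub>R e) < r" using r unit_nonzero by (auto simp: s_def)
    then have mem: "x - s *\<^sub>R e \<in> symcone" using r(2) by (auto simp: dist_norm)
    obtain \<alpha> f where f: "spectral_decomposition x \<alpha> f" by (rule spectral_theorem)
    then have F: "jordan_frame f" and x: "x = (\<Sum>i<jrank. \<alpha> i *\<^sub>R f i)"
      by (auto simp: spectral_decomposition_def)
    have "x - s *\<^sub>R e = (\<Sum>i<jrank. (\<alpha> i - s) *\<^sub>R f i)"
      by (simp add: x scaleR_diff_left sum_subtractf frame_sum[OF F] scaleR_sum_right[symmetric])
    with F have "spectral_decomposition (x - s *\<^sub>R e) (\<lambda>i. \<alpha> i - s) f"
      by (simp add: spectral_decomposition_def)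
    from spectrum_eq[OF this] mem have "\<forall>i<jrank. \<alpha> i - s \<ge> 0" by (auto simp: symcone_iff)
    with s(1) have "\<forall>i<jrank. \<alpha> i > 0" by force
    then show "x \<in> {x. positive x}" using positiveI[OF f] by simp
  qed
qed

section \<open>The barrier\<close>

lemma barrier_eq:
  assumes f: "spectral_decomposition z \<alpha> f" and z: "positive z"
  shows "barrier z = - (\<Sum>i<jrank. ln (\<alpha> i))"
proof -
  have prod: "(\<Prod>i<jrank. \<beta> i) = exp (\<Sum>i<jrank. ln (\<beta> i))" if "spectral_decomposition z \<beta> g" for \<beta> g
    unfolding exp_sum[OF finite_lessThan]
    by (intro prod.cong refl) (simp add: positive_eigenvalue[OF z that])
  have "jdet z = exp (\<Sum>i<jrank. ln (\<alpha> i))"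
    unfolding jdet_def
  proof (rule the_equality)
    show "\<exists>ev f. spectral_decomposition z ev f \<and> exp (\<Sum>i<jrank. ln (\<alpha> i)) = (\<Prod>i<jrank. ev i)"
      using f prod by metis
    fix r assume "\<exists>ev f. spectral_decomposition z ev f \<and> r = (\<Prod>i<jrank. ev i)"
    then obtain \<beta> g where g: "spectral_decomposition z \<beta> g" and r: "r = (\<Prod>i<jrank. \<beta> i)" by blast
    show "r = exp (\<Sum>i<jrank. ln (\<alpha> i))"
      unfolding r prod[OF g] spectral_sum_unique[OF f g, of ln] by (rule refl)
  qed
  then show ?thesis by (simp add: barrier_def)
qed

definition jinv :: "'e \<Rightarrow> 'e" where "jinv = jfun inverse"

lemma jinv_eq: "spectral_decomposition x \<alpha> f \<Longrightarrow> jinv x = (\<Sum>i<jrank. inverse (\<alpha> i) *\<^sub>R f i)"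
  unfolding jinv_def by (rule jfun_eq)

lemma jmul_jinv:
  assumes "positive x" shows "x \<diamondop> jinv x = e"
proof -
  obtain \<alpha> f where f: "spectral_decomposition x \<alpha> f" by (rule spectral_theorem)
  then have F: "jordan_frame f" and x: "x = (\<Sum>i<jrank. \<alpha> i *\<^sub>R f i)"
    by (auto simp: spectral_decomposition_def)
  have "x \<diamondop> jinv x = (\<Sum>i<jrank. (\<alpha> i * inverse (\<alpha> i)) *\<^sub>R f i)"
    unfolding jinv_eq[OF f] by (subst x) (rule system_comb_mult[OF jordan_frame_system[OF F]])
  also have "\<dots> = (\<Sum>i<jrank. f i)"
    by (intro sum.cong refl) (use positive_eigenvalue[OF assms f] in force)
  finally show ?thesis by (simp add: frame_sum[OF F])
qed

lemma jinv_inner: "positive x \<Longrightarrow> x \<bullet> jinv x = real jrank"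
proof -
  assume x: "positive x"
  obtain f where F: "jordan_frame f"
    using spectral_theorem[of x] by (auto simp: spectral_decomposition_def)
  have "x \<bullet> jinv x = e \<bullet> (x \<diamondop> jinv x)"
    using jmul_symmetric[of x e "jinv x"] by (simp add: jmul_unit_right)
  also have "\<dots> = (\<Sum>i<jrank. f i) \<bullet> e" by (simp only: jmul_jinv[OF x] frame_sum[OF F])
  also have "\<dots> = (\<Sum>i<jrank. f i \<bullet> e)" by (rule inner_sum_left)
  also have "\<dots> = real jrank" by (simp add: frame_inner_unit[OF F])
  finally show ?thesis .
qed

text \<open>In the doubly stochastic expansion the difference of the two sides is a sum of terms
  $u - 1 - \ln u \ge 0$ with $u = \beta_j/\alpha_i$.\<close>

lemma barrier_subgradient:
  assumes z: "positive z" and w: "positive w"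
  shows "barrier w \<ge> barrier z - jinv z \<bullet> (w - z)"
proof -
  obtain \<alpha> f where f: "spectral_decomposition z \<alpha> f" by (rule spectral_theorem)
  obtain \<beta> g where g: "spectral_decomposition w \<beta> g" by (rule spectral_theorem)
  have F: "jordan_frame f" and G: "jordan_frame g" and wg: "w = (\<Sum>j<jrank. \<beta> j *\<^sub>R g j)"
    using f g by (auto simp: spectral_decomposition_def)
  have "(\<Sum>j<jrank. ln (\<beta> j)) - (\<Sum>i<jrank. ln (\<alpha> i)) + real jrank
      = (\<Sum>i<jrank. \<Sum>j<jrank. (f i \<bullet> g j) * ln (\<beta> j) - (f i \<bullet> g j) * ln (\<alpha> i) + (f i \<bullet> g j) * 1)"
    unfolding frame_sum_expand(2)[OF F G, of "\<lambda>j. ln (\<beta> j)"] frame_sum_expand(1)[OF F G, of "\<lambda>j. ln (\<alpha> j)"]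
    using frame_sum_expand(1)[OF F G, of "\<lambda>j. 1"] by (simp add: sum.distrib sum_subtractf)
  also have "\<dots> \<le> (\<Sum>i<jrank. \<Sum>j<jrank. (f i \<bullet> g j) * (inverse (\<alpha> i) * \<beta> j))"
  proof (intro sum_mono)
    fix i j assume ij: "i \<in> {..<jrank}" "j \<in> {..<jrank}"
    have pos: "\<alpha> i > 0" "\<beta> j > 0" using positive_eigenvalue z w f g ij by auto
    have "ln (\<beta> j / \<alpha> i) \<le> \<beta> j / \<alpha> i - 1" using pos by (intro ln_le_minus_one) simp
    moreover have "ln (\<beta> j / \<alpha> i) = ln (\<beta> j) - ln (\<alpha> i)" using pos by (simp add: ln_div)
    moreover have "\<beta> j / \<alpha> i = inverse (\<alpha> i) * \<beta> j" by (simp add: field_simps)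
    ultimately have "ln (\<beta> j) - ln (\<alpha> i) + 1 \<le> inverse (\<alpha> i) * \<beta> j"
      by simp
    then have "(f i \<bullet> g j) * (ln (\<beta> j) - ln (\<alpha> i) + 1) \<le> (f i \<bullet> g j) * (inverse (\<alpha> i) * \<beta> j)"
      using frame_inner_nonneg[OF F G] ij by (intro mult_left_mono) auto
    then show "(f i \<bullet> g j) * ln (\<beta> j) - (f i \<bullet> g j) * ln (\<alpha> i) + (f i \<bullet> g j) * 1 \<le> (f i \<bullet> g j) * (inverse (\<alpha> i) * \<beta> j)"
      by (simp add: algebra_simps)
  qed
  also have "\<dots> = jinv z \<bullet> w"
    unfolding jinv_eq[OF f] by (subst wg) (rule frame_cross_inner[symmetric])
  finally show ?thesis
    using jinv_inner[OF z] by (simp add: barrier_eq[OF f z] barrier_eq[OF g w] inner_diff_right inner_commute[of z])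
qed

lemma jinv_lipschitz:
  assumes z: "\<forall>t\<in>spectrum z. m \<le> t" and w: "\<forall>t\<in>spectrum w. m \<le> t" and m: "m > 0"
  shows "norm (jinv z - jinv w) \<le> norm (z - w) / m\<^sup>2"
proof (rule power2_le_imp_le)
  obtain \<alpha> f where f: "spectral_decomposition z \<alpha> f" by (rule spectral_theorem)
  obtain \<beta> g where g: "spectral_decomposition w \<beta> g" by (rule spectral_theorem)
  have F: "jordan_frame f" and G: "jordan_frame g" and zf: "z = (\<Sum>j<jrank. \<alpha> j *\<^sub>R f j)" and wg: "w = (\<Sum>j<jrank. \<beta> j *\<^sub>R g j)"
    using f g by (auto simp: spectral_decomposition_def)
  have "(norm (jinv z - jinv w))\<^sup>2 = (\<Sum>i<jrank. \<Sum>j<jrank. (f i \<bullet> g j) * (inverse (\<alpha> i) - inverse (\<beta> j))\<^sup>2)"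
    unfolding jinv_eq[OF f] jinv_eq[OF g] by (rule frame_cross_distance[OF F G])
  also have "\<dots> \<le> (\<Sum>i<jrank. \<Sum>j<jrank. (f i \<bullet> g j) * (\<alpha> i - \<beta> j)\<^sup>2 / (m\<^sup>2)\<^sup>2)"
  proof (intro sum_mono)
    fix i j assume ij: "i \<in> {..<jrank}" "j \<in> {..<jrank}"
    have ge: "m \<le> \<alpha> i" "m \<le> \<beta> j" using z w spectrum_eq[OF f] spectrum_eq[OF g] ij by auto
    then have prod: "m * m \<le> \<alpha> i * \<beta> j" using m by (intro mult_mono) auto
    have "inverse (\<alpha> i) - inverse (\<beta> j) = (\<beta> j - \<alpha> i) / (\<alpha> i * \<beta> j)"
      using ge m by (simp add: field_simps)
    then have "(inverse (\<alpha> i) - inverse (\<beta> j))\<^sup>2 = (\<alpha> i - \<beta> j)\<^sup>2 / (\<alpha> i * \<beta> j)\<^sup>2"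
      by (simp add: power_divide power2_commute)
    also have "\<dots> \<le> (\<alpha> i - \<beta> j)\<^sup>2 / (m\<^sup>2)\<^sup>2"
      using prod m ge by (intro divide_left_mono power_mono) (auto simp: power2_eq_square intro!: mult_pos_pos)
    finally show "(f i \<bullet> g j) * (inverse (\<alpha> i) - inverse (\<beta> j))\<^sup>2 \<le> (f i \<bullet> g j) * (\<alpha> i - \<beta> j)\<^sup>2 / (m\<^sup>2)\<^sup>2"
      using mult_left_mono[OF _ frame_inner_nonneg[OF F G, of i j]] ij by (metis lessThan_iff times_divide_eq_right)
  qed
  also have "\<dots> = (norm (z - w))\<^sup>2 / (m\<^sup>2)\<^sup>2"
  proof -
    have "(norm (z - w))\<^sup>2 = (\<Sum>i<jrank. \<Sum>j<jrank. (f i \<bullet> g j) * (\<alpha> i - \<beta> j)\<^sup>2)"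
      unfolding zf wg by (rule frame_cross_distance[OF F G])
    then show ?thesis by (simp add: sum_divide_distrib)
  qed
  finally show "(norm (jinv z - jinv w))\<^sup>2 \<le> (norm (z - w) / m\<^sup>2)\<^sup>2" by (simp add: power_divide)
  show "0 \<le> norm (z - w) / m\<^sup>2" by simp
qed

text \<open>The subgradient inequalities at \<open>z\<close> and at \<open>w\<close> bound the remainder from both sides, and the
  inverse is locally Lipschitz.\<close>

lemma barrier_has_gradient:
  assumes z: "positive z" shows "(barrier has_derivative (\<lambda>h. - (jinv z \<bullet> h))) (at z)"
proof -
  obtain m where m: "m > 0" "\<forall>t\<in>spectrum z. m \<le> t" using positive_lower_bound[OF z] by blast
  show ?thesis
  proof (rule has_derivative_quadratic_bound[where d = "m / 2" and C = "1 / (m / 2)\<^sup>2"])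
    show "bounded_linear (\<lambda>h. - (jinv z \<bullet> h))" by (intro bounded_linear_minus bounded_linear_inner_right)
    show "m / 2 > 0" using m by simp
    fix w assume w: "norm (w - z) < m / 2"
    have sw: "\<forall>t\<in>spectrum w. m / 2 \<le> t"
    proof
      fix t assume "t \<in> spectrum w"
      from spectrum_perturb[OF m(2) this] w show "m / 2 \<le> t" by simp
    qed
    have sz: "\<forall>t\<in>spectrum z. m / 2 \<le> t"
      using m by force
    have pw: "positive w" by (rule positive_ball[OF m(2)]) (use w m in auto)
    have "barrier w - barrier z + jinv z \<bullet> (w - z) \<ge> 0" using barrier_subgradient[OF z pw] by simp
    moreover have "barrier w - barrier z + jinv z \<bullet> (w - z) \<le> (jinv z - jinv w) \<bullet> (w - z)"
      using barrier_subgradient[OF pw z] by (simp add: inner_diff_left inner_diff_right)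
    moreover have "(jinv z - jinv w) \<bullet> (w - z) \<le> norm (jinv z - jinv w) * norm (w - z)"
      by (rule norm_cauchy_schwarz)
    moreover have "norm (jinv z - jinv w) * norm (w - z) \<le> norm (z - w) / (m / 2)\<^sup>2 * norm (w - z)"
      using jinv_lipschitz[OF sz sw] m by (intro mult_right_mono) auto
    moreover have "norm (z - w) / (m / 2)\<^sup>2 * norm (w - z) = 1 / (m / 2)\<^sup>2 * (norm (w - z))\<^sup>2"
      by (simp add: norm_minus_commute[of z] power2_eq_square)
    ultimately show "norm (barrier w - barrier z - - (jinv z \<bullet> (w - z))) \<le> 1 / (m / 2)\<^sup>2 * (norm (w - z))\<^sup>2"
      unfolding real_norm_def diff_minus_eq_add by linarith
  qed
qed

section \<open>One-parameter groups of automorphisms of the cone\<close>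

definition eigenbasis :: "'e \<Rightarrow> 'e set" where
  "eigenbasis a = (SOME U. finite U \<and> (\<forall>b\<in>U. \<forall>b'\<in>U. b \<bullet> b' = (if b = b' then 1 else 0)) \<and>
     (\<forall>v. v = (\<Sum>b\<in>U. (v \<bullet> b) *\<^sub>R b)) \<and> (\<forall>b\<in>U. a \<diamondop> b = (b \<bullet> (a \<diamondop> b)) *\<^sub>R b))"

lemma eigenbasis:
  shows eigenbasis_finite: "finite (eigenbasis a)"
    and eigenbasis_orthonormal: "b \<in> eigenbasis a \<Longrightarrow> b' \<in> eigenbasis a \<Longrightarrow> b \<bullet> b' = (if b = b' then 1 else 0)"
    and eigenbasis_expand: "(\<Sum>b\<in>eigenbasis a. (v \<bullet> b) *\<^sub>R b) = v"
    and eigenbasis_eigen: "b \<in> eigenbasis a \<Longrightarrow> a \<diamondop> b = (b \<bullet> (a \<diamondop> b)) *\<^sub>R b"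
proof -
  have "\<exists>U. finite U \<and> (\<forall>b\<in>U. \<forall>b'\<in>U. b \<bullet> b' = (if b = b' then 1 else 0)) \<and>
     (\<forall>v. v = (\<Sum>b\<in>U. (v \<bullet> b) *\<^sub>R b)) \<and> (\<forall>b\<in>U. a \<diamondop> b = (b \<bullet> (a \<diamondop> b)) *\<^sub>R b)"
    using symmetric_eigenbasis[OF jmul_linear jmul_symmetric subspace_UNIV, of a] by simp
  from someI_ex[OF this, folded eigenbasis_def]
  have *: "finite (eigenbasis a)"
    "\<forall>b\<in>eigenbasis a. \<forall>b'\<in>eigenbasis a. b \<bullet> b' = (if b = b' then 1 else 0)"
    "\<forall>v. v = (\<Sum>b\<in>eigenbasis a. (v \<bullet> b) *\<^sub>R b)"
    "\<forall>b\<in>eigenbasis a. a \<diamondop> b = (b \<bullet> (a \<diamondop> b)) *\<^sub>R b" by blast+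
  show "finite (eigenbasis a)" by (rule *(1))
  show "b \<in> eigenbasis a \<Longrightarrow> b' \<in> eigenbasis a \<Longrightarrow> b \<bullet> b' = (if b = b' then 1 else 0)" using *(2) by blast
  show "(\<Sum>b\<in>eigenbasis a. (v \<bullet> b) *\<^sub>R b) = v" using *(3)[rule_format, of v] by (rule sym)
  show "b \<in> eigenbasis a \<Longrightarrow> a \<diamondop> b = (b \<bullet> (a \<diamondop> b)) *\<^sub>R b" using *(4) by blast
qed

text \<open>The exponential of \<open>t\<close> times the multiplication by \<open>a\<close>, in an orthonormal eigenbasis of that
  multiplication.\<close>

definition flow :: "'e \<Rightarrow> real \<Rightarrow> 'e \<Rightarrow> 'e" where
  "flow a t v = (\<Sum>b\<in>eigenbasis a. (exp (t * (b \<bullet> (a \<diamondop> b))) * (v \<bullet> b)) *\<^sub>R b)"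

lemma flow_linear: "linear (flow a t)"
  by (rule linearI)
    (simp_all add: flow_def inner_add_left distrib_left scaleR_add_left sum.distrib scaleR_sum_right
      mult.left_commute)

lemma flow_inner_basis:
  assumes b: "b \<in> eigenbasis a"
  shows "flow a t v \<bullet> b = exp (t * (b \<bullet> (a \<diamondop> b))) * (v \<bullet> b)"
proof -
  have "flow a t v \<bullet> b
      = (\<Sum>b'\<in>eigenbasis a. if b' = b then exp (t * (b \<bullet> (a \<diamondop> b))) * (v \<bullet> b) else 0)"
    unfolding flow_def inner_sum_left
    by (intro sum.cong refl) (auto simp: eigenbasis_orthonormal[OF _ b])
  then show ?thesis using b eigenbasis_finite by simp
qed

lemma flow_add: "flow a s (flow a t v) = flow a (s + t) v"
  unfolding flow_def[of a s] flow_def[of a "s + t"]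
  by (intro sum.cong refl) (simp add: flow_inner_basis exp_add distrib_right)

lemma flow_zero: "flow a 0 v = v"
  by (simp add: flow_def eigenbasis_expand)

lemma flow_symmetric: "flow a t v \<bullet> w = v \<bullet> flow a t w"
  unfolding flow_def inner_sum_left inner_sum_right
  by (intro sum.cong refl) (simp add: inner_commute)

lemma flow_jmul: "(\<Sum>b\<in>eigenbasis a. ((b \<bullet> (a \<diamondop> b)) * (v \<bullet> b)) *\<^sub>R b) = a \<diamondop> v"
proof -
  have "a \<diamondop> v = a \<diamondop> (\<Sum>b\<in>eigenbasis a. (v \<bullet> b) *\<^sub>R b)" by (simp only: eigenbasis_expand)
  also have "\<dots> = (\<Sum>b\<in>eigenbasis a. (v \<bullet> b) *\<^sub>R (a \<diamondop> b))"
    by (simp add: jmul_sum_right jmul_dist)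
  also have "\<dots> = (\<Sum>b\<in>eigenbasis a. ((b \<bullet> (a \<diamondop> b)) * (v \<bullet> b)) *\<^sub>R b)"
  proof (intro sum.cong refl)
    fix b assume "b \<in> eigenbasis a"
    from eigenbasis_eigen[OF this]
    have "(v \<bullet> b) *\<^sub>R (a \<diamondop> b) = (v \<bullet> b) *\<^sub>R ((b \<bullet> (a \<diamondop> b)) *\<^sub>R b)" by (rule arg_cong)
    then show "(v \<bullet> b) *\<^sub>R (a \<diamondop> b) = ((b \<bullet> (a \<diamondop> b)) * (v \<bullet> b)) *\<^sub>R b" by (simp add: mult.commute)
  qed
  finally show ?thesis by simp
qed

lemma flow_has_vector_derivative:
  "((\<lambda>u. flow a (u * t) v) has_vector_derivative t *\<^sub>R (a \<diamondop> flow a (u * t) v)) (at u)"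
proof -
  let ?l = "\<lambda>b. b \<bullet> (a \<diamondop> b)"
  have "((\<lambda>u. \<Sum>b\<in>eigenbasis a. (exp (u * t * ?l b) * (v \<bullet> b)) *\<^sub>R b) has_vector_derivative
      (\<Sum>b\<in>eigenbasis a. (t * ?l b * (exp (u * t * ?l b) * (v \<bullet> b))) *\<^sub>R b)) (at u)"
  proof (rule has_vector_derivative_sum)
    fix b
    have "((\<lambda>u. exp (u * t * ?l b) * (v \<bullet> b)) has_real_derivative t * ?l b * (exp (u * t * ?l b) * (v \<bullet> b))) (at u)"
      by (auto intro!: derivative_eq_intros)
    then have "((\<lambda>u. exp (u * t * ?l b) * (v \<bullet> b)) has_vector_derivative t * ?l b * (exp (u * t * ?l b) * (v \<bullet> b))) (at u)"
      by (simp add: has_real_derivative_iff_has_vector_derivative)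
    from bounded_linear.has_vector_derivative[OF bounded_linear_scaleR_left this, of b]
    show "((\<lambda>u. (exp (u * t * ?l b) * (v \<bullet> b)) *\<^sub>R b) has_vector_derivative
        (t * ?l b * (exp (u * t * ?l b) * (v \<bullet> b))) *\<^sub>R b) (at u)" .
  qed
  moreover have "(\<Sum>b\<in>eigenbasis a. (t * ?l b * (exp (u * t * ?l b) * (v \<bullet> b))) *\<^sub>R b)
      = t *\<^sub>R (\<Sum>b\<in>eigenbasis a. (?l b * (flow a (u * t) v \<bullet> b)) *\<^sub>R b)"
    by (simp add: flow_inner_basis scaleR_sum_right mult.assoc)
  then have "(\<Sum>b\<in>eigenbasis a. (t * ?l b * (exp (u * t * ?l b) * (v \<bullet> b))) *\<^sub>R b)
      = t *\<^sub>R (a \<diamondop> flow a (u * t) v)"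
    by (simp only: flow_jmul)
  ultimately show ?thesis by (simp add: flow_def)
qed

lemma flow_eigenvector:
  assumes c: "a \<diamondop> c = l *\<^sub>R c" shows "flow a t c = exp (t * l) *\<^sub>R c"
proof -
  have "flow a t c = (\<Sum>b\<in>eigenbasis a. exp (t * l) *\<^sub>R ((c \<bullet> b) *\<^sub>R b))"
    unfolding flow_def
  proof (intro sum.cong refl)
    fix b assume b: "b \<in> eigenbasis a"
    have "l * (c \<bullet> b) = (a \<diamondop> c) \<bullet> b" by (simp add: c)
    also have "\<dots> = c \<bullet> (a \<diamondop> b)" by (rule jmul_symmetric)
    also have "\<dots> = (b \<bullet> (a \<diamondop> b)) * (c \<bullet> b)" by (subst eigenbasis_eigen[OF b]) simp
    finally have "c \<bullet> b = 0 \<or> l = b \<bullet> (a \<diamondop> b)" by simp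
    then show "(exp (t * (b \<bullet> (a \<diamondop> b))) * (c \<bullet> b)) *\<^sub>R b = exp (t * l) *\<^sub>R (c \<bullet> b) *\<^sub>R b" by auto
  qed
  then show ?thesis by (simp only: scaleR_sum_right[symmetric] eigenbasis_expand)
qed

lemma flow_norm_le:
  assumes m: "\<forall>s\<in>spectrum a. m \<le> s" and t: "t \<ge> 0"
  shows "norm (flow a (- t) v) \<le> exp (- t * m) * norm v"
proof -
  have norm_eq: "(norm w)\<^sup>2 = (\<Sum>b\<in>eigenbasis a. (w \<bullet> b)\<^sup>2)" for w
  proof -
    have "(norm w)\<^sup>2 = w \<bullet> (\<Sum>b\<in>eigenbasis a. (w \<bullet> b) *\<^sub>R b)"
      by (simp only: eigenbasis_expand power2_norm_eq_inner)
    then show ?thesis by (simp add: inner_sum_right power2_eq_square)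
  qed
  have "(norm (flow a (- t) v))\<^sup>2 = (\<Sum>b\<in>eigenbasis a. (exp (- t * (b \<bullet> (a \<diamondop> b))))\<^sup>2 * (v \<bullet> b)\<^sup>2)"
    unfolding norm_eq by (intro sum.cong refl) (simp add: flow_inner_basis power_mult_distrib)
  also have "\<dots> \<le> (\<Sum>b\<in>eigenbasis a. (exp (- t * m))\<^sup>2 * (v \<bullet> b)\<^sup>2)"
  proof (intro sum_mono mult_right_mono power_mono)
    fix b assume b: "b \<in> eigenbasis a"
    have "m \<le> b \<bullet> (a \<diamondop> b)"
      using jmul_quadratic_lower[OF m, of b] eigenbasis_orthonormal[OF b b] by (simp add: power2_norm_eq_inner)
    then show "exp (- t * (b \<bullet> (a \<diamondop> b))) \<le> exp (- t * m)" using t by (simp add: mult_left_mono)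
  qed auto
  also have "\<dots> = (exp (- t * m) * norm v)\<^sup>2"
    by (simp add: norm_eq sum_distrib_left power_mult_distrib)
  finally show ?thesis by (rule power2_le_imp_le) simp
qed

text \<open>On bounded sets the barrier controls the distance to the boundary of the cone: all
  eigenvalues are at most \<open>M\<close>, so a small eigenvalue would make the barrier large.\<close>

lemma spectrum_lower_of_barrier:
  assumes w: "positive w" and M: "norm w \<le> M" "1 \<le> M" and K: "barrier w \<le> K"
  shows "\<forall>t\<in>spectrum w. exp (- K - real jrank * ln M) \<le> t"
proof
  fix t assume t: "t \<in> spectrum w"
  obtain \<alpha> f where f: "spectral_decomposition w \<alpha> f" by (rule spectral_theorem)
  obtain j where j: "j < jrank" "t = \<alpha> j" using t spectrum_eq[OF f] by auto
  have pos: "\<alpha> i > 0" if "i < jrank" for i by (rule positive_eigenvalue[OF w f that])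
  have ub: "ln (\<alpha> i) \<le> ln M" if "i < jrank" for i
  proof -
    have "\<alpha> i \<in> spectrum w" using spectrum_eq[OF f] that by blast
    then have "\<alpha> i \<le> M" using spectrum_abs_le_norm M by fastforce
    then show ?thesis using pos[OF that] by simp
  qed
  have lnM: "ln M \<ge> 0" using M by simp
  have "(\<Sum>i<jrank. ln (\<alpha> i)) = ln (\<alpha> j) + (\<Sum>i\<in>{..<jrank} - {j}. ln (\<alpha> i))"
    using j by (subst sum.remove[of _ j]) auto
  also have "(\<Sum>i\<in>{..<jrank} - {j}. ln (\<alpha> i)) \<le> (\<Sum>i\<in>{..<jrank} - {j}. ln M)"
    using ub by (intro sum_mono) auto
  also have "\<dots> \<le> real jrank * ln M"
    using lnM j by (simp add: mult_right_mono)
  finally have "- K - real jrank * ln M \<le> ln (\<alpha> j)"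
    using K barrier_eq[OF f w] by simp
  then show "exp (- K - real jrank * ln M) \<le> t"
    using pos[OF j(1)] j(2) by (metis exp_le_cancel_iff exp_ln)
qed

text \<open>By associativity of the inner product, $\langle y^{-1}, a \circ y\rangle = \langle e, a\rangle$, so the
  barrier has constant speed along the flow.\<close>

lemma flow_barrier_segment:
  assumes pos: "\<forall>u\<in>{0..u1}. positive (flow a (u * t) y)" and u1: "u1 \<ge> 0"
  shows "barrier (flow a (u1 * t) y) = barrier y - u1 * t * (a \<bullet> e)"
proof (cases "u1 = 0")
  case True then show ?thesis by (simp add: flow_zero)
next
  case False
  let ?Y = "\<lambda>u. flow a (u * t) y"
  let ?h = "\<lambda>u. barrier (?Y u) + u * t * (a \<bullet> e)"
  have der: "DERIV ?h u :> 0" if u: "u \<in> {0..u1}" for u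
  proof -
    have p: "positive (?Y u)" using pos u by blast
    have "((\<lambda>u. barrier (?Y u)) has_derivative (\<lambda>h. - (jinv (?Y u) \<bullet> (h *\<^sub>R (t *\<^sub>R (a \<diamondop> ?Y u)))))) (at u)"
      using has_derivative_compose[OF flow_has_vector_derivative[unfolded has_vector_derivative_def]
          barrier_has_gradient[OF p]] by simp
    moreover have "jinv (?Y u) \<bullet> (a \<diamondop> ?Y u) = a \<bullet> e"
    proof -
      have "jinv (?Y u) \<bullet> (a \<diamondop> ?Y u) = jinv (?Y u) \<bullet> (?Y u \<diamondop> a)" by (simp only: jmul_commute)
      also have "\<dots> = (?Y u \<diamondop> jinv (?Y u)) \<bullet> a" by (rule jmul_symmetric[symmetric])
      also have "\<dots> = e \<bullet> a" by (simp only: jmul_jinv[OF p])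
      finally show ?thesis by (simp only: inner_commute)
    qed
    then have "(\<lambda>h. - (jinv (?Y u) \<bullet> (h *\<^sub>R (t *\<^sub>R (a \<diamondop> ?Y u))))) = (*) (- (t * (a \<bullet> e)))"
      by (intro ext) simp
    ultimately have "((\<lambda>u. barrier (?Y u)) has_real_derivative - (t * (a \<bullet> e))) (at u)"
      by (simp only: has_field_derivative_def)
    then show ?thesis by (auto intro!: derivative_eq_intros)
  qed
  have "?h u1 = ?h 0"
  proof (rule DERIV_isconst_end[where f = ?h and a = 0 and b = u1])
    show "0 < u1" using False u1 by simp
    show "continuous_on {0..u1} ?h"
      using der by (intro continuous_at_imp_continuous_on ballI DERIV_isCont) auto
    show "DERIV ?h u :> 0" if "0 < u" "u < u1" for u using der that by auto
  qed
  then show ?thesis by (simp add: flow_zero)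
qed

text \<open>At a first exit time the barrier would still be bounded along the path, which keeps the
  eigenvalues away from zero.\<close>

lemma flow_positive:
  assumes y: "positive y" shows "positive (flow a t y)"
proof (rule ccontr)
  assume neg: "\<not> positive (flow a t y)"
  let ?Y = "\<lambda>u. flow a (u * t) y"
  have cont: "continuous_on S ?Y" for S
    by (intro continuous_at_imp_continuous_on ballI has_vector_derivative_continuous[OF flow_has_vector_derivative])
  \<comment> \<open>the first exit time is the infimum of \<open>T\<close>\<close>
  define T where "T = {u\<in>{0..1}. \<not> positive (?Y u)}"
  have "closed T"
  proof -
    have "T = {0..1} \<inter> ?Y -` (- {x. positive x})" by (auto simp: T_def)
    then show ?thesis
      using continuous_closed_preimage[OF cont[of "{0..1}"] closed_atLeastAtMost, of "- {x. positive x}"] open_positive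
      by (simp add: closed_Compl)
  qed
  moreover have "1 \<in> T" using neg by (simp add: T_def)
  moreover have "bdd_below T" by (rule bdd_belowI[of _ 0]) (auto simp: T_def)
  ultimately have mem: "Inf T \<in> T" using closed_contains_Inf[of T] by blast
  define u0 where "u0 = Inf T"
  have u0: "0 \<le> u0" "u0 \<le> 1" "\<not> positive (?Y u0)" using mem by (auto simp: T_def u0_def)
  have before: "positive (?Y u)" if "0 \<le> u" "u < u0" for u
  proof (rule ccontr)
    assume "\<not> positive (?Y u)"
    then have "u \<in> T" using that u0 by (simp add: T_def)
    then show False using that cInf_lower[OF _ \<open>bdd_below T\<close>] by (fastforce simp: u0_def)
  qed
  have "u0 \<noteq> 0" using u0(3) y by (auto simp: flow_zero)
  with u0 have u0pos: "u0 > 0" by simp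
  have "bounded (?Y ` {0..1})" by (rule compact_imp_bounded[OF compact_continuous_image[OF cont]]) simp
  then obtain M0 where M0: "\<forall>u\<in>{0..1}. norm (?Y u) \<le> M0" by (auto simp: bounded_iff)
  define M where "M = max 1 M0"
  define K where "K = barrier y + \<bar>t * (a \<bullet> e)\<bar>"
  define m where "m = exp (- K - real jrank * ln M)"
  have m: "m > 0" by (simp add: m_def)
  have low: "\<forall>s\<in>spectrum (?Y u). m \<le> s" if u: "0 \<le> u" "u < u0" for u
    unfolding m_def
  proof (rule spectrum_lower_of_barrier)
    show "positive (?Y u)" by (rule before[OF u])
    show "norm (?Y u) \<le> M" using M0 u u0 by (force simp: M_def)
    show "1 \<le> M" by (simp add: M_def)
    have "barrier (?Y u) = barrier y - u * t * (a \<bullet> e)"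
      by (rule flow_barrier_segment) (use before u in auto)
    also have "\<dots> \<le> K"
    proof -
      have "\<bar>u * (t * (a \<bullet> e))\<bar> \<le> 1 * \<bar>t * (a \<bullet> e)\<bar>"
        unfolding abs_mult[of u] using u u0 by (intro mult_right_mono) auto
      then show ?thesis by (simp add: K_def mult.assoc abs_le_iff)
    qed
    finally show "barrier (?Y u) \<le> K" .
  qed
  have "isCont ?Y u0" by (rule has_vector_derivative_continuous[OF flow_has_vector_derivative])
  then obtain d where d: "d > 0" "\<And>u. dist u u0 < d \<Longrightarrow> dist (?Y u) (?Y u0) < m"
    using m unfolding continuous_at_eps_delta by blast
  define u where "u = max 0 (u0 - d / 2)"
  have u: "0 \<le> u" "u < u0" "dist u u0 < d" using d(1) u0pos by (auto simp: u_def dist_real_def)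
  have "positive (?Y u0)"
    by (rule positive_ball[OF low[OF u(1,2)]]) (use d(2)[OF u(3)] in \<open>simp add: dist_norm norm_minus_commute\<close>)
  with u0 show False by blast
qed

lemma flow_barrier:
  assumes y: "positive y" shows "barrier (flow a t y) = barrier y - t * (a \<bullet> e)"
  using flow_barrier_segment[of 1 a t y] flow_positive[OF y] by simp

section \<open>Homogeneity of the cone\<close>

text \<open>The exponential of the multiplication by $\ln z$ and its inverse. Both are symmetric, preserve the
  cone, and move the unit to \<open>z\<close> and to the inverse of \<open>z\<close> (with the quadratic
  representation $P$ of the algebra they are $P(z^{1/2})$ and $P(z^{-1/2})$).\<close>

definition scal :: "'e \<Rightarrow> 'e \<Rightarrow> 'e" where "scal z = flow (jfun ln z) 1"
definition scali :: "'e \<Rightarrow> 'e \<Rightarrow> 'e" where "scali z = flow (jfun ln z) (- 1)"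

lemma scal_linear: "linear (scal z)" and scali_linear: "linear (scali z)"
  by (simp_all add: scal_def scali_def flow_linear)

lemma scal_scali: "scal z (scali z v) = v" and scali_scal: "scali z (scal z v) = v"
  by (simp_all add: scal_def scali_def flow_add flow_zero)

lemma scal_symmetric: "scal z v \<bullet> w = v \<bullet> scal z w" and scali_symmetric: "scali z v \<bullet> w = v \<bullet> scali z w"
  by (simp_all add: scal_def scali_def flow_symmetric)

lemma scal_positive: "positive y \<Longrightarrow> positive (scal z y)"
  and scali_positive: "positive y \<Longrightarrow> positive (scali z y)"
  by (simp_all add: scal_def scali_def flow_positive)

lemma jfun_ln_inner_unit:
  assumes z: "positive z" shows "jfun ln z \<bullet> e = - barrier z"
proof -
  obtain \<alpha> f where f: "spectral_decomposition z \<alpha> f" by (rule spectral_theorem)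
  then have F: "jordan_frame f" by (simp add: spectral_decomposition_def)
  have "jfun ln z \<bullet> e = (\<Sum>i<jrank. ln (\<alpha> i) * (f i \<bullet> e))"
    by (simp add: jfun_eq[OF f] inner_sum_left)
  also have "\<dots> = (\<Sum>i<jrank. ln (\<alpha> i))" by (simp add: frame_inner_unit[OF F])
  finally show ?thesis by (simp add: barrier_eq[OF f z])
qed

lemma scal_barrier: "positive z \<Longrightarrow> positive y \<Longrightarrow> barrier (scal z y) = barrier y + barrier z"
  and scali_barrier: "positive z \<Longrightarrow> positive y \<Longrightarrow> barrier (scali z y) = barrier y - barrier z"
  by (simp_all add: scal_def scali_def flow_barrier jfun_ln_inner_unit)

lemma scal_frame:
  assumes f: "spectral_decomposition z \<alpha> f" and z: "positive z" and i: "i < jrank"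
  shows "scal z (f i) = \<alpha> i *\<^sub>R f i" "scali z (f i) = inverse (\<alpha> i) *\<^sub>R f i"
proof -
  have "\<alpha> i > 0" by (rule positive_eigenvalue[OF z f i])
  moreover have "jfun ln z \<diamondop> f i = ln (\<alpha> i) *\<^sub>R f i"
    by (rule spectral_mult[OF jfun_spectral_decomposition[OF f] i])
  ultimately show "scal z (f i) = \<alpha> i *\<^sub>R f i" "scali z (f i) = inverse (\<alpha> i) *\<^sub>R f i"
    using flow_eigenvector[of "jfun ln z" "f i" "ln (\<alpha> i)"] by (simp_all add: scal_def scali_def exp_minus)
qed

lemma scal_comb:
  assumes f: "spectral_decomposition z \<alpha> f" and z: "positive z"
  shows "scal z (\<Sum>i<jrank. p i *\<^sub>R f i) = (\<Sum>i<jrank. (p i * \<alpha> i) *\<^sub>R f i)"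
    "scali z (\<Sum>i<jrank. p i *\<^sub>R f i) = (\<Sum>i<jrank. (p i * inverse (\<alpha> i)) *\<^sub>R f i)"
  by (simp_all add: linear_sum[OF scal_linear] linear_sum[OF scali_linear] o_def
      linear_scale[OF scal_linear] linear_scale[OF scali_linear] scal_frame[OF f z])

lemma scal_unit:
  assumes z: "positive z" shows "scal z e = z" "scali z e = jinv z"
proof -
  obtain \<alpha> f where f: "spectral_decomposition z \<alpha> f" by (rule spectral_theorem)
  then have F: "jordan_frame f" and zf: "z = (\<Sum>i<jrank. \<alpha> i *\<^sub>R f i)" by (auto simp: spectral_decomposition_def)
  have e: "e = (\<Sum>i<jrank. 1 *\<^sub>R f i)" using frame_sum[OF F] by simp
  show "scal z e = z" using scal_comb(1)[OF f z, of "\<lambda>_. 1"] by (simp add: frame_sum[OF F] zf[symmetric])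
  show "scali z e = jinv z"
    using scal_comb(2)[OF f z, of "\<lambda>_. 1"] by (simp add: frame_sum[OF F] jinv_eq[OF f])
qed

lemma scali_norm_le:
  assumes m: "m > 0" "\<forall>t\<in>spectrum z. m \<le> t"
  shows "norm (scali z v) \<le> norm v / m"
proof -
  have "\<forall>t\<in>spectrum (jfun ln z). ln m \<le> t"
    using m by (auto simp: spectrum_jfun)
  from flow_norm_le[OF this, of 1 v] show ?thesis
    using m(1) by (simp add: scali_def exp_minus divide_inverse mult.commute)
qed

text \<open>Compare the gradients of the two sides of the invariance.\<close>

lemma jinv_of_barrier_invariance:
  assumes g: "linear g" and pos: "\<And>y. positive y \<Longrightarrow> positive (g y)"
    and sym: "\<And>v w. g v \<bullet> w = v \<bullet> g w" and b: "\<And>y. positive y \<Longrightarrow> barrier (g y) = barrier y + C"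
    and y: "positive y"
  shows "g (jinv (g y)) = jinv y"
proof -
  have bl: "bounded_linear g" using g by (simp add: linear_conv_bounded_linear)
  have "((\<lambda>y. barrier (g y)) has_derivative (\<lambda>h. - (jinv (g y) \<bullet> g h))) (at y)"
    using has_derivative_compose[OF bounded_linear.has_derivative[OF bl has_derivative_ident]
        barrier_has_gradient[OF pos[OF y]]] .
  moreover have "((\<lambda>y. barrier y + C) has_derivative (\<lambda>h. - (jinv y \<bullet> h))) (at y)"
    using has_derivative_add[OF barrier_has_gradient[OF y] has_derivative_const[of C]] by simp
  then have "((\<lambda>y. barrier (g y)) has_derivative (\<lambda>h. - (jinv y \<bullet> h))) (at y)"
    by (rule has_derivative_transform_within_open[OF _ open_positive]) (auto simp: y b)
  ultimately have "(\<lambda>h. - (jinv (g y) \<bullet> g h)) = (\<lambda>h. - (jinv y \<bullet> h))"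
    by (rule has_derivative_unique)
  then have "g (jinv (g y)) \<bullet> h = jinv y \<bullet> h" for h
    by (metis neg_equal_iff_equal sym)
  then show ?thesis using vector_eq_rdot by blast
qed

lemma jinv_scali: assumes z: "positive z" and y: "positive y" shows "jinv (scali z y) = scal z (jinv y)"
proof -
  have "scali z (jinv (scali z y)) = jinv y"
  proof (rule jinv_of_barrier_invariance[OF scali_linear scali_positive scali_symmetric _ y])
    show "barrier (scali z y) = barrier y + - barrier z" if "positive y" for y
      using scali_barrier[OF z that] by simp
  qed
  then show ?thesis using scal_scali by metis
qed

section \<open>The Hessian of the barrier\<close>

lemma unit_plus_spectral:
  assumes f: "spectral_decomposition h \<eta> f"
  shows "spectral_decomposition (e + h) (\<lambda>i. 1 + \<eta> i) f"
proof -
  have F: "jordan_frame f" and hf: "h = (\<Sum>i<jrank. \<eta> i *\<^sub>R f i)" using f by (auto simp: spectral_decomposition_def)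
  have "(\<Sum>i<jrank. (1 + \<eta> i) *\<^sub>R f i) = (\<Sum>i<jrank. f i) + h"
    by (simp add: hf scaleR_add_left sum.distrib)
  with F show ?thesis by (simp add: spectral_decomposition_def frame_sum[OF F])
qed

lemma unit_plus_positive:
  assumes "norm h < 1" shows "positive (e + h)"
proof -
  obtain \<eta> f where f: "spectral_decomposition h \<eta> f" by (rule spectral_theorem)
  have "1 + \<eta> i > 0" if "i < jrank" for i
    using spectrum_abs_le_norm[of "\<eta> i" h] that spectrum_eq[OF f] assms by fastforce
  then show ?thesis by (rule positiveI[OF unit_plus_spectral[OF f]])
qed

lemma jinv_unit: "jinv e = e"
proof -
  obtain \<alpha> f where "spectral_decomposition e \<alpha> f" by (rule spectral_theorem)
  then have F: "jordan_frame f" by (simp add: spectral_decomposition_def)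
  have "spectral_decomposition e (\<lambda>_. 1) f" using F frame_sum[OF F] by (simp add: spectral_decomposition_def)
  from jinv_eq[OF this] show ?thesis by (simp add: frame_sum[OF F])
qed

lemma jinv_remainder_unit:
  assumes h: "norm h \<le> 1 / 2"
  shows "norm (jinv (e + h) - e + h) \<le> 2 * (norm h)\<^sup>2"
proof (rule power2_le_imp_le)
  obtain \<eta> f where f: "spectral_decomposition h \<eta> f" by (rule spectral_theorem)
  then have F: "jordan_frame f" and hf: "h = (\<Sum>i<jrank. \<eta> i *\<^sub>R f i)" by (auto simp: spectral_decomposition_def)
  have small: "\<bar>\<eta> i\<bar> \<le> norm h" if "i < jrank" for i
    using spectrum_abs_le_norm[of "\<eta> i" h] that spectrum_eq[OF f] by blast
  have "jinv (e + h) - e + h = (\<Sum>i<jrank. (inverse (1 + \<eta> i) - 1 + \<eta> i) *\<^sub>R f i)"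
    unfolding jinv_eq[OF unit_plus_spectral[OF f]]
    by (simp add: scaleR_add_left scaleR_diff_left sum.distrib sum_subtractf frame_sum[OF F] hf[symmetric])
  then have "(norm (jinv (e + h) - e + h))\<^sup>2 = (\<Sum>i<jrank. (inverse (1 + \<eta> i) - 1 + \<eta> i)\<^sup>2)"
    by (simp add: frame_comb_norm[OF F])
  also have "\<dots> \<le> (\<Sum>i<jrank. (2 * norm h)\<^sup>2 * (\<eta> i)\<^sup>2)"
  proof (intro sum_mono)
    fix i assume "i \<in> {..<jrank}"
    then have s: "\<bar>\<eta> i\<bar> \<le> norm h" using small by simp
    with h have half: "1 + \<eta> i \<ge> 1 / 2" by linarith
    have "inverse (1 + \<eta> i) - 1 + \<eta> i = \<eta> i / (1 + \<eta> i) * \<eta> i"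
      using half by (simp add: field_simps)
    moreover have "\<bar>\<eta> i / (1 + \<eta> i)\<bar> \<le> 2 * norm h"
    proof -
      have "\<bar>\<eta> i / (1 + \<eta> i)\<bar> = \<bar>\<eta> i\<bar> / (1 + \<eta> i)" using half by (simp add: abs_divide)
      also have "\<dots> \<le> norm h / (1 / 2)" using s half by (intro frac_le) auto
      finally show ?thesis by simp
    qed
    then have "(\<eta> i / (1 + \<eta> i))\<^sup>2 \<le> (2 * norm h)\<^sup>2" by (subst abs_le_square_iff[symmetric]) simp
    then have "(\<eta> i / (1 + \<eta> i))\<^sup>2 * (\<eta> i)\<^sup>2 \<le> (2 * norm h)\<^sup>2 * (\<eta> i)\<^sup>2"
      by (rule mult_right_mono) simp
    ultimately show "(inverse (1 + \<eta> i) - 1 + \<eta> i)\<^sup>2 \<le> (2 * norm h)\<^sup>2 * (\<eta> i)\<^sup>2"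
      by (simp only: power_mult_distrib[of "\<eta> i / (1 + \<eta> i)"])
  qed
  also have "\<dots> = (2 * (norm h)\<^sup>2)\<^sup>2"
    unfolding sum_distrib_left[symmetric] frame_comb_norm[OF F, symmetric] hf[symmetric]
    by (simp add: power2_eq_square)
  finally show "(norm (jinv (e + h) - e + h))\<^sup>2 \<le> (2 * (norm h)\<^sup>2)\<^sup>2" .
qed simp

text \<open>At the unit the remainder is estimated by eigenvalues; the invariance under \<open>scali z\<close> transports
  the derivative to \<open>z\<close>.\<close>

lemma jinv_has_derivative:
  assumes z: "positive z" shows "(jinv has_derivative (\<lambda>h. - scali z (scali z h))) (at z)"
proof -
  have bl: "bounded_linear (scali z)" using scali_linear by (simp add: linear_conv_bounded_linear)
  have sz: "scali z z = e" using scali_scal[of z e] scal_unit[OF z] by simp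
  have "(jinv has_derivative uminus) (at e)"
  proof (rule has_derivative_quadratic_bound[where d = "1 / 2" and C = 2])
    show "bounded_linear (uminus :: 'e \<Rightarrow> 'e)" by (intro bounded_linear_minus bounded_linear_ident)
    fix y :: 'e assume "norm (y - e) < 1 / 2"
    with jinv_remainder_unit[of "y - e"] show "norm (jinv y - jinv e - - (y - e)) \<le> 2 * (norm (y - e))\<^sup>2"
      unfolding jinv_unit diff_minus_eq_add by simp
  qed simp
  then have "(jinv has_derivative uminus) (at (scali z z))" by (simp add: sz)
  from has_derivative_compose[OF bounded_linear.has_derivative[OF bl has_derivative_ident] this]
  have "((\<lambda>w. jinv (scali z w)) has_derivative (\<lambda>h. - scali z h)) (at z)" .
  from bounded_linear.has_derivative[OF bl this]
  have "((\<lambda>w. scali z (jinv (scali z w))) has_derivative (\<lambda>h. - scali z (scali z h))) (at z)"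
    by (simp add: linear_neg[OF scali_linear])
  then show ?thesis
    by (rule has_derivative_transform_within_open[OF _ open_positive])
      (auto simp: z jinv_scali scali_scal)
qed

lemma grad_barrier:
  assumes z: "positive z" shows "grad barrier z = - jinv z"
  using barrier_has_gradient[OF z] by (intro grad_eqI) (simp add: gderiv_def inner_commute)

lemma hess_barrier:
  assumes z: "positive z" shows "hess barrier z = (\<lambda>h. scali z (scali z h))"
proof -
  have "((\<lambda>w. - jinv w) has_derivative (\<lambda>h. scali z (scali z h))) (at z)"
    using has_derivative_minus[OF jinv_has_derivative[OF z]] by simp
  then have "(grad barrier has_derivative (\<lambda>h. scali z (scali z h))) (at z)"
    by (rule has_derivative_transform_within_open[OF _ open_positive]) (auto simp: z grad_barrier)
  then show ?thesis unfolding hess_def by (rule frechet_derivative_at[symmetric])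
qed

text \<open>The Hessian at \<open>scal z y\<close> is the Hessian at \<open>y\<close> transported by \<open>scali z\<close>. The maps \<open>scali\<close>
  themselves need not compose in this way, only their squares do.\<close>

lemma scali_scal_compose:
  assumes z: "positive z" and y: "positive y"
  shows "scali (scal z y) (scali (scal z y) h) = scali z (scali y (scali y (scali z h)))"
proof -
  let ?w = "scal z y"
  have w: "positive ?w" by (rule scal_positive[OF y])
  have bl: "bounded_linear (scali z)" using scali_linear by (simp add: linear_conv_bounded_linear)
  have "(jinv has_derivative (\<lambda>h. - scali y (scali y h))) (at (scali z ?w))"
    using jinv_has_derivative[OF y] by (simp add: scali_scal)
  from has_derivative_compose[OF bounded_linear.has_derivative[OF bl has_derivative_ident] this]
  have "((\<lambda>w. jinv (scali z w)) has_derivative (\<lambda>h. - scali y (scali y (scali z h)))) (at ?w)" .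
  from bounded_linear.has_derivative[OF bl this]
  have "((\<lambda>w. scali z (jinv (scali z w))) has_derivative (\<lambda>h. - scali z (scali y (scali y (scali z h))))) (at ?w)"
    by (simp add: linear_neg[OF scali_linear])
  then have "(jinv has_derivative (\<lambda>h. - scali z (scali y (scali y (scali z h))))) (at ?w)"
    by (rule has_derivative_transform_within_open[OF _ open_positive])
      (auto simp: w z jinv_scali scali_scal)
  from has_derivative_unique[OF jinv_has_derivative[OF w] this] show ?thesis
    by (metis neg_equal_iff_equal)
qed

lemma scali_norm_scal_le:
  assumes z: "positive z" and m: "m > 0" "\<forall>t\<in>spectrum y. m \<le> t"
  shows "norm (scali (scal z y) h) \<le> norm (scali z h) / m"
proof (rule power2_le_imp_le)
  have y: "positive y" using m by (force simp: positive_def)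
  have "(norm (scali (scal z y) h))\<^sup>2 = h \<bullet> scali (scal z y) (scali (scal z y) h)"
    by (simp add: power2_norm_eq_inner scali_symmetric)
  also have "\<dots> = (norm (scali y (scali z h)))\<^sup>2"
    by (simp add: scali_scal_compose[OF z y] power2_norm_eq_inner scali_symmetric)
  also have "\<dots> \<le> (norm (scali z h) / m)\<^sup>2"
    using scali_norm_le[OF m] by (intro power_mono) auto
  finally show "(norm (scali (scal z y) h))\<^sup>2 \<le> (norm (scali z h) / m)\<^sup>2" .
  show "0 \<le> norm (scali z h) / m" using m by simp
qed

section \<open>The proximal point\<close>

text \<open>The eigenvalue function is the positive root of $\zeta - \tau/\zeta = v$.\<close>

definition prox :: "real \<Rightarrow> 'e \<Rightarrow> 'e" where
  "prox \<tau> = jfun (\<lambda>v. (v + sqrt (v\<^sup>2 + 4 * \<tau>)) / 2)"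

lemma prox_scalar:
  assumes "\<tau> > 0"
  shows "(v + sqrt (v\<^sup>2 + 4 * \<tau>)) / 2 > 0"
    and "(v + sqrt (v\<^sup>2 + 4 * \<tau>)) / 2 - \<tau> * inverse ((v + sqrt (v\<^sup>2 + 4 * \<tau>)) / 2) = v"
proof -
  define q where "q = sqrt (v\<^sup>2 + 4 * \<tau>)"
  have q2: "q\<^sup>2 = v\<^sup>2 + 4 * \<tau>" using assms by (simp add: q_def)
  have "\<bar>v\<bar> < q" unfolding q_def using assms by (intro real_less_rsqrt) simp
  then have pos: "v + q > 0" by linarith
  then show "(v + sqrt (v\<^sup>2 + 4 * \<tau>)) / 2 > 0" by (simp add: q_def)
  have "(v + q) * (v + q) - 4 * \<tau> = 2 * v * (v + q)" using q2 by (simp add: power2_eq_square algebra_simps)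
  then have "(v + q) / 2 - \<tau> * inverse ((v + q) / 2) = v" using pos by (simp add: field_simps)
  then show "(v + sqrt (v\<^sup>2 + 4 * \<tau>)) / 2 - \<tau> * inverse ((v + sqrt (v\<^sup>2 + 4 * \<tau>)) / 2) = v" by (simp add: q_def)
qed

lemma prox_spectral_decomposition:
  "spectral_decomposition u \<alpha> f \<Longrightarrow>
    spectral_decomposition (prox \<tau> u) (\<lambda>i. (\<alpha> i + sqrt ((\<alpha> i)\<^sup>2 + 4 * \<tau>)) / 2) f"
  unfolding prox_def by (rule jfun_spectral_decomposition)

lemma prox_positive:
  assumes "\<tau> > 0" shows "positive (prox \<tau> u)"
proof -
  obtain \<alpha> f where f: "spectral_decomposition u \<alpha> f" by (rule spectral_theorem)
  show ?thesis by (rule positiveI[OF prox_spectral_decomposition[OF f]]) (rule prox_scalar(1)[OF assms])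
qed

lemma prox_eq:
  assumes "\<tau> > 0" shows "prox \<tau> u - \<tau> *\<^sub>R jinv (prox \<tau> u) = u"
proof -
  obtain \<alpha> f where f: "spectral_decomposition u \<alpha> f" by (rule spectral_theorem)
  let ?r = "\<lambda>i. (\<alpha> i + sqrt ((\<alpha> i)\<^sup>2 + 4 * \<tau>)) / 2"
  have g: "spectral_decomposition (prox \<tau> u) ?r f" by (rule prox_spectral_decomposition[OF f])
  then have "prox \<tau> u = (\<Sum>i<jrank. ?r i *\<^sub>R f i)" by (simp add: spectral_decomposition_def)
  moreover have "jinv (prox \<tau> u) = (\<Sum>i<jrank. inverse (?r i) *\<^sub>R f i)" by (rule jinv_eq[OF g])
  ultimately have "prox \<tau> u - \<tau> *\<^sub>R jinv (prox \<tau> u) = (\<Sum>i<jrank. (?r i - \<tau> * inverse (?r i)) *\<^sub>R f i)"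
    by (simp only: scaleR_diff_left sum_subtractf scaleR_sum_right scaleR_scaleR)
  also have "\<dots> = u" using f by (simp only: prox_scalar(2)[OF assms] spectral_decomposition_def)
  finally show ?thesis .
qed

lemma jinv_antimono:
  assumes "positive z" "positive w" shows "(jinv z - jinv w) \<bullet> (z - w) \<le> 0"
  using barrier_subgradient[OF assms] barrier_subgradient[OF assms(2,1)]
  by (simp add: inner_diff_left inner_diff_right)

lemma shifted_inverse_expansive:
  assumes \<tau>: "\<tau> > 0" and zw: "positive z" "positive w"
  shows "norm (z - w) \<le> norm ((z - \<tau> *\<^sub>R jinv z) - (w - \<tau> *\<^sub>R jinv w))"
proof -
  let ?d = "(z - \<tau> *\<^sub>R jinv z) - (w - \<tau> *\<^sub>R jinv w)"
  have "(z - w) \<bullet> ?d = (norm (z - w))\<^sup>2 - \<tau> * ((jinv z - jinv w) \<bullet> (z - w))"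
    by (simp add: power2_norm_eq_inner inner_diff_left inner_diff_right inner_commute algebra_simps)
  then have "(norm (z - w))\<^sup>2 \<le> (z - w) \<bullet> ?d"
    using mult_nonneg_nonpos[OF less_imp_le[OF \<tau>] jinv_antimono[OF zw]] by linarith
  also have "\<dots> \<le> norm (z - w) * norm ?d" by (rule norm_cauchy_schwarz)
  finally show ?thesis by (cases "z = w") (auto simp: power2_eq_square)
qed

lemma prox_nonexpansive:
  assumes \<tau>: "\<tau> > 0" shows "norm (prox \<tau> u - prox \<tau> v) \<le> norm (u - v)"
  using shifted_inverse_expansive[OF \<tau> prox_positive[OF \<tau>] prox_positive[OF \<tau>], of u v]
  by (simp add: prox_eq[OF \<tau>])

lemma prox_continuous: "\<tau> > 0 \<Longrightarrow> continuous (at u) (prox \<tau>)"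
  unfolding continuous_at_eps_delta dist_norm
  using prox_nonexpansive by (meson le_less_trans)

text \<open>The operator $\mathcal W = \tau D^2\phi(z)$.\<close>

definition barrier_op :: "real \<Rightarrow> 'e \<Rightarrow> 'e \<Rightarrow> 'e" where
  "barrier_op \<tau> z h = \<tau> *\<^sub>R scali z (scali z h)"

lemma barrier_op_form: "h \<bullet> barrier_op \<tau> z h = \<tau> * (norm (scali z h))\<^sup>2"
  by (simp add: barrier_op_def power2_norm_eq_inner scali_symmetric)

lemma barrier_op_positive:
  assumes \<tau>: "\<tau> > 0" shows "positive_operator (barrier_op \<tau> z)"
proof (rule positive_operator.intro)
  show "linear (barrier_op \<tau> z)"
    by (rule linearI) (simp_all add: barrier_op_def linear_add[OF scali_linear] linear_scale[OF scali_linear]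
        scaleR_add_right)
  show "barrier_op \<tau> z x \<bullet> y = x \<bullet> barrier_op \<tau> z y" for x y
    by (simp add: barrier_op_def scali_symmetric)
  show "x \<bullet> barrier_op \<tau> z x > 0" if "x \<noteq> 0" for x
  proof -
    have "scali z x \<noteq> 0" using that scal_scali[of z x] linear_0[OF scal_linear] by metis
    then show ?thesis using \<tau> by (simp add: barrier_op_form)
  qed
qed

text \<open>The proximal map is a continuous inverse of $z \mapsto z - \tau z^{-1}$, so the inverse function
  rule applies.\<close>

lemma prox_has_derivative:
  assumes \<tau>: "\<tau> > 0"
  shows "(prox \<tau> has_derivative resolvent (barrier_op \<tau> (prox \<tau> u))) (at u)"
proof -
  let ?W = "barrier_op \<tau> (prox \<tau> u)"
  interpret positive_operator ?W by (rule barrier_op_positive[OF \<tau>])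
  show ?thesis
  proof (rule has_derivative_inverse_basic[where f = "\<lambda>z. z - \<tau> *\<^sub>R jinv z" and T = UNIV])
    have "((\<lambda>z. z - \<tau> *\<^sub>R jinv z) has_derivative (\<lambda>h. h - \<tau> *\<^sub>R (- scali (prox \<tau> u) (scali (prox \<tau> u) h)))) (at (prox \<tau> u))"
      by (intro has_derivative_diff has_derivative_ident has_derivative_scaleR_right
          jinv_has_derivative prox_positive[OF \<tau>])
    then show "((\<lambda>z. z - \<tau> *\<^sub>R jinv z) has_derivative (\<lambda>h. h + ?W h)) (at (prox \<tau> u))"
      by (simp add: barrier_op_def)
    show "bounded_linear (resolvent ?W)" using resolvent_linear by (simp add: linear_conv_bounded_linear)
    show "resolvent ?W \<circ> (\<lambda>h. h + ?W h) = id" by (simp add: fun_eq_iff resolvent_left)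
    show "continuous (at u) (prox \<tau>)" by (rule prox_continuous[OF \<tau>])
  qed (auto simp: prox_eq[OF \<tau>])
qed

lemma prox_minimal:
  assumes mu: "mu > 0" and rho: "rho > 0" and w: "positive w"
    and z: "z = prox (mu / rho) (x - (1 / rho) *\<^sub>R s)"
  shows "mu * barrier z + s \<bullet> z + rho / 2 * (norm (z - x))\<^sup>2 + rho / 2 * (norm (w - z))\<^sup>2
    \<le> mu * barrier w + s \<bullet> w + rho / 2 * (norm (w - x))\<^sup>2"
proof -
  have \<tau>: "mu / rho > 0" using mu rho by simp
  have pz: "positive z" unfolding z by (rule prox_positive[OF \<tau>])
  have "z - (mu / rho) *\<^sub>R jinv z = x - (1 / rho) *\<^sub>R s" unfolding z by (rule prox_eq[OF \<tau>])
  then have "rho *\<^sub>R (z - (mu / rho) *\<^sub>R jinv z) = rho *\<^sub>R (x - (1 / rho) *\<^sub>R s)" by simp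
  then have eq: "mu *\<^sub>R jinv z = rho *\<^sub>R (z - x) + s" using rho by (simp add: algebra_simps)
  have "mu * barrier w \<ge> mu * (barrier z - jinv z \<bullet> (w - z))"
    using barrier_subgradient[OF pz w] mu by (intro mult_left_mono) auto
  also have "mu * (barrier z - jinv z \<bullet> (w - z)) = mu * barrier z - (mu *\<^sub>R jinv z) \<bullet> (w - z)"
    by (simp add: algebra_simps)
  also have "\<dots> = mu * barrier z - rho * ((z - x) \<bullet> (w - z)) - s \<bullet> (w - z)"
    by (simp add: eq inner_add_left)
  finally have 1: "mu * barrier z - rho * ((z - x) \<bullet> (w - z)) - s \<bullet> (w - z) \<le> mu * barrier w" .
  have "(norm (w - x))\<^sup>2 = (norm (w - z))\<^sup>2 + 2 * ((z - x) \<bullet> (w - z)) + (norm (z - x))\<^sup>2"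
    by (simp add: power2_norm_eq_inner inner_diff_left inner_diff_right inner_commute)
  then have "rho / 2 * (norm (w - x))\<^sup>2 = rho / 2 * (norm (w - z))\<^sup>2 + rho * ((z - x) \<bullet> (w - z)) + rho / 2 * (norm (z - x))\<^sup>2"
    by (simp add: distrib_left)
  moreover have "s \<bullet> (w - z) = s \<bullet> w - s \<bullet> z" by (rule inner_diff_right)
  ultimately show ?thesis using 1 by linarith
qed

lemma zprox_eq:
  assumes mu: "mu > 0" and rho: "rho > 0"
  shows "zprox rho mu x s = prox (mu / rho) (x - (1 / rho) *\<^sub>R s)"
  unfolding zprox_def
proof (rule the_equality)
  let ?F = "\<lambda>z. mu * barrier z + s \<bullet> z + rho / 2 * (norm (z - x))\<^sup>2"
  define z where "z = prox (mu / rho) (x - (1 / rho) *\<^sub>R s)"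
  have pz: "positive z" unfolding z_def using mu rho by (intro prox_positive) simp
  have min: "?F z + rho / 2 * (norm (w - z))\<^sup>2 \<le> ?F w" if "positive w" for w
    by (rule prox_minimal[OF mu rho that z_def])
  have nn: "rho / 2 * (norm (w - z))\<^sup>2 \<ge> 0" for w using rho by simp
  show "is_arg_min ?F (\<lambda>z. z \<in> interior symcone) (prox (mu / rho) (x - (1 / rho) *\<^sub>R s))"
    unfolding z_def[symmetric] is_arg_min_def interior_symcone
  proof (intro conjI notI)
    show "z \<in> Collect positive" using pz by simp
    assume "\<exists>y. y \<in> Collect positive \<and> ?F y < ?F z"
    then obtain y where "positive y" "?F y < ?F z" by auto
    then show False using min[of y] nn[of y] by linarith
  qed
  fix y assume "is_arg_min ?F (\<lambda>z. z \<in> interior symcone) y"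
  then have y: "positive y" "\<not> ?F z < ?F y"
    using pz by (auto simp: is_arg_min_def interior_symcone)
  have "rho / 2 * (norm (y - z))\<^sup>2 \<le> 0" using min[OF y(1)] y(2) by linarith
  then have "(norm (y - z))\<^sup>2 \<le> 0" using rho by (simp add: mult_le_0_iff)
  then show "y = prox (mu / rho) (x - (1 / rho) *\<^sub>R s)" by (simp add: z_def)
qed

section \<open>The gap function near the unit\<close>

lemma unit_gap_lower:
  assumes pos: "positive (e + h)"
  shows "(norm h)\<^sup>2 / (2 * (2 + norm h)) \<le> e \<bullet> h + barrier (e + h)"
proof -
  obtain \<eta> f where f: "spectral_decomposition h \<eta> f" by (rule spectral_theorem)
  then have F: "jordan_frame f" and hf: "h = (\<Sum>i<jrank. \<eta> i *\<^sub>R f i)" by (auto simp: spectral_decomposition_def)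
  have eh: "e \<bullet> h = (\<Sum>i<jrank. \<eta> i)"
  proof -
    have "h \<bullet> e = (\<Sum>i<jrank. \<eta> i * (f i \<bullet> e))" by (subst hf) (simp add: inner_sum_left)
    then show ?thesis by (simp add: inner_commute[of e h] frame_inner_unit[OF F])
  qed
  have nh: "(norm h)\<^sup>2 = (\<Sum>i<jrank. (\<eta> i)\<^sup>2)" by (subst hf) (rule frame_comb_norm[OF F])
  have "(norm h)\<^sup>2 / (2 * (2 + norm h)) = (\<Sum>i<jrank. (\<eta> i)\<^sup>2 / (2 * (2 + norm h)))"
    by (simp add: nh sum_divide_distrib)
  also have "\<dots> \<le> (\<Sum>i<jrank. \<eta> i - ln (1 + \<eta> i))"
  proof (intro sum_mono ln_one_plus_gap)
    fix i assume i: "i \<in> {..<jrank}"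
    show "\<eta> i > -1" using positive_eigenvalue[OF pos unit_plus_spectral[OF f], of i] i by simp
    show "\<bar>\<eta> i\<bar> \<le> norm h" using spectrum_abs_le_norm[of "\<eta> i" h] spectrum_eq[OF f] i by blast
  qed
  also have "\<dots> = e \<bullet> h + barrier (e + h)"
    using barrier_eq[OF unit_plus_spectral[OF f] pos] by (simp add: eh sum_subtractf)
  finally show ?thesis .
qed

text \<open>Per eigenvalue this is $-\ln(1 - \eta^2) - \eta^2$, which is of fourth order: the second-order
  terms of the two barriers add up to $\|k\|^2$.\<close>

lemma unit_gap_symmetric:
  assumes k: "(norm k)\<^sup>2 \<le> 1 / 2"
  shows "barrier (e + k) + barrier (e - k) - (norm k)\<^sup>2 \<le> 2 * ((norm k)\<^sup>2)\<^sup>2"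
proof -
  obtain \<eta> f where f: "spectral_decomposition k \<eta> f" by (rule spectral_theorem)
  then have F: "jordan_frame f" and kf: "k = (\<Sum>i<jrank. \<eta> i *\<^sub>R f i)" by (auto simp: spectral_decomposition_def)
  have "- k = (\<Sum>i<jrank. (- \<eta> i) *\<^sub>R f i)" by (simp add: kf sum_negf)
  with F have f': "spectral_decomposition (- k) (\<lambda>i. - \<eta> i) f" by (simp add: spectral_decomposition_def)
  have "norm k < 1" by (rule power2_less_imp_less) (use k in auto)
  then have pos: "positive (e + k)" "positive (e + - k)"
    using unit_plus_positive[of k] unit_plus_positive[of "- k"] by simp_all
  have nk: "(norm k)\<^sup>2 = (\<Sum>i<jrank. (\<eta> i)\<^sup>2)" by (subst kf) (rule frame_comb_norm[OF F])
  have "barrier (e + k) + barrier (e + - k) - (norm k)\<^sup>2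
      = (\<Sum>i<jrank. - ln (1 + \<eta> i) - ln (1 + - \<eta> i) - (\<eta> i)\<^sup>2)"
    using barrier_eq[OF unit_plus_spectral[OF f] pos(1)] barrier_eq[OF unit_plus_spectral[OF f'] pos(2)]
    by (simp add: nk sum_subtractf sum_negf)
  also have "\<dots> \<le> (\<Sum>i<jrank. 2 * (norm k)\<^sup>2 * (\<eta> i)\<^sup>2)"
  proof (intro sum_mono)
    fix i assume i: "i \<in> {..<jrank}"
    have p: "1 + \<eta> i > 0" "1 + - \<eta> i > 0"
      using positive_eigenvalue[OF pos(1) unit_plus_spectral[OF f], of i]
        positive_eigenvalue[OF pos(2) unit_plus_spectral[OF f'], of i] i by auto
    have le: "(\<eta> i)\<^sup>2 \<le> (norm k)\<^sup>2" unfolding nk using i by (intro member_le_sum) auto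
    have "(1 + \<eta> i) * (1 + - \<eta> i) = 1 - (\<eta> i)\<^sup>2" by (simp add: power2_eq_square algebra_simps)
    then have "ln (1 + \<eta> i) + ln (1 + - \<eta> i) = ln (1 - (\<eta> i)\<^sup>2)"
      using ln_mult[of "1 + \<eta> i" "1 + - \<eta> i"] p by simp
    moreover have "- (\<eta> i)\<^sup>2 - 2 * ((\<eta> i)\<^sup>2)\<^sup>2 \<le> ln (1 - (\<eta> i)\<^sup>2)"
      using le k by (intro ln_one_minus_pos_lower_bound) auto
    moreover have "((\<eta> i)\<^sup>2)\<^sup>2 \<le> (norm k)\<^sup>2 * (\<eta> i)\<^sup>2"
      unfolding power2_eq_square[of "(\<eta> i)\<^sup>2"] using le by (intro mult_right_mono) auto
    ultimately show "- ln (1 + \<eta> i) - ln (1 + - \<eta> i) - (\<eta> i)\<^sup>2 \<le> 2 * (norm k)\<^sup>2 * (\<eta> i)\<^sup>2" by linarith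
  qed
  also have "\<dots> = 2 * ((norm k)\<^sup>2)\<^sup>2"
    by (simp add: sum_distrib_left[symmetric] nk[symmetric] power2_eq_square[of "(norm k)\<^sup>2"])
  finally show ?thesis by simp
qed

text \<open>The quantity
  $\langle e, p\rangle + \phi(e + p) + \langle e, q\rangle + \phi(e + q) + \langle p, q\rangle$ is the gap of
  the pair. It equals $\phi(e + k) + \phi(e - k) - \|k\|^2$, because \<open>scal\<close> and \<open>scali\<close> are adjoint
  inverses of each other and shift the barrier by opposite constants.\<close>

lemma primal_dual_gap_contraction:
  assumes z: "positive z" and z': "positive z'" and k: "norm k \<le> 7 / 50"
    and y: "scal z (e + k) = scal z' (e + p)" and l: "scali z (e - k) = scali z' (e + q)"
    and pq: "p \<bullet> q \<ge> 0"
  shows "norm (p + q) \<le> 1 / 10"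
proof (rule power2_le_imp_le)
  define \<Gamma> where "\<Gamma> = 2 * ((norm k)\<^sup>2)\<^sup>2"
  have k2: "(norm k)\<^sup>2 \<le> (7 / 50)\<^sup>2" using k by (intro power_mono) auto
  then have k4: "((norm k)\<^sup>2)\<^sup>2 \<le> ((7 / 50)\<^sup>2)\<^sup>2" by (intro power_mono) auto
  have \<Gamma>: "\<Gamma> \<le> 1 / 1000" using k4 by (simp add: \<Gamma>_def power2_eq_square)
  have "norm k < 1" using k by simp
  then have pk: "positive (e + k)" "positive (e - k)"
    using unit_plus_positive[of k] unit_plus_positive[of "- k"] by auto
  have sc: "scali w (scal w v) = v" "scal w (scali w v) = v" for w v by (rule scali_scal scal_scali)+
  have pp: "positive (e + p)" "positive (e + q)"
    using scali_positive[OF scal_positive[OF pk(1)], of z' z] scal_positive[OF scali_positive[OF pk(2)], of z' z]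
    by (simp_all add: y l sc)
  have inner: "scal w a \<bullet> scali w b' = a \<bullet> b'" for w a b' by (simp add: scal_symmetric sc)
  have "(e + k) \<bullet> (e - k) = (e + p) \<bullet> (e + q)"
    using inner[of z "e + k" "e - k"] inner[of z' "e + p" "e + q"] y l by simp
  then have i: "- (norm k)\<^sup>2 = e \<bullet> p + e \<bullet> q + p \<bullet> q"
    by (simp add: inner_add_left inner_add_right inner_diff_right inner_commute power2_norm_eq_inner)
  have "barrier (e + k) + barrier z = barrier (e + p) + barrier z'"
    using scal_barrier[OF z pk(1)] scal_barrier[OF z' pp(1)] y by simp
  moreover have "barrier (e - k) - barrier z = barrier (e + q) - barrier z'"
    using scali_barrier[OF z pk(2)] scali_barrier[OF z' pp(2)] l by simp
  ultimately have b: "barrier (e + k) + barrier (e - k) = barrier (e + p) + barrier (e + q)" by simp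
  have "barrier (e + k) + barrier (e - k) - (norm k)\<^sup>2 \<le> \<Gamma>"
    unfolding \<Gamma>_def by (rule unit_gap_symmetric) (use k2 in \<open>simp add: power2_eq_square\<close>)
  then have total: "(e \<bullet> p + barrier (e + p)) + (e \<bullet> q + barrier (e + q)) + p \<bullet> q \<le> \<Gamma>"
    using i b by linarith
  have low: "(norm p)\<^sup>2 / (2 * (2 + norm p)) \<le> e \<bullet> p + barrier (e + p)"
    "(norm q)\<^sup>2 / (2 * (2 + norm q)) \<le> e \<bullet> q + barrier (e + q)"
    by (rule unit_gap_lower[OF pp(1)], rule unit_gap_lower[OF pp(2)])
  have nn: "(norm p)\<^sup>2 / (2 * (2 + norm p)) \<ge> 0" "(norm q)\<^sup>2 / (2 * (2 + norm q)) \<ge> 0" by auto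
  \<comment> \<open>an a priori bound on the displacements, after which the gap is quadratic in them\<close>
  have small: "N \<le> 1" if N: "N\<^sup>2 / (2 * (2 + N)) \<le> \<Gamma>" "N \<ge> 0" for N :: real
  proof (rule ccontr)
    assume "\<not> N \<le> 1"
    then have N1: "N > 1" by simp
    have "N\<^sup>2 \<le> \<Gamma> * (2 * (2 + N))" using N by (simp add: pos_divide_le_eq)
    also have "\<dots> \<le> 1 / 1000 * (2 * (2 + N))" using \<Gamma> N(2) by (intro mult_right_mono) auto
    also have "\<dots> < N" using N1 by simp
    finally have "N * N < N * 1" by (simp add: power2_eq_square)
    then show False using N1 by simp
  qed
  have p1: "norm p \<le> 1" by (rule small) (use total low nn pq in linarith, simp)
  have q1: "norm q \<le> 1" by (rule small) (use total low nn pq in linarith, simp)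
  have sixth: "N\<^sup>2 / 6 \<le> N\<^sup>2 / (2 * (2 + N))" if "N \<le> 1" "N \<ge> 0" for N :: real
    using that by (intro divide_left_mono) auto
  have "(norm p)\<^sup>2 / 6 + (norm q)\<^sup>2 / 6 + p \<bullet> q \<le> \<Gamma>"
    using total low sixth[OF p1 norm_ge_zero] sixth[OF q1 norm_ge_zero] by linarith
  moreover have "(norm (p + q))\<^sup>2 = (norm p)\<^sup>2 + (norm q)\<^sup>2 + 2 * (p \<bullet> q)"
    by (simp add: power2_norm_eq_inner inner_add_left inner_add_right inner_commute)
  ultimately show "(norm (p + q))\<^sup>2 \<le> (1 / 10)\<^sup>2" using \<Gamma> pq by (simp add: power2_eq_square)
qed simp

text \<open>The second factor is the norm of \<open>r\<close> dual to that of $(I + \mathcal W)^{-1}\mathcal W$, whose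
  inverse is $I + \mathcal W^{-1}$.\<close>

lemma coresolvent_dual_bound:
  assumes \<tau>: "\<tau> > 0"
  shows "x \<bullet> r \<le> sqrt (x \<bullet> coresolvent (barrier_op \<tau> z) x) * sqrt ((norm r)\<^sup>2 + (norm (scal z r))\<^sup>2 / \<tau>)"
proof -
  let ?W = "barrier_op \<tau> z"
  interpret W: positive_operator ?W by (rule barrier_op_positive[OF \<tau>])
  \<comment> \<open>\<open>t\<close> is the image of \<open>r\<close> under the inverse of the operator, so \<open>t + r\<close> is the vector to pair with\<close>
  define t where "t = (1 / \<tau>) *\<^sub>R scal z (scal z r)"
  have Wt: "?W t = r"
    using \<tau> by (simp add: barrier_op_def t_def linear_scale[OF scali_linear] scali_scal)
  have Q: "coresolvent ?W (t + ?W t) = r"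
    unfolding W.coresolvent_eq W.resolvent_left by (rule Wt)
  have "(t + ?W t) \<bullet> r = (norm r)\<^sup>2 + (norm (scal z r))\<^sup>2 / \<tau>"
    unfolding Wt by (simp add: t_def inner_add_left scal_symmetric power2_norm_eq_inner)
  then show ?thesis
    using psd_cauchy_schwarz[OF W.coresolvent_linear W.coresolvent_sym W.coresolvent_nonneg, of x "t + ?W t"]
    by (simp add: Q)
qed

lemma resolvent_dual_bound:
  assumes \<tau>: "\<tau> > 0"
  shows "x \<bullet> r \<le> sqrt (x \<bullet> resolvent (barrier_op \<tau> z) x) * sqrt ((norm r)\<^sup>2 + \<tau> * (norm (scali z r))\<^sup>2)"
proof -
  let ?W = "barrier_op \<tau> z"
  interpret W: positive_operator ?W by (rule barrier_op_positive[OF \<tau>])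
  have "(r + ?W r) \<bullet> r = (norm r)\<^sup>2 + \<tau> * (norm (scali z r))\<^sup>2"
    by (simp only: inner_add_left W.W_sym barrier_op_form) (simp add: power2_norm_eq_inner)
  then show ?thesis
    using psd_cauchy_schwarz[OF W.resolvent_linear W.resolvent_sym W.resolvent_nonneg, of x "r + ?W r"]
    by (simp add: W.resolvent_left)
qed

text \<open>The sum of the two dual squared norms of a vector is a single square, which is why $\xi_\rho$ is
  bounded by the norm of the sum of the displacements of the primal and of the dual part.\<close>

lemma scal_scali_norm:
  assumes \<tau>: "\<tau> > 0"
  shows "\<tau> * (norm (scali z r + (1 / \<tau>) *\<^sub>R scal z r))\<^sup>2
    = ((norm r)\<^sup>2 + (norm (scal z r))\<^sup>2 / \<tau>) + ((norm r)\<^sup>2 + \<tau> * (norm (scali z r))\<^sup>2)"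
proof -
  have "scali z r \<bullet> scal z r = (norm r)\<^sup>2" by (simp add: scali_symmetric scali_scal power2_norm_eq_inner)
  moreover have "(norm (a + b))\<^sup>2 = (norm a)\<^sup>2 + 2 * (a \<bullet> b) + (norm b)\<^sup>2" for a b :: 'e
    by (simp add: power2_norm_eq_inner inner_add_left inner_add_right inner_commute)
  ultimately have "(norm (scali z r + (1 / \<tau>) *\<^sub>R scal z r))\<^sup>2
      = (norm (scali z r))\<^sup>2 + 2 / \<tau> * (norm r)\<^sup>2 + (norm (scal z r))\<^sup>2 / \<tau>\<^sup>2"
    using \<tau> by (simp add: power_divide)
  then show ?thesis using \<tau> by (simp add: field_simps power2_eq_square)
qed

text \<open>Both points are functions of \<open>u\<close> and so share its frame. Since \<open>scali z' z\<close> has the quotients of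
  the eigenvalues as eigenvalues, bounds on these quotients compare the two local norms.\<close>

lemma central_path_move:
  assumes \<tau>: "\<tau> > 0" and \<sigma>: "0 < \<sigma>" "\<sigma> < 1"
    and z_def: "z = prox \<tau> u" and z'_def: "z' = prox (\<sigma> * \<tau>) u"
  shows "norm (scali z h) \<le> norm (scali z' h)" "norm (scali z' h) \<le> norm (scali z h) / \<sigma>"
    "norm (scali z' (z - z') + (1 / (\<sigma> * \<tau>)) *\<^sub>R scal z' (z - z')) \<le> sqrt (real jrank) * ((1 - \<sigma>) / \<sigma>)"
proof -
  have \<tau>': "\<sigma> * \<tau> > 0" using \<tau> \<sigma> by simp
  obtain \<alpha> f where f: "spectral_decomposition u \<alpha> f" by (rule spectral_theorem)
  then have F: "jordan_frame f" by (simp add: spectral_decomposition_def)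
  define \<zeta> where "\<zeta> i = (\<alpha> i + sqrt ((\<alpha> i)\<^sup>2 + 4 * \<tau>)) / 2" for i
  define \<zeta>' where "\<zeta>' i = (\<alpha> i + sqrt ((\<alpha> i)\<^sup>2 + 4 * (\<sigma> * \<tau>))) / 2" for i
  have sz: "spectral_decomposition z \<zeta> f" and sz': "spectral_decomposition z' \<zeta>' f"
    using prox_spectral_decomposition[OF f] by (simp_all add: z_def z'_def \<zeta>_def[abs_def] \<zeta>'_def[abs_def])
  have pz: "positive z" "positive z'" using prox_positive \<tau> \<tau>' by (auto simp: z_def z'_def)
  have zf: "z = (\<Sum>i<jrank. \<zeta> i *\<^sub>R f i)" "z' = (\<Sum>i<jrank. \<zeta>' i *\<^sub>R f i)"
    using sz sz' by (auto simp: spectral_decomposition_def)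
  have pos: "\<zeta> i > 0" "\<zeta>' i > 0" for i
    using prox_scalar(1)[OF \<tau>] prox_scalar(1)[OF \<tau>'] by (auto simp: \<zeta>_def \<zeta>'_def)
  have "\<zeta> i - \<tau> * inverse (\<zeta> i) = \<zeta>' i - \<sigma> * \<tau> * inverse (\<zeta>' i)" for i
    unfolding \<zeta>_def \<zeta>'_def prox_scalar(2)[OF \<tau>] prox_scalar(2)[OF \<tau>'] by (rule refl)
  note cp = central_path_eigenvalues[OF pos \<tau> \<sigma> this]
  have y: "spectral_decomposition (scali z' z) (\<lambda>i. \<zeta> i * inverse (\<zeta>' i)) f"
    using F scal_comb(2)[OF sz' pz(2), of \<zeta>] by (simp add: spectral_decomposition_def zf(1))
  have "\<forall>t\<in>spectrum (scali z' z). 1 \<le> t"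
    using cp(1) pos by (auto simp: spectrum_eq[OF y] field_simps)
  from scali_norm_scal_le[OF pz(2) _ this, of h]
  show "norm (scali z h) \<le> norm (scali z' h)" by (simp add: scal_scali)
  have y': "spectral_decomposition (scali z z') (\<lambda>i. \<zeta>' i * inverse (\<zeta> i)) f"
    using F scal_comb(2)[OF sz pz(1), of \<zeta>'] by (simp add: spectral_decomposition_def zf(2))
  have "\<forall>t\<in>spectrum (scali z z'). \<sigma> \<le> t"
    using cp(2) pos by (auto simp: spectrum_eq[OF y'] field_simps)
  from scali_norm_scal_le[OF pz(1) \<sigma>(1) this, of h]
  show "norm (scali z' h) \<le> norm (scali z h) / \<sigma>" by (simp add: scal_scali)
  let ?g = "\<lambda>i. (\<zeta> i - \<zeta>' i) * inverse (\<zeta>' i) + (1 / (\<sigma> * \<tau>)) * ((\<zeta> i - \<zeta>' i) * \<zeta>' i)"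
  have d: "z - z' = (\<Sum>i<jrank. (\<zeta> i - \<zeta>' i) *\<^sub>R f i)"
    by (simp only: zf scaleR_diff_left sum_subtractf)
  have "scali z' (z - z') + (1 / (\<sigma> * \<tau>)) *\<^sub>R scal z' (z - z') = (\<Sum>i<jrank. ?g i *\<^sub>R f i)"
    unfolding d scal_comb[OF sz' pz(2)]
    by (simp only: scaleR_sum_right scaleR_scaleR scaleR_add_left sum.distrib)
  then have "(norm (scali z' (z - z') + (1 / (\<sigma> * \<tau>)) *\<^sub>R scal z' (z - z')))\<^sup>2 = (\<Sum>i<jrank. (?g i)\<^sup>2)"
    by (simp only: frame_comb_norm[OF F])
  also have "\<dots> \<le> (\<Sum>i<jrank. ((1 - \<sigma>) / \<sigma>)\<^sup>2)"
  proof (intro sum_mono)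
    fix i
    show "(?g i)\<^sup>2 \<le> ((1 - \<sigma>) / \<sigma>)\<^sup>2" using cp(3)[of i] by (metis abs_ge_zero power2_abs power_mono)
  qed
  also have "\<dots> = (sqrt (real jrank) * ((1 - \<sigma>) / \<sigma>))\<^sup>2" unfolding power_mult_distrib by simp
  finally show "norm (scali z' (z - z') + (1 / (\<sigma> * \<tau>)) *\<^sub>R scal z' (z - z')) \<le> sqrt (real jrank) * ((1 - \<sigma>) / \<sigma>)"
    by (rule power2_le_imp_le) (use \<sigma> in simp)
qed

end

context bal_problem
begin

section \<open>The reduced coordinates\<close>

text \<open>The space of reduced coordinates is a mere inner product space, so the existence of the adjoint
  needs an argument. For a linear left inverse \<open>L\<close> of \<open>B\<close>, the form
  \<open>L x \<bullet> L y + (x - B (L x)) \<bullet> (y - B (L y))\<close> is an inner product on the ambient space, and the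
  vector that represents a functional in it supplies the value of the adjoint.\<close>

lemma adjoint_B: "B x \<bullet> y = x \<bullet> adjoint B y"
proof -
  obtain L where L: "linear L" and LB: "\<And>x. L (B x) = x"
    using linear_injective_left_inverse[OF B_linear B_inj] by (metis comp_apply id_apply)
  define C where "C x = x - B (L x)" for x
  define \<beta> where "\<beta> x y = L x \<bullet> L y + C x \<bullet> C y" for x y
  have "\<exists>v. \<forall>x. B x \<bullet> y = x \<bullet> v" for y
  proof -
    have C: "linear C"
      by (rule linearI) (simp_all add: C_def linear_add[OF L] linear_add[OF B_linear] linear_scale[OF L]
          linear_scale[OF B_linear] scaleR_diff_right)
    have \<beta>_lin: "linear (\<beta> x)" for x
      by (rule linearI) (simp_all add: \<beta>_def linear_add[OF L] linear_add[OF C] linear_scale[OF L]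
          linear_scale[OF C] inner_add_right distrib_left)
    have \<beta>_lin': "linear (\<lambda>x. \<beta> x y)" for y
    proof -
      have "(\<lambda>x. \<beta> x y) = \<beta> y" by (simp add: \<beta>_def[abs_def] inner_commute)
      then show ?thesis using \<beta>_lin by simp
    qed
    define T where "T x = (\<Sum>b\<in>Basis. \<beta> x b *\<^sub>R b)" for x
    have T_lin: "linear T"
      by (rule linearI) (simp_all add: T_def linear_add[OF \<beta>_lin'] linear_scale[OF \<beta>_lin']
          scaleR_add_left sum.distrib scaleR_sum_right)
    have rep: "(\<Sum>b\<in>Basis. f b *\<^sub>R b) \<bullet> y = f y" if "linear f" for f :: "'e \<Rightarrow> real" and y
    proof -
      have "f y = f (\<Sum>b\<in>Basis. (y \<bullet> b) *\<^sub>R b)" by (simp only: euclidean_representation)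
      also have "\<dots> = (\<Sum>b\<in>Basis. f b *\<^sub>R b) \<bullet> y"
        by (simp add: linear_sum[OF that] linear_scale[OF that] inner_sum_left inner_commute[of y] mult.commute)
      finally show ?thesis by simp
    qed
    have T: "T x \<bullet> y = \<beta> x y" for x y unfolding T_def by (rule rep[OF \<beta>_lin])
    have "inj T" unfolding linear_injective_0[OF T_lin]
    proof (intro allI impI)
      fix x assume "T x = 0"
      then have "\<beta> x x = 0" using T[of x x] by simp
      then have "L x = 0" "C x = 0" unfolding \<beta>_def
        by (metis add_nonneg_eq_0_iff inner_eq_zero_iff inner_ge_zero)+
      then show "x = 0" by (simp add: C_def linear_0[OF B_linear])
    qed
    then have "surj T" using linear_injective_imp_surjective[OF T_lin] by simp
    let ?f = "\<lambda>x. B (L x) \<bullet> y"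
    have f: "linear ?f"
      by (rule linearI) (simp_all add: linear_add[OF L] linear_add[OF B_linear] linear_scale[OF L]
          linear_scale[OF B_linear] inner_add_left)
    obtain a where a: "T a = (\<Sum>b\<in>Basis. ?f b *\<^sub>R b)" using \<open>surj T\<close> by (metis surjD)
    have "B x \<bullet> y = x \<bullet> L a" for x
    proof -
      have "B x \<bullet> y = T a \<bullet> B x" unfolding a by (subst rep[OF f]) (simp add: LB)
      also have "\<dots> = \<beta> a (B x)" by (rule T)
      also have "\<dots> = x \<bullet> L a" by (simp add: \<beta>_def C_def LB inner_commute[of x])
      finally show ?thesis .
    qed
    then show ?thesis by blast
  qed
  then obtain f' where f': "\<forall>x y. B x \<bullet> y = x \<bullet> f' y" by metis
  have "\<forall>x y. B x \<bullet> y = x \<bullet> adjoint B y"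
    unfolding adjoint_def by (rule someI[of "\<lambda>f'. \<forall>x y. B x \<bullet> y = x \<bullet> f' y", OF f'])
  then show ?thesis by blast
qed

lemma B_inner: "B x \<bullet> B y = x \<bullet> y"
  by (simp add: adjoint_B B_isometry)

lemma B_norm: "norm (B x) = norm x"
  by (simp add: norm_eq_sqrt_inner B_inner)

lemma B_bounded_linear: "bounded_linear B"
  using B_linear by (auto simp: linear_iff B_norm intro!: bounded_linear_intro[of B 1])

lemma adjoint_B_norm: "norm (adjoint B y) \<le> norm y"
proof -
  have "norm (adjoint B y) * norm (adjoint B y) = B (adjoint B y) \<bullet> y"
    unfolding adjoint_B by (simp only: power2_norm_eq_inner[symmetric] power2_eq_square)
  also have "\<dots> \<le> norm (adjoint B y) * norm y"
    using norm_cauchy_schwarz[of "B (adjoint B y)" y] by (simp add: B_norm)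
  finally show ?thesis by (cases "adjoint B y = 0") auto
qed

lemma adjoint_B_linear: "linear (adjoint B)"
proof (rule linearI)
  fix x y :: 'e and r :: real
  have "v \<bullet> adjoint B (x + y) = v \<bullet> (adjoint B x + adjoint B y)" for v
    unfolding inner_add_right adjoint_B[symmetric] by (rule refl)
  then show "adjoint B (x + y) = adjoint B x + adjoint B y" using vector_eq_ldot by blast
  have "v \<bullet> adjoint B (r *\<^sub>R x) = v \<bullet> (r *\<^sub>R adjoint B x)" for v
    unfolding inner_scaleR_right adjoint_B[symmetric] by (rule refl)
  then show "adjoint B (r *\<^sub>R x) = r *\<^sub>R adjoint B x" using vector_eq_ldot by blast
qed

lemma adjoint_B_bounded_linear: "bounded_linear (adjoint B)"
  using adjoint_B_linear adjoint_B_norm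
  by (auto simp: linear_iff intro!: bounded_linear_intro[of _ 1])

lemma adjoint_A: "A x \<bullet> y = x \<bullet> adjoint A y"
  by (rule adjoint_works[OF A_linear, symmetric])

lemma adjoint_A_linear: "linear (adjoint A)"
  by (rule adjoint_linear[OF A_linear])

lemma adjoint_A_inj: assumes "adjoint A y = 0" shows "y = 0"
proof -
  obtain x where "A x = y" using A_surj by (metis surjD)
  then have "y \<bullet> y = 0" using adjoint_A[of x y] assms by simp
  then show ?thesis by simp
qed

lemma adjoint_B_adjoint_A: "adjoint B (adjoint A y) = 0"
proof -
  have "x \<bullet> adjoint B (adjoint A y) = x \<bullet> 0" for x
    unfolding adjoint_B[symmetric] adjoint_A[symmetric] A_B by simp
  then show ?thesis using vector_eq_ldot by blast
qed

lemma range_B: "range B = {x. A x = 0}"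
proof (rule subspace_dim_equal)
  show "subspace (range B)" using B_linear by (rule linear_subspace_image[OF _ subspace_UNIV])
  show "subspace {x. A x = 0}" by (rule linear_subspace_kernel[OF A_linear])
  show "range B \<subseteq> {x. A x = 0}" using A_B by auto
  obtain S :: "'h set" where S: "independent S" "span S = UNIV" "card S = dim (UNIV :: 'h set)"
    using basis_exists[of "UNIV :: 'h set"] by (metis UNIV_I subset_UNIV top.extremum_uniqueI)
  have "independent (B ` S)"
    using linear_independent_injective_image[OF B_linear S(1)] B_inj by (simp add: inj_on_subset)
  moreover have "span (B ` S) = range B" using linear_span_image[OF B_linear, of S] S(2) by simp
  ultimately have "dim (range B) = card (B ` S)" by (metis dim_span_eq_card_independent)
  also have "\<dots> = card S" by (rule card_image) (use B_inj in \<open>rule inj_on_subset\<close>, simp)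
  finally show "dim {x. A x = 0} \<le> dim (range B)" using S(3) dim_reduced by simp
qed

lemma B_adjoint_B: "A x = 0 \<Longrightarrow> B (adjoint B x) = x"
proof -
  assume "A x = 0"
  then have "x \<in> range B" by (simp add: range_B)
  then obtain y where "x = B y" by blast
  then show ?thesis by (simp add: B_isometry)
qed

lemma B_zero_iff: "B x = 0 \<longleftrightarrow> x = 0"
  by (metis B_norm norm_eq_zero)

section \<open>Derivatives of the reduced function\<close>

text \<open>At a point \<open>w\<close> of the reduced space: the primal point, the proximal point, the residual
  $x - z$, the operator $\mathcal W$, and the derivative of the residual.\<close>

definition full :: "'h \<times> 'e \<Rightarrow> 'e" where "full w = xbar + B (fst w)"

definition zpt :: "real \<Rightarrow> real \<Rightarrow> 'h \<times> 'e \<Rightarrow> 'e" where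
  "zpt rho mu w = prox (mu / rho) (full w - (1 / rho) *\<^sub>R snd w)"

definition resid :: "real \<Rightarrow> real \<Rightarrow> 'h \<times> 'e \<Rightarrow> 'e" where
  "resid rho mu w = full w - zpt rho mu w"

definition Wat :: "real \<Rightarrow> real \<Rightarrow> 'h \<times> 'e \<Rightarrow> 'e \<Rightarrow> 'e" where
  "Wat rho mu w = barrier_op (mu / rho) (zpt rho mu w)"

definition resid_deriv :: "real \<Rightarrow> real \<Rightarrow> 'h \<times> 'e \<Rightarrow> 'h \<times> 'e \<Rightarrow> 'e" where
  "resid_deriv rho mu w d =
     coresolvent (Wat rho mu w) (B (fst d)) + (1 / rho) *\<^sub>R resolvent (Wat rho mu w) (snd d)"

lemma Wat_positive: "rho > 0 \<Longrightarrow> mu > 0 \<Longrightarrow> positive_operator (Wat rho mu w)"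
  unfolding Wat_def by (rule barrier_op_positive) simp

lemma zpt_positive: "rho > 0 \<Longrightarrow> mu > 0 \<Longrightarrow> positive (zpt rho mu w)"
  unfolding zpt_def by (rule prox_positive) simp

lemma zpt_zprox: "rho > 0 \<Longrightarrow> mu > 0 \<Longrightarrow> zpt rho mu w = zprox rho mu (full w) (snd w)"
  by (simp add: zpt_def zprox_eq)

lemma zpt_optimality:
  assumes rho: "rho > 0" and mu: "mu > 0"
  shows "mu *\<^sub>R jinv (zpt rho mu w) + rho *\<^sub>R resid rho mu w = snd w"
proof -
  have "rho *\<^sub>R (zpt rho mu w - (mu / rho) *\<^sub>R jinv (zpt rho mu w)) = rho *\<^sub>R (full w - (1 / rho) *\<^sub>R snd w)"
    unfolding zpt_def using prox_eq[of "mu / rho"] rho mu by simp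
  then show ?thesis using rho by (simp add: resid_def algebra_simps)
qed

lemma eta_eq:
  assumes rho: "rho > 0" and mu: "mu > 0"
  shows "eta rho mu w = c \<bullet> full w + mu * barrier (zpt rho mu w) - snd w \<bullet> resid rho mu w
    + rho / 2 * (resid rho mu w \<bullet> resid rho mu w)"
proof -
  let ?F = "\<lambda>z. c \<bullet> full w + mu * barrier z + snd w \<bullet> (z - full w) + rho / 2 * (norm (z - full w))\<^sup>2"
  have z: "positive (zpt rho mu w)" by (rule zpt_positive[OF rho mu])
  have min: "?F (zpt rho mu w) \<le> ?F y" if "positive y" for y
  proof -
    have "0 \<le> rho / 2 * (norm (y - zpt rho mu w))\<^sup>2" using rho by simp
    then show ?thesis
      using prox_minimal[OF mu rho that refl, of "full w" "snd w", folded zpt_def]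
      unfolding inner_diff_right by linarith
  qed
  have "eta rho mu w = Inf (?F ` Collect positive)"
    by (simp add: eta_def full_def interior_symcone Let_def)
  also have "\<dots> = ?F (zpt rho mu w)"
    by (rule cInf_eq_minimum) (use z min in auto)
  also have "zpt rho mu w - full w = - resid rho mu w" by (simp add: resid_def)
  finally show ?thesis by (simp add: power2_norm_eq_inner)
qed

lemma full_has_derivative: "(full has_derivative (\<lambda>d. B (fst d))) (at w)"
  unfolding full_def[abs_def]
  by (auto intro!: derivative_eq_intros bounded_linear.has_derivative[OF B_bounded_linear])

lemma zpt_has_derivative:
  assumes rho: "rho > 0" and mu: "mu > 0"
  shows "(zpt rho mu has_derivative (\<lambda>d. resolvent (Wat rho mu w) (B (fst d) - (1 / rho) *\<^sub>R snd d))) (at w)"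
proof -
  have "((\<lambda>w. full w - (1 / rho) *\<^sub>R snd w) has_derivative (\<lambda>d. B (fst d) - (1 / rho) *\<^sub>R snd d)) (at w)"
    by (intro has_derivative_diff full_has_derivative has_derivative_scaleR_right has_derivative_snd
        has_derivative_ident)
  from has_derivative_compose[OF this prox_has_derivative] rho mu
  show ?thesis unfolding zpt_def[abs_def] Wat_def by simp
qed

lemma resid_has_derivative:
  assumes rho: "rho > 0" and mu: "mu > 0"
  shows "(resid rho mu has_derivative resid_deriv rho mu w) (at w)"
proof -
  interpret W: positive_operator "Wat rho mu w" by (rule Wat_positive[OF rho mu])
  have "(resid rho mu has_derivative (\<lambda>d. B (fst d) - resolvent (Wat rho mu w) (B (fst d) - (1 / rho) *\<^sub>R snd d))) (at w)"
    unfolding resid_def[abs_def]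
    by (rule has_derivative_diff[OF full_has_derivative zpt_has_derivative[OF rho mu]])
  moreover have "(\<lambda>d. B (fst d) - resolvent (Wat rho mu w) (B (fst d) - (1 / rho) *\<^sub>R snd d)) = resid_deriv rho mu w"
    by (rule ext) (simp add: resid_deriv_def coresolvent_def linear_diff[OF W.resolvent_linear]
        linear_scale[OF W.resolvent_linear])
  ultimately show ?thesis by simp
qed

text \<open>The contributions of the derivative of the proximal point cancel by its optimality condition.\<close>

lemma eta_has_derivative:
  assumes rho: "rho > 0" and mu: "mu > 0"
  shows "(eta rho mu has_derivative
    (\<lambda>d. B (fst d) \<bullet> (c - snd w + rho *\<^sub>R resid rho mu w) - snd d \<bullet> resid rho mu w)) (at w)"
proof -
  let ?z = "zpt rho mu w" and ?r = "resid rho mu w"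
  let ?z' = "\<lambda>d. resolvent (Wat rho mu w) (B (fst d) - (1 / rho) *\<^sub>R snd d)"
  let ?r' = "\<lambda>d. B (fst d) - ?z' d"
  have r': "(resid rho mu has_derivative ?r') (at w)"
    unfolding resid_def[abs_def]
    by (rule has_derivative_diff[OF full_has_derivative zpt_has_derivative[OF rho mu]])
  have bar: "((\<lambda>w. barrier (zpt rho mu w)) has_derivative (\<lambda>d. - (jinv ?z \<bullet> ?z' d))) (at w)"
    by (rule has_derivative_compose[OF zpt_has_derivative[OF rho mu] barrier_has_gradient[OF zpt_positive[OF rho mu]]])
  have der: "((\<lambda>w. c \<bullet> full w + mu * barrier (zpt rho mu w) - snd w \<bullet> resid rho mu w
      + rho / 2 * (resid rho mu w \<bullet> resid rho mu w)) has_derivative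
      (\<lambda>d. c \<bullet> B (fst d) + mu * (- (jinv ?z \<bullet> ?z' d)) - (snd w \<bullet> ?r' d + snd d \<bullet> ?r)
        + rho / 2 * (?r \<bullet> ?r' d + ?r' d \<bullet> ?r))) (at w)"
    by (intro has_derivative_add has_derivative_diff has_derivative_inner_right full_has_derivative
        has_derivative_mult_right bar has_derivative_inner has_derivative_snd has_derivative_ident r')
  have val: "c \<bullet> B (fst d) + mu * (- (jinv ?z \<bullet> ?z' d)) - (snd w \<bullet> ?r' d + snd d \<bullet> ?r)
        + rho / 2 * (?r \<bullet> ?r' d + ?r' d \<bullet> ?r)
      = B (fst d) \<bullet> (c - snd w + rho *\<^sub>R ?r) - snd d \<bullet> ?r" for d
  proof -
    have "mu * (jinv ?z \<bullet> ?z' d) + rho * (?r \<bullet> ?z' d) = snd w \<bullet> ?z' d"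
      using arg_cong[OF zpt_optimality[OF rho mu, of w], of "\<lambda>v. v \<bullet> ?z' d"] by (simp add: inner_add_left)
    moreover have "rho / 2 * (?r \<bullet> ?r' d + ?r' d \<bullet> ?r) = rho * (?r \<bullet> B (fst d)) - rho * (?r \<bullet> ?z' d)"
      by (simp add: inner_diff_right inner_commute right_diff_distrib)
    moreover have "snd w \<bullet> ?r' d = snd w \<bullet> B (fst d) - snd w \<bullet> ?z' d" by (rule inner_diff_right)
    moreover have "B (fst d) \<bullet> (c - snd w + rho *\<^sub>R ?r)
        = c \<bullet> B (fst d) - snd w \<bullet> B (fst d) + rho * (?r \<bullet> B (fst d))"
      by (simp add: inner_add_right inner_diff_right inner_commute)
    ultimately show ?thesis by linarith
  qed
  have "eta rho mu = (\<lambda>w. c \<bullet> full w + mu * barrier (zpt rho mu w) - snd w \<bullet> resid rho mu w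
      + rho / 2 * (resid rho mu w \<bullet> resid rho mu w))"
    by (rule ext) (rule eta_eq[OF rho mu])
  with der show ?thesis by (simp only: val)
qed

lemma grad_eta:
  assumes rho: "rho > 0" and mu: "mu > 0"
  shows "grad (eta rho mu) w = (adjoint B (c - snd w + rho *\<^sub>R resid rho mu w), - resid rho mu w)"
proof (rule grad_eqI)
  show "GDERIV (eta rho mu) w :> (adjoint B (c - snd w + rho *\<^sub>R resid rho mu w), - resid rho mu w)"
    using eta_has_derivative[OF rho mu, of w] by (simp add: gderiv_def inner_prod_def adjoint_B)
qed

lemma grad_x_eq:
  assumes rho: "rho > 0" and mu: "mu > 0"
  shows "grad (\<lambda>y. eta rho mu (y, s)) y = adjoint B (c - s + rho *\<^sub>R resid rho mu (y, s))"
proof (rule grad_eqI)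
  have "((\<lambda>y. (y, s)) has_derivative (\<lambda>h. (h, 0))) (at y)"
    by (intro has_derivative_Pair has_derivative_ident has_derivative_const)
  from has_derivative_compose[OF this eta_has_derivative[OF rho mu]]
  show "GDERIV (\<lambda>y. eta rho mu (y, s)) y :> adjoint B (c - s + rho *\<^sub>R resid rho mu (y, s))"
    by (simp add: gderiv_def adjoint_B)
qed

lemma grad_s_eq:
  assumes rho: "rho > 0" and mu: "mu > 0"
  shows "grad (\<lambda>s. eta rho mu (y, s)) s = - resid rho mu (y, s)"
proof (rule grad_eqI)
  have "((\<lambda>s. (y, s)) has_derivative (\<lambda>h. (0, h))) (at s)"
    by (intro has_derivative_Pair has_derivative_ident has_derivative_const)
  from has_derivative_compose[OF this eta_has_derivative[OF rho mu]]
  show "GDERIV (\<lambda>s. eta rho mu (y, s)) s :> - resid rho mu (y, s)"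
    by (simp add: gderiv_def linear_0[OF B_linear])
qed

lemma grad_x_resid:
  "rho > 0 \<Longrightarrow> mu > 0 \<Longrightarrow> grad_x rho mu w = adjoint B (c - snd w + rho *\<^sub>R resid rho mu w)"
  by (simp add: grad_x_def grad_x_eq)

lemma grad_s_resid: "rho > 0 \<Longrightarrow> mu > 0 \<Longrightarrow> grad_s rho mu w = - resid rho mu w"
  by (simp add: grad_s_def grad_s_eq)

lemma hess_eta:
  assumes rho: "rho > 0" and mu: "mu > 0"
  shows "hess (eta rho mu) w = (\<lambda>d. (adjoint B (rho *\<^sub>R resid_deriv rho mu w d - snd d), - resid_deriv rho mu w d))"
proof -
  have "((\<lambda>w. (adjoint B (c - snd w + rho *\<^sub>R resid rho mu w), - resid rho mu w)) has_derivative
      (\<lambda>d. (adjoint B (0 - snd d + rho *\<^sub>R resid_deriv rho mu w d), - resid_deriv rho mu w d))) (at w)"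
    by (intro has_derivative_Pair bounded_linear.has_derivative[OF adjoint_B_bounded_linear]
        has_derivative_add has_derivative_diff has_derivative_const has_derivative_snd
        has_derivative_ident has_derivative_scaleR_right has_derivative_minus resid_has_derivative[OF rho mu])
  then have "(grad (eta rho mu) has_derivative
      (\<lambda>d. (adjoint B (rho *\<^sub>R resid_deriv rho mu w d - snd d), - resid_deriv rho mu w d))) (at w)"
    by (simp add: grad_eta[OF rho mu, abs_def] algebra_simps)
  then show ?thesis unfolding hess_def by (rule frechet_derivative_at[symmetric])
qed

lemma hess_xx_eq:
  assumes rho: "rho > 0" and mu: "mu > 0"
  shows "hess_xx rho mu w = (\<lambda>h. rho *\<^sub>R adjoint B (coresolvent (Wat rho mu w) (B h)))"
proof -
  interpret W: positive_operator "Wat rho mu w" by (rule Wat_positive[OF rho mu])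
  have "((\<lambda>y. (y, snd w)) has_derivative (\<lambda>h. (h, 0))) (at (fst w))"
    by (intro has_derivative_Pair has_derivative_ident has_derivative_const)
  then have "((\<lambda>y. resid rho mu (y, snd w)) has_derivative (\<lambda>h. resid_deriv rho mu w (h, 0))) (at (fst w))"
    using has_derivative_compose[where g = "resid rho mu"] resid_has_derivative[OF rho mu, of w] by fastforce
  then have "((\<lambda>y. adjoint B (c - snd w + rho *\<^sub>R resid rho mu (y, snd w))) has_derivative
      (\<lambda>h. adjoint B (0 + rho *\<^sub>R resid_deriv rho mu w (h, 0)))) (at (fst w))"
    by (intro bounded_linear.has_derivative[OF adjoint_B_bounded_linear]
        has_derivative_add has_derivative_const has_derivative_scaleR_right)
  then have "(grad (\<lambda>y. eta rho mu (y, snd w)) has_derivative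
      (\<lambda>h. rho *\<^sub>R adjoint B (coresolvent (Wat rho mu w) (B h)))) (at (fst w))"
    by (simp add: grad_x_eq[OF rho mu, abs_def] resid_deriv_def linear_0[OF W.resolvent_linear]
        linear_scale[OF adjoint_B_linear])
  then show ?thesis unfolding hess_xx_def hess_def by (rule frechet_derivative_at[symmetric])
qed

lemma hess_ss_eq:
  assumes rho: "rho > 0" and mu: "mu > 0"
  shows "hess_ss rho mu w = (\<lambda>h. - ((1 / rho) *\<^sub>R resolvent (Wat rho mu w) h))"
proof -
  interpret W: positive_operator "Wat rho mu w" by (rule Wat_positive[OF rho mu])
  have "((\<lambda>s. (fst w, s)) has_derivative (\<lambda>h. (0, h))) (at (snd w))"
    by (intro has_derivative_Pair has_derivative_ident has_derivative_const)
  then have "((\<lambda>s. resid rho mu (fst w, s)) has_derivative (\<lambda>h. resid_deriv rho mu w (0, h))) (at (snd w))"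
    using has_derivative_compose[where g = "resid rho mu"] resid_has_derivative[OF rho mu, of w] by fastforce
  then have "((\<lambda>s. - resid rho mu (fst w, s)) has_derivative (\<lambda>h. - resid_deriv rho mu w (0, h))) (at (snd w))"
    by (rule has_derivative_minus)
  then have "(grad (\<lambda>s. eta rho mu (fst w, s)) has_derivative
      (\<lambda>h. - ((1 / rho) *\<^sub>R resolvent (Wat rho mu w) h))) (at (snd w))"
    by (simp add: grad_s_eq[OF rho mu, abs_def] resid_deriv_def linear_0[OF W.coresolvent_linear]
        linear_0[OF B_linear])
  then show ?thesis unfolding hess_ss_def hess_def by (rule frechet_derivative_at[symmetric])
qed

section \<open>Newton steps\<close>

lemma full_reduced: "A x = b \<Longrightarrow> full (reduced (x, s, l)) = x"
  using B_adjoint_B[of "x - xbar"] A_xbar by (simp add: full_def reduced_def linear_diff[OF A_linear])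

lemma snd_reduced: "snd (reduced (x, s, l)) = s"
  by (simp add: reduced_def)

lemma Wop_eq:
  assumes rho: "rho > 0" and mu: "mu > 0" and x: "A x = b"
  shows "Wop rho mu x s = Wat rho mu (reduced (x, s, l))"
proof -
  let ?w = "reduced (x, s, l)"
  have z: "zprox rho mu x s = zpt rho mu ?w"
    by (simp add: zpt_zprox[OF rho mu] full_reduced[OF x] snd_reduced)
  show ?thesis
    unfolding Wop_def[abs_def] Wat_def barrier_op_def[abs_def] z hess_barrier[OF zpt_positive[OF rho mu]]
    by (rule refl)
qed

lemma newtonN_iff:
  assumes rho: "rho > 0" and mu: "mu > 0" and x: "A x = b"
  shows "newtonN rho mu (x, s, l) (dx, ds, dl) \<longleftrightarrow>
    A dx = 0 \<and> ds + adjoint A dl = c - (adjoint A l + s) \<and>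
    coresolvent (Wat rho mu (reduced (x, s, l))) dx
      + (1 / rho) *\<^sub>R resolvent (Wat rho mu (reduced (x, s, l))) ds = - resid rho mu (reduced (x, s, l))"
proof -
  define w where "w = reduced (x, s, l)"
  interpret W: positive_operator "Wat rho mu w" by (rule Wat_positive[OF rho mu])
  have Wop: "Wop rho mu x s = Wat rho mu w" unfolding w_def by (rule Wop_eq[OF rho mu x])
  have "Hop rho mu x s = (\<lambda>h. h + Wat rho mu w h)"
    by (rule ext) (simp add: Hop_def Wop)
  then have "inv (Hop rho mu x s) = resolvent (Wat rho mu w)" by (simp add: resolvent_def)
  moreover have "zprox rho mu x s = x - resid rho mu w"
    by (simp add: resid_def zpt_zprox[OF rho mu] w_def full_reduced[OF x] snd_reduced)
  ultimately show ?thesis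
    by (simp add: newtonN_def Wop W.resolvent_of_W x flip: w_def)
qed

text \<open>The system is square, and a solution of the homogeneous system has
  $\langle\Delta x, \Delta s\rangle = 0$, hence $\langle\Delta x, \mathcal W \Delta x\rangle = 0$.\<close>

lemma newtonN_unique_solution:
  assumes rho: "rho > 0" and mu: "mu > 0" and x: "A x = b"
  shows "\<exists>!dv. newtonN rho mu (x, s, l) dv"
proof -
  define W where "W = Wat rho mu (reduced (x, s, l))"
  interpret W: positive_operator W unfolding W_def by (rule Wat_positive[OF rho mu])
  define N :: "'e \<times> 'e \<times> (real ^ 'm) \<Rightarrow> 'e \<times> 'e \<times> (real ^ 'm)" where
    "N = (\<lambda>(dx, ds, dl). (coresolvent W dx + (1 / rho) *\<^sub>R resolvent W ds, ds + adjoint A dl, A dx))"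
  have N_lin: "linear N"
    by (rule linearI) (auto simp: N_def linear_add[OF W.coresolvent_linear] linear_add[OF W.resolvent_linear]
        linear_add[OF adjoint_A_linear] linear_add[OF A_linear] linear_scale[OF W.coresolvent_linear]
        linear_scale[OF W.resolvent_linear] linear_scale[OF adjoint_A_linear] linear_scale[OF A_linear]
        algebra_simps)
  have "inj N" unfolding linear_injective_0[OF N_lin]
  proof (intro allI impI)
    fix v assume v0: "N v = 0"
    obtain dx ds dl where v: "v = (dx, ds, dl)" by (cases v)
    have 1: "coresolvent W dx + (1 / rho) *\<^sub>R resolvent W ds = 0" and 2: "ds + adjoint A dl = 0" and 3: "A dx = 0"
      using v0 by (auto simp: v N_def zero_prod_def)
    have "resolvent W (W dx + (1 / rho) *\<^sub>R ds) = 0"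
      using 1 by (simp add: linear_add[OF W.resolvent_linear] linear_scale[OF W.resolvent_linear] W.resolvent_of_W)
    then have 4: "W dx + (1 / rho) *\<^sub>R ds = 0"
      using W.resolvent_right[of "W dx + (1 / rho) *\<^sub>R ds"] by (simp add: linear_0[OF W.W_linear])
    have "dx \<bullet> ds = - (dx \<bullet> adjoint A dl)" using 2 by (simp add: eq_neg_iff_add_eq_0 flip: inner_add_right)
    also have "\<dots> = 0" by (simp add: 3 flip: adjoint_A)
    finally have "dx \<bullet> (W dx + (1 / rho) *\<^sub>R ds) = dx \<bullet> W dx" by (simp add: inner_add_right)
    then have "dx \<bullet> W dx = 0" by (simp add: 4)
    then have dx: "dx = 0" using W.W_pos by force
    then have ds: "ds = 0" using 4 rho by (simp add: linear_0[OF W.W_linear])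
    then have "dl = 0" using 2 adjoint_A_inj by simp
    with dx ds show "v = 0" by (simp add: v zero_prod_def)
  qed
  moreover from this have "surj N" using linear_injective_imp_surjective[OF N_lin] by simp
  ultimately have "bij N" by (simp add: bij_def)
  let ?y = "(- resid rho mu (reduced (x, s, l)), c - (adjoint A l + s), 0 :: real ^ 'm)"
  have iff: "newtonN rho mu (x, s, l) dv \<longleftrightarrow> N dv = ?y" for dv
    by (cases dv) (auto simp: newtonN_iff[OF rho mu x] N_def W_def)
  show ?thesis unfolding iff using \<open>bij N\<close> by (simp add: bij_iff)
qed

text \<open>The squared length of a step $(\Delta x, \Delta s)$ in the metric given by the diagonal blocks of the
  Hessian of $\eta_\rho$, up to the factor $\rho/\mu$.\<close>

definition step_form :: "real \<Rightarrow> real \<Rightarrow> 'h \<times> 'e \<Rightarrow> 'e \<Rightarrow> 'e \<Rightarrow> real" where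
  "step_form rho mu w dx ds = dx \<bullet> coresolvent (Wat rho mu w) dx
     + ((1 / rho) *\<^sub>R ds) \<bullet> resolvent (Wat rho mu w) ((1 / rho) *\<^sub>R ds)"

text \<open>The third Newton equation determines $\Delta s$ by $d = r + \Delta x$, and the length of the step
  splits into the local norm of $d$ and the norm of the residual.\<close>

lemma newton_step_form:
  assumes rho: "rho > 0" and mu: "mu > 0"
    and eq: "coresolvent (Wat rho mu w) dx + (1 / rho) *\<^sub>R resolvent (Wat rho mu w) ds = - resid rho mu w"
  defines "r \<equiv> resid rho mu w" and "z \<equiv> zpt rho mu w"
  shows "(1 / rho) *\<^sub>R ds = - (r + Wat rho mu w (r + dx))"
    and "step_form rho mu w dx ds = mu / rho * (norm (scali z (r + dx)))\<^sup>2 + (norm r)\<^sup>2"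
proof -
  define W where "W = Wat rho mu w"
  interpret W: positive_operator W unfolding W_def by (rule Wat_positive[OF rho mu])
  define t where "t = (1 / rho) *\<^sub>R ds"
  have eq': "coresolvent W dx + resolvent W t = - r"
    using eq by (simp add: W_def t_def r_def linear_scale[OF W.resolvent_linear, unfolded W_def])
  then have "resolvent W (W dx + t) = - r" by (simp add: linear_add[OF W.resolvent_linear] W.resolvent_of_W)
  then have "W dx + t = - r - W r"
    using W.resolvent_right[of "W dx + t"] by (simp add: linear_neg[OF W.W_linear])
  then have t: "t = - (r + W (r + dx))" by (simp add: linear_add[OF W.W_linear] algebra_simps)
  then show "(1 / rho) *\<^sub>R ds = - (r + Wat rho mu w (r + dx))" by (simp add: t_def W_def)
  define d where "d = r + dx"
  have dx: "dx = d - r" by (simp add: d_def)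
  have t': "t = - (r + W d)" by (simp add: t d_def)
  have "dx \<bullet> coresolvent W dx + t \<bullet> resolvent W t = dx \<bullet> (- r) + (t - dx) \<bullet> resolvent W t"
    unfolding eq'[symmetric] by (simp add: inner_add_right inner_diff_left)
  also have "t - dx = - (d + W d)" by (simp add: t' dx)
  also have "- (d + W d) \<bullet> resolvent W t = - (d \<bullet> t)"
    using W.resolvent_sym[of "d + W d" t] by (simp only: inner_minus_left W.resolvent_left)
  also have "dx \<bullet> (- r) + - (d \<bullet> t) = d \<bullet> W d + r \<bullet> r"
    by (simp add: dx t' inner_diff_left inner_diff_right inner_add_right inner_commute[of r d])
  finally show "step_form rho mu w dx ds = mu / rho * (norm (scali z (r + dx)))\<^sup>2 + (norm r)\<^sup>2"
    using barrier_op_form[of d "mu / rho" "zpt rho mu w"]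
    by (simp add: step_form_def W_def t_def d_def z_def Wat_def power2_norm_eq_inner)
qed

text \<open>The Newton direction of the saddle function is the solution of the Newton system: multiplied by
  the adjoint of \<open>B\<close>, the dual equation loses the multiplier. The iterates of the first phase, which
  may violate the dual equation, are covered.\<close>

lemma delta_eq_step_form:
  assumes rho: "rho > 0" and mu: "mu > 0" and x: "A x = b"
    and N: "newtonN rho mu (x, s, l) (dx, ds, dl)"
  shows "delta rho mu (reduced (x, s, l)) = sqrt (rho / mu * step_form rho mu (reduced (x, s, l)) dx ds)"
proof -
  define w where "w = reduced (x, s, l)"
  interpret W: positive_operator "Wat rho mu w" by (rule Wat_positive[OF rho mu])
  have eqs: "A dx = 0" "ds + adjoint A dl = c - (adjoint A l + s)"
    "coresolvent (Wat rho mu w) dx + (1 / rho) *\<^sub>R resolvent (Wat rho mu w) ds = - resid rho mu w"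
    using N by (simp_all add: newtonN_iff[OF rho mu x] w_def)
  define h where "h = adjoint B dx"
  have Bh: "B h = dx" by (simp add: h_def B_adjoint_B eqs(1))
  have rd: "resid_deriv rho mu w (h, ds) = - resid rho mu w"
    by (simp add: resid_deriv_def Bh eqs(3))
  have rd_lin: "linear (resid_deriv rho mu w)"
    by (rule linearI) (simp_all add: resid_deriv_def linear_add[OF B_linear] linear_scale[OF B_linear]
        linear_add[OF W.coresolvent_linear] linear_add[OF W.resolvent_linear]
        linear_scale[OF W.coresolvent_linear] linear_scale[OF W.resolvent_linear] algebra_simps)
  have H_lin: "linear (hess (eta rho mu) w)"
    unfolding hess_eta[OF rho mu]
    by (rule linearI) (simp_all add: linear_add[OF rd_lin] linear_scale[OF rd_lin] linear_add[OF adjoint_B_linear]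
        linear_diff[OF adjoint_B_linear] linear_scale[OF adjoint_B_linear] algebra_simps)
  have adjB: "adjoint B ds = adjoint B (c - s)"
  proof -
    have "adjoint B (ds + adjoint A dl) = adjoint B ((c - s) - adjoint A l)"
      unfolding eqs(2) by (simp add: algebra_simps)
    then show ?thesis
      unfolding linear_add[OF adjoint_B_linear] linear_diff[OF adjoint_B_linear, of "c - s"]
        adjoint_B_adjoint_A by simp
  qed
  have image: "hess (eta rho mu) w (- (h, ds)) = grad (eta rho mu) w"
  proof -
    have "snd w = s" by (simp add: w_def snd_reduced)
    then show ?thesis
      unfolding linear_neg[OF H_lin] unfolding hess_eta[OF rho mu] grad_eta[OF rho mu]
      using adjB by (simp add: rd linear_add[OF adjoint_B_linear] linear_diff[OF adjoint_B_linear]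
          linear_neg[OF adjoint_B_linear] linear_scale[OF adjoint_B_linear])
  qed
  have "inj (hess (eta rho mu) w)"
    unfolding linear_injective_0[OF H_lin]
  proof (intro allI impI)
    fix d assume "hess (eta rho mu) w d = 0"
    then have r0: "resid_deriv rho mu w d = 0" and "adjoint B (rho *\<^sub>R resid_deriv rho mu w d - snd d) = 0"
      by (auto simp: hess_eta[OF rho mu] zero_prod_def)
    then have a0: "adjoint B (snd d) = 0" by (simp add: linear_neg[OF adjoint_B_linear])
    let ?y = "Wat rho mu w (B (fst d)) + (1 / rho) *\<^sub>R snd d"
    have "resolvent (Wat rho mu w) ?y = 0"
      using r0 by (simp add: resid_deriv_def linear_add[OF W.resolvent_linear]
          linear_scale[OF W.resolvent_linear] W.resolvent_of_W)
    then have y0: "?y = 0" using W.resolvent_right[of ?y] by (simp add: linear_0[OF W.W_linear])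
    have "B (fst d) \<bullet> snd d = 0" by (simp add: adjoint_B a0)
    then have "B (fst d) \<bullet> ?y = B (fst d) \<bullet> Wat rho mu w (B (fst d))" by (simp add: inner_add_right)
    then have "B (fst d) \<bullet> Wat rho mu w (B (fst d)) = 0" by (simp add: y0)
    then have "B (fst d) = 0" using W.W_pos by force
    then have "fst d = 0" and "snd d = 0"
      using y0 rho by (auto simp: B_zero_iff linear_0[OF W.W_linear] linear_0[OF B_linear])
    then show "d = 0" by (simp add: prod_eq_iff)
  qed
  then have "inv (hess (eta rho mu) w) (grad (eta rho mu) w) = - (h, ds)"
    unfolding image[symmetric] by (rule inv_f_f)
  then have "delta rho mu w = sqrt (1 / mu * Seta rho mu w (- (h, ds)))"
    by (simp add: delta_def eta_norm_def)
  also have "Seta rho mu w (- (h, ds)) = rho * step_form rho mu w dx ds"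
  proof -
    have "Seta rho mu w (- (h, ds)) = rho * (dx \<bullet> coresolvent (Wat rho mu w) dx)
        + 1 / rho * (ds \<bullet> resolvent (Wat rho mu w) ds)"
      using adjoint_B[of h "coresolvent (Wat rho mu w) dx"]
      by (simp add: Seta_def hess_xx_eq[OF rho mu] hess_ss_eq[OF rho mu] linear_neg[OF B_linear] Bh
          linear_neg[OF W.coresolvent_linear] linear_neg[OF W.resolvent_linear] linear_neg[OF adjoint_B_linear])
    then show ?thesis using rho
      by (simp add: step_form_def linear_scale[OF W.resolvent_linear] distrib_left)
  qed
  finally show ?thesis by (simp add: w_def)
qed

text \<open>The operator \<open>T\<close> extends the projected operator from the range of \<open>B\<close> to the ambient space, where
  injectivity implies surjectivity.\<close>

lemma normal_equation_solvable:
  assumes W: "positive_operator W" shows "\<exists>p. adjoint B (coresolvent W (B p)) = g"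
proof -
  interpret W: positive_operator W by fact
  define P where "P y = B (adjoint B y)" for y
  have P_lin: "linear P"
    by (rule linearI) (simp_all add: P_def linear_add[OF B_linear] linear_add[OF adjoint_B_linear]
        linear_scale[OF B_linear] linear_scale[OF adjoint_B_linear])
  define T where "T y = P (coresolvent W (P y)) + (y - P y)" for y
  have T_lin: "linear T"
    by (rule linearI) (simp_all add: T_def linear_add[OF P_lin] linear_scale[OF P_lin]
        linear_add[OF W.coresolvent_linear] linear_scale[OF W.coresolvent_linear] algebra_simps)
  have "inj T" unfolding linear_injective_0[OF T_lin]
  proof (intro allI impI)
    fix y assume "T y = 0"
    moreover have "P y \<bullet> T y = P y \<bullet> coresolvent W (P y)"
      unfolding T_def P_def inner_add_right inner_diff_right adjoint_B B_isometry by simp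
    ultimately have "P y \<bullet> coresolvent W (P y) = 0" by simp
    then have "P y = 0" using W.coresolvent_pos by force
    with \<open>T y = 0\<close> show "y = 0"
      by (simp add: T_def linear_0[OF W.coresolvent_linear] linear_0[OF P_lin])
  qed
  then have "surj T" using linear_injective_imp_surjective[OF T_lin] by simp
  then obtain y where "T y = B g" by (metis surjD)
  then have "adjoint B (T y) = g" by (simp add: B_isometry)
  then have "adjoint B (coresolvent W (B (adjoint B y))) = g"
    by (simp add: T_def P_def linear_add[OF adjoint_B_linear] linear_diff[OF adjoint_B_linear] B_isometry)
  then show ?thesis by blast
qed

text \<open>For a feasible point $\nabla_{\hat x}\eta_\rho = \rho\,\mathcal B^* r$, so both blocks of $\xi_\rho$
  measure the same residual \<open>r\<close>.\<close>

lemma xi_feasible: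
  assumes rho: "rho > 0" and mu: "mu > 0" and x: "A x = b" and s: "adjoint A l + s = c"
  defines "w \<equiv> reduced (x, s, l)"
  obtains p where "adjoint B (coresolvent (Wat rho mu w) (B p)) = adjoint B (resid rho mu w)"
    "xi rho mu w = sqrt (rho / mu * (B p \<bullet> coresolvent (Wat rho mu w) (B p)
       + ((norm (resid rho mu w))\<^sup>2 + mu / rho * (norm (scali (zpt rho mu w) (resid rho mu w)))\<^sup>2)))"
proof -
  define W where "W = Wat rho mu w"
  have Wp: "positive_operator W" unfolding W_def by (rule Wat_positive[OF rho mu])
  interpret W: positive_operator W by (rule Wp)
  define r where "r = resid rho mu w"
  obtain p where p: "adjoint B (coresolvent W (B p)) = adjoint B r"
    using normal_equation_solvable[OF Wp] by blast
  have gx: "grad_x rho mu w = rho *\<^sub>R adjoint B r"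
  proof -
    have "c - snd w = adjoint A l" using s by (simp add: w_def snd_reduced algebra_simps)
    then show ?thesis
      by (simp add: grad_x_resid[OF rho mu] linear_add[OF adjoint_B_linear] adjoint_B_adjoint_A
          linear_scale[OF adjoint_B_linear] r_def)
  qed
  have "inj (hess_xx rho mu w)"
  proof (rule injI)
    fix a a' assume "hess_xx rho mu w a = hess_xx rho mu w a'"
    then have "adjoint B (coresolvent W (B a)) = adjoint B (coresolvent W (B a'))"
      using rho by (simp add: hess_xx_eq[OF rho mu] W_def)
    then have "adjoint B (coresolvent W (B (a - a'))) = 0"
      by (simp add: linear_diff[OF B_linear] linear_diff[OF W.coresolvent_linear] linear_diff[OF adjoint_B_linear])
    then have "B (a - a') \<bullet> coresolvent W (B (a - a')) = 0" by (simp add: adjoint_B)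
    then have "B (a - a') = 0" using W.coresolvent_pos by force
    then show "a = a'" by (simp add: B_zero_iff)
  qed
  moreover have "hess_xx rho mu w p = grad_x rho mu w"
    by (simp add: hess_xx_eq[OF rho mu] gx p flip: W_def)
  ultimately have ix: "inv (hess_xx rho mu w) (grad_x rho mu w) = p" by (metis inv_f_f)
  \<comment> \<open>the preimage of the gradient under the Hessian in \<open>s\<close>\<close>
  define q where "q = rho *\<^sub>R (r + W r)"
  have "inj (hess_ss rho mu w)"
  proof (rule injI)
    fix a a' assume "hess_ss rho mu w a = hess_ss rho mu w a'"
    then have "resolvent W a = resolvent W a'" using rho by (simp add: hess_ss_eq[OF rho mu] W_def)
    then show "a = a'" by (metis W.resolvent_right)
  qed
  moreover have "hess_ss rho mu w q = grad_s rho mu w"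
    using rho by (simp add: hess_ss_eq[OF rho mu] grad_s_resid[OF rho mu] q_def r_def[symmetric]
        W_def[symmetric] linear_scale[OF W.resolvent_linear] W.resolvent_left)
  ultimately have iss: "inv (hess_ss rho mu w) (grad_s rho mu w) = q" by (metis inv_f_f)
  have "grad_x rho mu w \<bullet> p = rho * (B p \<bullet> coresolvent W (B p))"
    by (simp add: gx p[symmetric] adjoint_B inner_commute)
  moreover have "grad_s rho mu w \<bullet> q = - (rho * ((norm r)\<^sup>2 + mu / rho * (norm (scali (zpt rho mu w) r))\<^sup>2))"
    using barrier_op_form[of r "mu / rho" "zpt rho mu w"]
    by (simp add: grad_s_resid[OF rho mu] q_def r_def[symmetric] inner_add_right power2_norm_eq_inner
        W_def Wat_def right_diff_distrib distrib_left)
  ultimately have "xi rho mu w = sqrt (rho / mu * (B p \<bullet> coresolvent W (B p)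
       + ((norm r)\<^sup>2 + mu / rho * (norm (scali (zpt rho mu w) r))\<^sup>2)))"
    by (simp add: xi_def ix iss distrib_left diff_divide_distrib add_divide_distrib)
  with p that show thesis by (simp add: W_def r_def)
qed

section \<open>Quadratic convergence and the change of the smoothing parameter\<close>

text \<open>Restricting the dual norm to the range of \<open>B\<close> can only decrease it.\<close>

lemma xi_le_residual_norm:
  assumes rho: "rho > 0" and mu: "mu > 0" and x: "A x = b" and s: "adjoint A l + s = c"
    and w: "w = reduced (x, s, l)"
  shows "xi rho mu w \<le> norm (scali (zpt rho mu w) (resid rho mu w)
      + (1 / (mu / rho)) *\<^sub>R scal (zpt rho mu w) (resid rho mu w))"
proof -
  have \<tau>: "mu / rho > 0" using rho mu by simp
  define W r z where "W = Wat rho mu w" and "r = resid rho mu w" and "z = zpt rho mu w"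
  interpret W: positive_operator W unfolding W_def by (rule Wat_positive[OF rho mu])
  obtain p where p: "adjoint B (coresolvent W (B p)) = adjoint B r"
    and xi: "xi rho mu w = sqrt (rho / mu * (B p \<bullet> coresolvent W (B p)
       + ((norm r)\<^sup>2 + mu / rho * (norm (scali z r))\<^sup>2)))"
    using xi_feasible[OF rho mu x s] by (auto simp: w W_def r_def z_def)
  define a where "a = B p \<bullet> coresolvent W (B p)"
  define N where "N = (norm r)\<^sup>2 + (norm (scal z r))\<^sup>2 / (mu / rho)"
  have "a = B p \<bullet> r" by (simp add: a_def adjoint_B p)
  also have "\<dots> \<le> sqrt a * sqrt N"
    using coresolvent_dual_bound[OF \<tau>, of "B p" r z] by (simp add: a_def N_def W_def Wat_def z_def)
  finally have "a \<le> sqrt a * sqrt N" .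
  moreover have a0: "a \<ge> 0" unfolding a_def by (rule W.coresolvent_nonneg)
  ultimately have "sqrt a * sqrt a \<le> sqrt a * sqrt N" by simp
  then have "a \<le> N"
  proof (cases "a = 0")
    case True
    have "N \<ge> 0" unfolding N_def using rho mu by (intro add_nonneg_nonneg divide_nonneg_nonneg) auto
    with True show ?thesis by simp
  next
    case False
    with a0 have "sqrt a > 0" by simp
    with \<open>sqrt a * sqrt a \<le> sqrt a * sqrt N\<close> have "sqrt a \<le> sqrt N" by (simp only: mult_le_cancel_left_pos)
    then show ?thesis by simp
  qed
  then have "a + ((norm r)\<^sup>2 + mu / rho * (norm (scali z r))\<^sup>2)
      \<le> mu / rho * (norm (scali z r + (1 / (mu / rho)) *\<^sub>R scal z r))\<^sup>2"
    unfolding scal_scali_norm[OF \<tau>] N_def by simp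
  then have "rho / mu * (a + ((norm r)\<^sup>2 + mu / rho * (norm (scali z r))\<^sup>2))
      \<le> rho / mu * (mu / rho * (norm (scali z r + (1 / (mu / rho)) *\<^sub>R scal z r))\<^sup>2)"
    using rho mu by (intro mult_left_mono) auto
  also have "\<dots> = (norm (scali z r + (1 / (mu / rho)) *\<^sub>R scal z r))\<^sup>2" using rho mu by simp
  finally show ?thesis
    unfolding xi a_def[symmetric] r_def[symmetric] z_def[symmetric] by (rule real_le_lsqrt[rotated]) simp
qed

lemma residual_le_xi:
  assumes rho: "rho > 0" and mu: "mu > 0" and x: "A x = b" and s: "adjoint A l + s = c"
  shows "norm (resid rho mu (reduced (x, s, l))) \<le> sqrt (mu / rho) * xi rho mu (reduced (x, s, l))"
proof -
  define w where "w = reduced (x, s, l)"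
  interpret W: positive_operator "Wat rho mu w" by (rule Wat_positive[OF rho mu])
  obtain p where xi: "xi rho mu w = sqrt (rho / mu * (B p \<bullet> coresolvent (Wat rho mu w) (B p)
       + ((norm (resid rho mu w))\<^sup>2 + mu / rho * (norm (scali (zpt rho mu w) (resid rho mu w)))\<^sup>2)))"
    using xi_feasible[OF rho mu x s] by (auto simp: w_def)
  have "(norm (resid rho mu w))\<^sup>2 \<le> B p \<bullet> coresolvent (Wat rho mu w) (B p)
       + ((norm (resid rho mu w))\<^sup>2 + mu / rho * (norm (scali (zpt rho mu w) (resid rho mu w)))\<^sup>2)"
    using W.coresolvent_nonneg[of "B p"] rho mu by simp
  then have "(norm (resid rho mu w))\<^sup>2 \<le> mu / rho * (rho / mu * (B p \<bullet> coresolvent (Wat rho mu w) (B p)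
       + ((norm (resid rho mu w))\<^sup>2 + mu / rho * (norm (scali (zpt rho mu w) (resid rho mu w)))\<^sup>2)))"
    using rho mu by simp
  then have "norm (resid rho mu w) \<le> sqrt (mu / rho * (rho / mu * (B p \<bullet> coresolvent (Wat rho mu w) (B p)
       + ((norm (resid rho mu w))\<^sup>2 + mu / rho * (norm (scali (zpt rho mu w) (resid rho mu w)))\<^sup>2))))"
    by (rule real_le_rsqrt)
  then show ?thesis unfolding real_sqrt_mult[of "mu / rho"] xi[symmetric] by (simp add: w_def)
qed

text \<open>The pairs $(e + k, e - k)$ and $(e + p, e + q)$ are the new point in the coordinates of the old and
  of the new proximal point.\<close>

lemma newton_step_recenters:
  assumes rho: "rho > 0" and mu: "mu > 0" and x: "A x = b"
    and N: "newtonN rho mu (x, s, l) (dx, ds, dl)"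
    and close: "norm (scali (zpt rho mu (reduced (x, s, l))) (resid rho mu (reduced (x, s, l)) + dx)) \<le> 7 / 50"
  shows "(x + dx, s + ds, l + dl) \<in> nbhd (1 / 10) mu rho"
proof -
  have \<tau>: "mu / rho > 0" using rho mu by simp
  define w z r where "w = reduced (x, s, l)" and "z = zpt rho mu w" and "r = resid rho mu w"
  define w' z' r' where "w' = reduced (x + dx, s + ds, l + dl)" and "z' = zpt rho mu w'" and "r' = resid rho mu w'"
  have z: "positive z" "positive z'" by (simp_all add: z_def z'_def zpt_positive[OF rho mu])
  have eqs: "A dx = 0" "ds + adjoint A dl = c - (adjoint A l + s)"
    "coresolvent (Wat rho mu w) dx + (1 / rho) *\<^sub>R resolvent (Wat rho mu w) ds = - resid rho mu w"
    using N by (simp_all add: newtonN_iff[OF rho mu x] w_def)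
  have feas: "A (x + dx) = b" "adjoint A (l + dl) + (s + ds) = c"
    using eqs(1,2) x by (simp_all add: linear_add[OF A_linear] linear_add[OF adjoint_A_linear] algebra_simps)
  define k where "k = scali z (r + dx)"
  have x1: "x + dx = scal z (e + k)"
  proof -
    have "scal z (e + k) = z + (r + dx)"
      by (simp add: linear_add[OF scal_linear] scal_unit[OF z(1)] k_def scal_scali)
    also have "z + r = x"
      using full_reduced[OF x, of s l] by (simp add: r_def resid_def z_def w_def)
    then have "z + (r + dx) = x + dx" by (simp add: add.assoc[symmetric])
    finally show ?thesis by simp
  qed
  have s1: "s + ds = mu *\<^sub>R scali z (e - k)"
  proof -
    have "rho *\<^sub>R ((1 / rho) *\<^sub>R ds) = rho *\<^sub>R (- (r + Wat rho mu w (r + dx)))"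
      using newton_step_form(1)[OF rho mu eqs(3)] by (simp add: r_def)
    then have "ds = - (rho *\<^sub>R r) - rho *\<^sub>R Wat rho mu w (r + dx)"
      using rho by (simp add: scaleR_add_right scaleR_diff_right)
    also have "rho *\<^sub>R Wat rho mu w (r + dx) = mu *\<^sub>R scali z k"
      using rho by (simp add: Wat_def barrier_op_def k_def z_def)
    finally have "ds = - (rho *\<^sub>R r) - mu *\<^sub>R scali z k" .
    moreover have "s = mu *\<^sub>R jinv z + rho *\<^sub>R r"
      using zpt_optimality[OF rho mu, of w] by (simp add: w_def snd_reduced z_def r_def)
    ultimately show ?thesis
      by (simp add: linear_diff[OF scali_linear] scal_unit[OF z(1)] scaleR_diff_right)
  qed
  define p where "p = scali z' r'"
  define q where "q = (1 / (mu / rho)) *\<^sub>R scal z' r'"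
  have x2: "x + dx = scal z' (e + p)"
  proof -
    have "scal z' (e + p) = z' + r'"
      by (simp add: linear_add[OF scal_linear] scal_unit[OF z(2)] p_def scal_scali)
    also have "\<dots> = x + dx"
      using full_reduced[OF feas(1), of "s + ds" "l + dl"] by (simp add: r'_def resid_def z'_def w'_def)
    finally show ?thesis by simp
  qed
  have s2: "s + ds = mu *\<^sub>R scali z' (e + q)"
  proof -
    have "mu *\<^sub>R scali z' (e + q) = mu *\<^sub>R jinv z' + rho *\<^sub>R r'"
      using mu by (simp add: linear_add[OF scali_linear] scal_unit[OF z(2)] q_def
          linear_scale[OF scali_linear] scali_scal scaleR_add_right)
    also have "\<dots> = s + ds"
      using zpt_optimality[OF rho mu, of w'] by (simp add: w'_def snd_reduced z'_def r'_def)
    finally show ?thesis by simp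
  qed
  have "norm (p + q) \<le> 1 / 10"
  proof (rule primal_dual_gap_contraction[OF z])
    show "norm k \<le> 7 / 50" using close by (simp add: k_def z_def r_def w_def)
    show "scal z (e + k) = scal z' (e + p)" using x1 x2 by simp
    show "scali z (e - k) = scali z' (e + q)" using s1 s2 mu by simp
    have "p \<bullet> q = rho / mu * (r' \<bullet> r')" by (simp add: p_def q_def scali_symmetric scali_scal)
    then show "p \<bullet> q \<ge> 0" using rho mu by simp
  qed
  moreover have "xi rho mu w' \<le> norm (p + q)"
    using xi_le_residual_norm[OF rho mu feas w'_def] by (simp only: p_def q_def z'_def r'_def)
  ultimately have "xi rho mu w' \<le> 1 / 10" by linarith
  then show ?thesis using feas by (simp add: nbhd_def w'_def)
qed

text \<open>For a feasible point $\Delta x$ and $\Delta s$ are orthogonal, so the squared step length is a pairing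
  of the step with the residual for the new parameter. That residual is the old one plus the
  displacement \<open>\<Delta>\<close> of the proximal point. The old one is bounded by $\xi_\rho$ after a comparison of the
  metrics, the displacement by \<open>central_path_move\<close>.\<close>

lemma newton_step_after_mu_update:
  assumes rho: "rho > 0" and mu: "mu > 0" and \<sigma>: "0 < \<sigma>" "\<sigma> < 1"
    and x: "A x = b" and s: "adjoint A l + s = c"
    and N: "newtonN rho (\<sigma> * mu) (x, s, l) (dx, ds, dl)" and w: "w = reduced (x, s, l)"
  shows "norm (scali (zpt rho (\<sigma> * mu) w) (resid rho (\<sigma> * mu) w + dx))
    \<le> xi rho mu w / \<sigma> + sqrt (real jrank) * ((1 - \<sigma>) / \<sigma>)"
proof -
  have mu': "\<sigma> * mu > 0" using mu \<sigma> by simp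
  define \<tau> where "\<tau> = mu / rho"
  have \<tau>: "\<tau> > 0" and \<tau>': "\<sigma> * \<tau> > 0" and \<tau>'_eq: "\<sigma> * mu / rho = \<sigma> * \<tau>"
    using rho mu \<sigma> by (simp_all add: \<tau>_def)
  define z0 z1 where "z0 = zpt rho mu w" and "z1 = zpt rho (\<sigma> * mu) w"
  define r0 r1 where "r0 = resid rho mu w" and "r1 = resid rho (\<sigma> * mu) w"
  define W0 W1 where "W0 = Wat rho mu w" and "W1 = Wat rho (\<sigma> * mu) w"
  have W0p: "positive_operator W0" and W1p: "positive_operator W1"
    using Wat_positive[OF rho] mu mu' by (simp_all add: W0_def W1_def)
  interpret W0: positive_operator W0 by (rule W0p)
  interpret W1: positive_operator W1 by (rule W1p)
  have W0_eq: "W0 = barrier_op \<tau> z0" and W1_eq: "W1 = barrier_op (\<sigma> * \<tau>) z1"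
    by (simp_all add: W0_def W1_def Wat_def z0_def z1_def \<tau>_def)
  define u where "u = full w - (1 / rho) *\<^sub>R snd w"
  have z0: "z0 = prox \<tau> u" and z1: "z1 = prox (\<sigma> * \<tau>) u"
    by (simp_all add: z0_def z1_def zpt_def u_def \<tau>_def)
  note move = central_path_move[OF \<tau> \<sigma> z0 z1]
  define \<Delta> where "\<Delta> = z0 - z1"
  have r1_eq: "r1 = r0 + \<Delta>" by (simp add: r1_def r0_def resid_def z0_def z1_def \<Delta>_def)
  have eqs: "A dx = 0" "ds + adjoint A dl = c - (adjoint A l + s)"
    "coresolvent W1 dx + (1 / rho) *\<^sub>R resolvent W1 ds = - r1"
    using N by (simp_all add: newtonN_iff[OF rho mu' x] w W1_def r1_def)
  define t where "t = (1 / rho) *\<^sub>R ds"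
  have eq3: "coresolvent W1 dx + resolvent W1 t = - r1"
    using eqs(3) by (simp add: t_def linear_scale[OF W1.resolvent_linear])
  have "ds = - adjoint A dl" using eqs(2) s by (simp add: eq_neg_iff_add_eq_0)
  then have orth: "dx \<bullet> t = 0" by (simp add: t_def eqs(1) flip: adjoint_A)
  define a d where "a = dx \<bullet> coresolvent W1 dx" and "d = t \<bullet> resolvent W1 t"
  have ad: "a \<ge> 0" "d \<ge> 0" unfolding a_def d_def by (rule W1.coresolvent_nonneg W1.resolvent_nonneg)+
  have form: "a + d = (- dx) \<bullet> r1 + (- t) \<bullet> r1"
  proof -
    have "t \<bullet> coresolvent W1 dx = - (dx \<bullet> resolvent W1 t)"
      using orth W1.resolvent_sym[of dx t] by (simp add: coresolvent_def inner_diff_right inner_commute)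
    then have "a + d = (dx + t) \<bullet> (coresolvent W1 dx + resolvent W1 t)"
      by (simp add: a_def d_def inner_add_left inner_add_right)
    then show ?thesis unfolding eq3 by (simp add: inner_add_left)
  qed
  obtain p where p: "adjoint B (coresolvent W0 (B p)) = adjoint B r0"
    and xi: "xi rho mu w = sqrt (rho / mu * (B p \<bullet> coresolvent W0 (B p)
       + ((norm r0)\<^sup>2 + mu / rho * (norm (scali z0 r0))\<^sup>2)))"
    using xi_feasible[OF rho mu x s] by (auto simp: w W0_def r0_def z0_def)
  define A0 B0 where "A0 = B p \<bullet> coresolvent W0 (B p)" and "B0 = (norm r0)\<^sup>2 + \<tau> * (norm (scali z0 r0))\<^sup>2"
  have A0: "A0 \<ge> 0" unfolding A0_def by (rule W0.coresolvent_nonneg)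
  have B0: "B0 \<ge> 0" unfolding B0_def using \<tau> by (intro add_nonneg_nonneg) auto
  have bound1: "(- dx) \<bullet> r0 \<le> sqrt a * sqrt (A0 / \<sigma>)"
  proof -
    have dxB: "B (adjoint B dx) = dx" by (rule B_adjoint_B[OF eqs(1)])
    have "dx \<bullet> r0 = dx \<bullet> coresolvent W0 (B p)"
      using adjoint_B[of "adjoint B dx" r0] adjoint_B[of "adjoint B dx" "coresolvent W0 (B p)"]
      by (simp add: dxB p)
    then have "(- dx) \<bullet> r0 = (- dx) \<bullet> coresolvent W0 (B p)" by simp
    also have "\<dots> \<le> sqrt ((- dx) \<bullet> coresolvent W0 (- dx)) * sqrt A0"
      unfolding A0_def
      by (rule psd_cauchy_schwarz[OF W0.coresolvent_linear W0.coresolvent_sym W0.coresolvent_nonneg])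
    also have "(- dx) \<bullet> coresolvent W0 (- dx) \<le> 1 / \<sigma> * a"
    proof -
      have "y \<bullet> W0 y \<le> 1 / \<sigma> * (y \<bullet> W1 y)" for y
        using move(1)[of y] \<tau> \<sigma> by (simp add: W0_eq W1_eq barrier_op_form power_mono)
      from coresolvent_mono[OF W0p W1p _ this, of dx] \<sigma> show ?thesis
        by (simp add: a_def linear_neg[OF W0.coresolvent_linear])
    qed
    finally have "(- dx) \<bullet> r0 \<le> sqrt (1 / \<sigma> * a) * sqrt A0" using A0 by (simp add: mult_right_mono)
    then show ?thesis by (simp add: real_sqrt_mult real_sqrt_divide)
  qed
  have bound2: "(- t) \<bullet> r0 \<le> sqrt d * sqrt (B0 / \<sigma>)"
  proof -
    have "(- t) \<bullet> r0 \<le> sqrt d * sqrt ((norm r0)\<^sup>2 + \<sigma> * \<tau> * (norm (scali z1 r0))\<^sup>2)"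
      using resolvent_dual_bound[OF \<tau>', of "- t" r0 z1]
      by (simp add: d_def linear_neg[OF W1.resolvent_linear] flip: W1_eq)
    also have "(norm r0)\<^sup>2 + \<sigma> * \<tau> * (norm (scali z1 r0))\<^sup>2 \<le> B0 / \<sigma>"
    proof -
      have "(norm (scali z1 r0))\<^sup>2 \<le> (norm (scali z0 r0) / \<sigma>)\<^sup>2" using move(2) by (intro power_mono) auto
      then have "\<sigma> * \<tau> * (norm (scali z1 r0))\<^sup>2 \<le> \<sigma> * \<tau> * (norm (scali z0 r0) / \<sigma>)\<^sup>2"
        using \<tau>' by (intro mult_left_mono) auto
      also have "\<dots> = \<tau> * (norm (scali z0 r0))\<^sup>2 / \<sigma>" using \<sigma> by (simp add: power2_eq_square)
      finally have "\<sigma> * \<tau> * (norm (scali z1 r0))\<^sup>2 \<le> \<tau> * (norm (scali z0 r0))\<^sup>2 / \<sigma>" .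
      moreover have "(norm r0)\<^sup>2 \<le> (norm r0)\<^sup>2 / \<sigma>"
        using \<sigma> by (simp add: pos_le_divide_eq mult_left_le)
      ultimately show ?thesis by (simp add: B0_def add_divide_distrib)
    qed
    finally show ?thesis using ad by (simp add: mult_left_mono)
  qed
  define N1 N2 where "N1 = (norm \<Delta>)\<^sup>2 + (norm (scal z1 \<Delta>))\<^sup>2 / (\<sigma> * \<tau>)"
    and "N2 = (norm \<Delta>)\<^sup>2 + \<sigma> * \<tau> * (norm (scali z1 \<Delta>))\<^sup>2"
  have N12: "N1 \<ge> 0" "N2 \<ge> 0"
    unfolding N1_def N2_def using \<tau>' by (auto intro!: add_nonneg_nonneg divide_nonneg_nonneg mult_nonneg_nonneg)
  have bound3: "(- dx) \<bullet> \<Delta> \<le> sqrt a * sqrt N1"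
    using coresolvent_dual_bound[OF \<tau>', of "- dx" \<Delta> z1]
    by (simp add: a_def N1_def linear_neg[OF W1.coresolvent_linear] flip: W1_eq)
  have bound4: "(- t) \<bullet> \<Delta> \<le> sqrt d * sqrt N2"
    using resolvent_dual_bound[OF \<tau>', of "- t" \<Delta> z1]
    by (simp add: d_def N2_def linear_neg[OF W1.resolvent_linear] flip: W1_eq)
  have "a + d = ((- dx) \<bullet> r0 + (- t) \<bullet> r0) + ((- dx) \<bullet> \<Delta> + (- t) \<bullet> \<Delta>)"
    unfolding form r1_eq by (simp only: inner_add_right)
  also have "\<dots> \<le> (sqrt a * sqrt (A0 / \<sigma>) + sqrt d * sqrt (B0 / \<sigma>)) + (sqrt a * sqrt N1 + sqrt d * sqrt N2)"
    using bound1 bound2 bound3 bound4 by linarith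
  also have "\<dots> \<le> sqrt (a + d) * sqrt (A0 / \<sigma> + B0 / \<sigma>) + sqrt (a + d) * sqrt (N1 + N2)"
    using ad A0 B0 N12 \<sigma> by (intro add_mono sqrt_pair_cauchy_schwarz) auto
  finally have "a + d \<le> sqrt (a + d) * (sqrt (A0 / \<sigma> + B0 / \<sigma>) + sqrt (N1 + N2))"
    by (simp add: distrib_left)
  then have main: "sqrt (a + d) \<le> sqrt (A0 / \<sigma> + B0 / \<sigma>) + sqrt (N1 + N2)"
  proof (cases "a + d = 0")
    case True
    then show ?thesis using A0 B0 N12 \<sigma> by simp
  next
    case False
    then have pos: "sqrt (a + d) > 0" using ad by simp
    have "sqrt (a + d) * sqrt (a + d) = a + d" using ad by simp
    with \<open>a + d \<le> _\<close> have "sqrt (a + d) * sqrt (a + d) \<le> sqrt (a + d) * (sqrt (A0 / \<sigma> + B0 / \<sigma>) + sqrt (N1 + N2))" by simp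
    then show ?thesis using pos by (simp only: mult_le_cancel_left_pos)
  qed
  have st: "sqrt (\<sigma> * \<tau>) > 0" using \<tau>' by simp
  have first: "sqrt (A0 / \<sigma> + B0 / \<sigma>) = sqrt (\<sigma> * \<tau>) * (xi rho mu w / \<sigma>)"
  proof -
    have "A0 / \<sigma> + B0 / \<sigma> = (\<sigma> * \<tau>) * ((rho / mu * (A0 + B0)) / \<sigma>\<^sup>2)"
      using \<sigma> rho mu by (simp add: \<tau>_def field_simps power2_eq_square)
    then have "sqrt (A0 / \<sigma> + B0 / \<sigma>) = sqrt (\<sigma> * \<tau>) * (sqrt (rho / mu * (A0 + B0)) / sqrt (\<sigma>\<^sup>2))"
      by (simp only: real_sqrt_mult real_sqrt_divide)
    also have "sqrt (\<sigma>\<^sup>2) = \<sigma>" using \<sigma> by simp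
    also have "sqrt (rho / mu * (A0 + B0)) = xi rho mu w" by (simp add: xi A0_def B0_def \<tau>_def)
    finally show ?thesis .
  qed
  have second: "sqrt (N1 + N2) \<le> sqrt (\<sigma> * \<tau>) * (sqrt (real jrank) * ((1 - \<sigma>) / \<sigma>))"
  proof -
    have "N1 + N2 = \<sigma> * \<tau> * (norm (scali z1 \<Delta> + (1 / (\<sigma> * \<tau>)) *\<^sub>R scal z1 \<Delta>))\<^sup>2"
      unfolding scal_scali_norm[OF \<tau>'] N1_def N2_def by (rule refl)
    then have "sqrt (N1 + N2) = sqrt (\<sigma> * \<tau>) * norm (scali z1 \<Delta> + (1 / (\<sigma> * \<tau>)) *\<^sub>R scal z1 \<Delta>)"
      by (simp only: real_sqrt_mult real_sqrt_abs abs_norm_cancel)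
    then show ?thesis using move(3) st unfolding \<Delta>_def by (simp only: mult_left_mono less_imp_le)
  qed
  have "step_form rho (\<sigma> * mu) w dx ds = \<sigma> * \<tau> * (norm (scali z1 (r1 + dx)))\<^sup>2 + (norm r1)\<^sup>2"
    using newton_step_form(2)[OF rho mu', of w dx ds] eqs(3) by (simp only: W1_def r1_def z1_def \<tau>'_eq)
  moreover have "step_form rho (\<sigma> * mu) w dx ds = a + d" by (simp add: step_form_def a_def d_def t_def W1_def)
  ultimately have "\<sigma> * \<tau> * (norm (scali z1 (r1 + dx)))\<^sup>2 \<le> a + d" by simp
  then have "sqrt (\<sigma> * \<tau>) * norm (scali z1 (r1 + dx)) \<le> sqrt (a + d)"
    by (metis real_sqrt_le_mono real_sqrt_mult real_sqrt_abs abs_norm_cancel)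
  also have "\<dots> \<le> sqrt (\<sigma> * \<tau>) * (xi rho mu w / \<sigma> + sqrt (real jrank) * ((1 - \<sigma>) / \<sigma>))"
    using main second unfolding first by (simp add: distrib_left)
  finally show ?thesis using st by (simp only: mult_le_cancel_left_pos z1_def r1_def)
qed

section \<open>The two phases\<close>

lemma alg1_iterate_primal_feasible:
  assumes "alg1_iterate kappa rho mu v00 t0 v t" "A (fst v00) = b"
  shows "A (fst v) = b"
  using assms
proof (induction rule: alg1_iterate.induct)
  case (step v t t' dv)
  then have "A (fst dv) = 0" by (cases v00; cases v; cases dv) (auto simp: newtonNt_def)
  with step show ?case by (simp add: linear_add[OF A_linear])
qed simp

lemma alg1_output_in_nbhd:
  assumes out: "alg1_output (1 / 10) rho mu w00 l00 t0 v0"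
  shows "v0 \<in> nbhd (1 / 10) mu rho"
proof -
  have rho: "rho > 0" and mu: "mu > 0" using out by (auto simp: alg1_output_def)
  obtain v t dv where it: "alg1_iterate (1 / 10) rho mu (xbar + B (fst w00), snd w00, l00) t0 v t"
    and delta: "delta rho mu (reduced v) \<le> 1 / 10" and N: "newtonN rho mu v dv" and v0: "v0 = v + dv"
    using out by (auto simp: alg1_output_def)
  obtain x s l where v: "v = (x, s, l)" by (cases v)
  obtain dx ds dl where dv: "dv = (dx, ds, dl)" by (cases dv)
  have x: "A x = b"
    using alg1_iterate_primal_feasible[OF it] by (simp add: v linear_add[OF A_linear] A_xbar A_B)
  define w where "w = reduced (x, s, l)"
  let ?k = "norm (scali (zpt rho mu w) (resid rho mu w + dx))"
  have N': "newtonN rho mu (x, s, l) (dx, ds, dl)" using N by (simp add: v dv)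
  have eq3: "coresolvent (Wat rho mu w) dx + (1 / rho) *\<^sub>R resolvent (Wat rho mu w) ds = - resid rho mu w"
    using N' by (simp add: newtonN_iff[OF rho mu x] w_def)
  have "?k\<^sup>2 \<le> rho / mu * step_form rho mu w dx ds"
    using rho mu by (simp add: newton_step_form(2)[OF rho mu eq3] distrib_left)
  then have "?k \<le> sqrt (rho / mu * step_form rho mu w dx ds)" by (rule real_le_rsqrt)
  also have "\<dots> = delta rho mu w" using delta_eq_step_form[OF rho mu x N'] by (simp add: w_def)
  also have "\<dots> \<le> 7 / 50" using delta by (simp add: v w_def)
  finally have "(x + dx, s + ds, l + dl) \<in> nbhd (1 / 10) mu rho"
    unfolding w_def by (rule newton_step_recenters[OF rho mu x N'])
  then show ?thesis by (simp add: v0 v dv)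
qed

text \<open>The reduction factors for which the Newton step after the update is short enough to return to the
  neighbourhood.\<close>

definition good_factor :: "real \<Rightarrow> bool" where
  "good_factor \<sigma> \<longleftrightarrow> 0 < \<sigma> \<and> \<sigma> < 1 \<and> 1 / 10 / \<sigma> + sqrt (real jrank) * ((1 - \<sigma>) / \<sigma>) \<le> 7 / 50"

lemma alg2_step_in_nbhd:
  assumes rho: "rho > 0" and mu: "mu > 0" and \<sigma>: "good_factor \<sigma>"
    and v: "v \<in> nbhd (1 / 10) mu rho" and N: "newtonN rho (\<sigma> * mu) v dv"
  shows "v + dv \<in> nbhd (1 / 10) (\<sigma> * mu) rho"
proof -
  have \<sigma>': "0 < \<sigma>" "\<sigma> < 1" using \<sigma> by (auto simp: good_factor_def)
  obtain x s l where v': "v = (x, s, l)" by (cases v)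
  obtain dx ds dl where dv: "dv = (dx, ds, dl)" by (cases dv)
  have feas: "A x = b" "adjoint A l + s = c" and xi: "xi rho mu (reduced (x, s, l)) \<le> 1 / 10"
    using v by (auto simp: v' nbhd_def)
  have N': "newtonN rho (\<sigma> * mu) (x, s, l) (dx, ds, dl)" using N by (simp add: v' dv)
  have "norm (scali (zpt rho (\<sigma> * mu) (reduced (x, s, l))) (resid rho (\<sigma> * mu) (reduced (x, s, l)) + dx))
      \<le> xi rho mu (reduced (x, s, l)) / \<sigma> + sqrt (real jrank) * ((1 - \<sigma>) / \<sigma>)"
    by (rule newton_step_after_mu_update[OF rho mu \<sigma>' feas N' refl])
  also have "xi rho mu (reduced (x, s, l)) / \<sigma> \<le> 1 / 10 / \<sigma>" using xi \<sigma>' by (intro divide_right_mono) auto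
  also have "1 / 10 / \<sigma> + sqrt (real jrank) * ((1 - \<sigma>) / \<sigma>) \<le> 7 / 50" using \<sigma> by (simp add: good_factor_def)
  finally show ?thesis
    unfolding v' dv using newton_step_recenters[OF rho _ feas(1) N'] mu \<sigma>' by simp
qed

lemma alg2_iterate_invariant:
  assumes rho: "rho > 0" and mu0: "mu0 > 0" and \<sigma>: "good_factor \<sigma>" and v0: "v0 \<in> nbhd (1 / 10) mu0 rho"
    and it: "alg2_iterate rho \<sigma> eps mu0 v0 k mu v"
  shows "mu = \<sigma> ^ k * mu0 \<and> mu > 0 \<and> v \<in> nbhd (1 / 10) mu rho"
  using it
proof (induction rule: alg2_iterate.induct)
  case start
  then show ?case using mu0 v0 by simp
next
  case (step k mu v dv)
  then have "v + dv \<in> nbhd (1 / 10) (\<sigma> * mu) rho" using alg2_step_in_nbhd[OF rho _ \<sigma>] by blast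
  then show ?case using step \<sigma> by (simp add: good_factor_def)
qed

lemma nbhd_accurate:
  assumes rho: "rho > 0" and mu: "mu > 0" "mu \<le> eps" and v: "v \<in> nbhd kappa mu rho" and kappa: "kappa \<ge> 0"
  shows "accurate kappa rho eps mu v"
proof -
  obtain x s l where v': "v = (x, s, l)" by (cases v)
  have feas: "A x = b" "adjoint A l + s = c" and xi: "xi rho mu (reduced (x, s, l)) \<le> kappa"
    using v by (auto simp: v' nbhd_def)
  let ?w = "reduced (x, s, l)"
  have "Phi rho mu x s = 2 *\<^sub>R resid rho mu ?w"
    by (simp add: Phi_def resid_def zpt_zprox[OF rho mu(1)] full_reduced[OF feas(1)] snd_reduced)
  then have "norm (Phi rho mu x s) = 2 * norm (resid rho mu ?w)" by simp
  also have "\<dots> \<le> 2 * (sqrt (mu / rho) * xi rho mu ?w)" using residual_le_xi[OF rho mu(1) feas] by simp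
  also have "sqrt (mu / rho) * xi rho mu ?w \<le> sqrt (eps / rho) * kappa"
  proof -
    have "sqrt (mu / rho) * xi rho mu ?w \<le> sqrt (mu / rho) * kappa"
      using xi rho mu by (intro mult_left_mono) auto
    also have "\<dots> \<le> sqrt (eps / rho) * kappa"
      using kappa rho mu by (intro mult_right_mono real_sqrt_le_mono divide_right_mono) auto
    finally show ?thesis .
  qed
  finally show ?thesis using feas mu by (simp add: accurate_def v' mult.commute mult.left_commute)
qed

lemma alg2_iterate_exists:
  assumes rho: "rho > 0" and mu0: "mu0 > 0" and \<sigma>: "good_factor \<sigma>" and v0: "v0 \<in> nbhd (1 / 10) mu0 rho"
    and above: "\<forall>j<k. \<not> \<sigma> ^ j * mu0 \<le> eps"
  shows "\<exists>v. alg2_iterate rho \<sigma> eps mu0 v0 k (\<sigma> ^ k * mu0) v"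
  using above
proof (induction k)
  case 0
  then show ?case by (intro exI[of _ v0]) (simp add: alg2_iterate.start)
next
  case (Suc k)
  then obtain v where it: "alg2_iterate rho \<sigma> eps mu0 v0 k (\<sigma> ^ k * mu0) v" by auto
  have \<sigma>': "\<sigma> > 0" using \<sigma> by (simp add: good_factor_def)
  obtain x s l where v: "v = (x, s, l)" by (cases v)
  have "A x = b" using alg2_iterate_invariant[OF rho mu0 \<sigma> v0 it] by (auto simp: v nbhd_def)
  then obtain dv where "newtonN rho (\<sigma> * (\<sigma> ^ k * mu0)) v dv"
    using newtonN_unique_solution[OF rho, of "\<sigma> * (\<sigma> ^ k * mu0)" x s l] \<sigma>' mu0 by (auto simp: v)
  from alg2_iterate.step[OF it _ this] Suc.prems show ?case
    by (intro exI[of _ "v + dv"]) (simp add: mult.assoc)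
qed

lemma alg2_attains_at_least_index:
  assumes rho: "rho > 0" and mu0: "mu0 > 0" and eps: "eps > 0" and \<sigma>: "good_factor \<sigma>"
    and v0: "v0 \<in> nbhd (1 / 10) mu0 rho"
    and N: "\<sigma> ^ N * mu0 \<le> eps" "\<forall>j<N. \<not> \<sigma> ^ j * mu0 \<le> eps"
  shows "alg2_attains (1 / 10) rho \<sigma> eps mu0 v0 N"
  unfolding alg2_attains_def
proof (intro conjI allI impI)
  show "alg2_input (1 / 10) rho \<sigma> eps mu0 v0"
    using assms by (simp add: alg2_input_def good_factor_def)
  fix k mu v assume it: "alg2_iterate rho \<sigma> eps mu0 v0 k mu v \<and> \<not> mu \<le> eps"
  obtain x s l where v: "v = (x, s, l)" by (cases v)
  have "mu > 0" "A x = b" using alg2_iterate_invariant[OF rho mu0 \<sigma> v0, of eps k mu v] it by (auto simp: v nbhd_def)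
  then show "\<exists>!dv. newtonN rho (\<sigma> * mu) v dv"
    unfolding v using \<sigma> by (intro newtonN_unique_solution rho) (auto simp: good_factor_def)
next
  show "\<exists>mu v. alg2_iterate rho \<sigma> eps mu0 v0 N mu v"
    using alg2_iterate_exists[OF rho mu0 \<sigma> v0 N(2)] by blast
  fix mu v assume "alg2_iterate rho \<sigma> eps mu0 v0 N mu v"
  then have "mu = \<sigma> ^ N * mu0 \<and> mu > 0 \<and> v \<in> nbhd (1 / 10) mu rho"
    by (rule alg2_iterate_invariant[OF rho mu0 \<sigma> v0])
  then show "accurate (1 / 10) rho eps mu v" using N(1) by (intro nbhd_accurate rho) auto
qed

end

section \<open>The number of iterations\<close>

lemma geometric_iteration_count:
  fixes \<sigma> L n mu0 eps :: real
  assumes L: "L > 0" and n: "n \<ge> 1" and \<sigma>: "\<sigma> = 1 - L / (2 * n + L)"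
    and eps: "eps > 0" and le: "eps \<le> mu0"
    and N: "\<forall>j<N. \<not> \<sigma> ^ j * mu0 \<le> eps"
  shows "real N \<le> (1 + 2 / L) * (1 + n * ln (mu0 / eps))"
proof -
  have ln0: "ln (mu0 / eps) \<ge> 0" using eps le by simp
  then have rhs: "(1 + 2 / L) * (1 + n * ln (mu0 / eps)) \<ge> 0" using L n by (intro mult_nonneg_nonneg add_nonneg_nonneg) auto
  show ?thesis
  proof (cases N)
    case 0 then show ?thesis using rhs by simp
  next
    case (Suc j)
    have den: "2 * n + L > 0" using L n by simp
    have \<sigma>_eq: "\<sigma> = 2 * n / (2 * n + L)" using den by (simp add: \<sigma> field_simps)
    then have \<sigma>pos: "\<sigma> > 0" using den n by simp
    have mu0: "mu0 > 0" using eps le by simp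
    have "eps < \<sigma> ^ j * mu0" using N Suc by auto
    then have "ln eps < ln (\<sigma> ^ j * mu0)" using eps \<sigma>pos mu0 by (subst ln_less_cancel_iff) auto
    then have "real j * (- ln \<sigma>) < ln (mu0 / eps)"
      using eps \<sigma>pos mu0 by (simp add: ln_mult ln_div ln_realpow)
    moreover have "L / (2 * n + L) \<le> - ln \<sigma>" using ln_le_minus_one[OF \<sigma>pos] by (simp add: \<sigma>)
    then have "real j * (L / (2 * n + L)) \<le> real j * (- ln \<sigma>)" by (intro mult_left_mono) auto
    ultimately have "real j * (L / (2 * n + L)) \<le> ln (mu0 / eps)" by linarith
    then have "real j * L \<le> ln (mu0 / eps) * (2 * n + L)" using den by (simp add: field_simps)
    also have "\<dots> \<le> ln (mu0 / eps) * (2 * n + L * n)" using ln0 L n by (intro mult_left_mono) auto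
    finally have "real j \<le> (1 + 2 / L) * (n * ln (mu0 / eps))" using L by (simp add: field_simps)
    moreover have "(1 + 2 / L) * (1 + n * ln (mu0 / eps)) = 1 + 2 / L + (1 + 2 / L) * (n * ln (mu0 / eps))"
      by (simp only: distrib_left mult_1_right)
    moreover have "2 / L \<ge> 0" using L by simp
    ultimately show ?thesis unfolding Suc of_nat_Suc by linarith
  qed
qed

lemma reduction_factor_bounds:
  fixes L n \<sigma> :: real
  assumes L: "0 < L" "L \<le> 1 / 15" and n: "n \<ge> 1" and \<sigma>: "\<sigma> = 1 - L / (2 * n + L)"
  shows "0 < \<sigma>" "\<sigma> < 1" "1 / 10 / \<sigma> + n * ((1 - \<sigma>) / \<sigma>) \<le> 7 / 50"
proof -
  have den: "2 * n + L > 0" using L n by simp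
  have \<sigma>_eq: "\<sigma> = 2 * n / (2 * n + L)" using den by (simp add: \<sigma> field_simps)
  show 0: "0 < \<sigma>" using den n by (simp add: \<sigma>_eq)
  show "\<sigma> < 1" using den L by (simp add: \<sigma>)
  \<comment> \<open>hence the update contributes exactly \<open>L / 2\<close> to the step length\<close>
  have inv: "1 / \<sigma> = 1 + L / (2 * n)" using n den by (simp add: \<sigma>_eq field_simps)
  have "n * ((1 - \<sigma>) / \<sigma>) = n * (1 / \<sigma> - 1)" using 0 by (simp add: diff_divide_distrib)
  also have "\<dots> = L / 2" using n by (simp add: inv)
  finally have 1: "n * ((1 - \<sigma>) / \<sigma>) = L / 2" .
  have "L / (2 * n) \<le> L / 2" using L n by (intro divide_left_mono) auto
  then have "1 / 10 / \<sigma> \<le> 1 / 10 * (1 + L / 2)" using inv by (simp add: field_simps)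
  also have "1 / 10 * (1 + L / 2) = 1 / 10 + L / 20" by simp
  finally show "1 / 10 / \<sigma> + n * ((1 - \<sigma>) / \<sigma>) \<le> 7 / 50" unfolding 1 using L by linarith
qed

theorem theorem12:
  fixes jmul :: "'e::euclidean_space \<Rightarrow> 'e \<Rightarrow> 'e" and e :: 'e
    and A :: "'e \<Rightarrow> real ^ 'm" and b :: "real ^ 'm" and c xbar :: 'e
    and B :: "'h::real_inner \<Rightarrow> 'e"
    and rho kappa eps gamma sigma mu0 t0 :: real
    and w00 :: "'h \<times> 'e" and l00 :: "real ^ 'm"
    and v0 :: "'e \<times> 'e \<times> (real ^ 'm)" and nu :: nat
  assumes problem: "bal_problem jmul e A b c xbar B"
    and nu: "nu = jordan_product.jrank jmul e"
    and rho: "rho > 0" and kappa: "kappa = 1 / 10" and eps: "eps > 0" and mu0: "mu0 > 0"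
    and gamma: "gamma = (2 * kappa + sqrt 2) / (kappa + sqrt 2)"
    and sigma: "sigma = 1 - ln gamma / (2 * sqrt (real nu) + ln gamma)"
    and phase1: "bal_problem.alg1_output jmul e A b c xbar B kappa rho mu0 w00 l00 t0 v0"
  shows "\<exists>N. bal_problem.alg2_attains jmul e A b c xbar B kappa rho sigma eps mu0 v0 N \<and>
    (eps \<le> mu0 \<longrightarrow>
       real N \<le> iteration_const gamma * (1 + sqrt (real nu) * ln (mu0 / eps)))"
proof -
  interpret bal_problem jmul e A b c xbar B by (rule problem)
  define L where "L = ln gamma"
  have sqrt2: "sqrt 2 \<ge> 7 / 5" by (rule real_le_rsqrt) (simp add: power2_eq_square)
  have "gamma = 1 + (1 / 10) / (1 / 10 + sqrt 2)"
    unfolding gamma kappa using sqrt2 by (simp add: field_simps)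
  moreover have "(1 / 10) / (1 / 10 + sqrt 2) > 0" using sqrt2 by simp
  moreover have "(1 / 10) / (1 / 10 + sqrt 2) \<le> 1 / 15" using sqrt2 by (simp add: field_simps)
  ultimately have g: "gamma > 1" "gamma - 1 \<le> 1 / 15" by simp_all
  have L: "0 < L" "L \<le> 1 / 15"
    unfolding L_def using g ln_le_minus_one[of gamma] by auto
  have n: "sqrt (real nu) \<ge> 1" using jrank_pos by (simp add: nu)
  have \<sigma>: "sigma = 1 - L / (2 * sqrt (real nu) + L)" by (simp add: sigma L_def)
  have good: "good_factor sigma"
    using reduction_factor_bounds[OF L n \<sigma>] by (simp add: good_factor_def nu)
  have v0: "v0 \<in> nbhd (1 / 10) mu0 rho" using phase1 unfolding kappa by (rule alg1_output_in_nbhd)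
  define N where "N = (LEAST k. sigma ^ k * mu0 \<le> eps)"
  have "\<exists>k. sigma ^ k * mu0 \<le> eps"
  proof -
    obtain k where "sigma ^ k < eps / mu0"
      using real_arch_pow_inv[of "eps / mu0" sigma] eps mu0 good by (auto simp: good_factor_def)
    then show ?thesis using mu0 by (intro exI[of _ k]) (simp add: field_simps)
  qed
  then have N1: "sigma ^ N * mu0 \<le> eps" unfolding N_def by (rule LeastI_ex)
  have N2: "\<forall>j<N. \<not> sigma ^ j * mu0 \<le> eps" unfolding N_def using not_less_Least by blast
  have "alg2_attains kappa rho sigma eps mu0 v0 N"
    unfolding kappa by (rule alg2_attains_at_least_index[OF rho mu0 eps good v0 N1 N2])
  moreover have "real N \<le> iteration_const gamma * (1 + sqrt (real nu) * ln (mu0 / eps))" if "eps \<le> mu0"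
    using geometric_iteration_count[OF L(1) n \<sigma> eps that N2] by (simp add: iteration_const_def L_def)
  ultimately show ?thesis by blast
qed

end
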